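(* Let $k$ be a field of characteristic $0$, $\mathfrak{g}$ a finite dimensional split simple Lie algebra over $k$, $R$ a commutative, associative, unital $k$-algebra, and $S/R$ a finite Galois extension of rings with Galois group $G$. Let $u=(u_g)_{g\in G}$ be a cocycle in $Z^1\big(G,\mathrm{Aut}_S(\mathfrak{g}_S)\big)$, where $\mathfrak{g}_S=\mathfrak{g}\otimes_k S$, and for each $g\in G$ let $\widehat{u}_g\in\mathrm{Aut}_k(\widehat{\mathfrak{g}_S})$ be the unique lift of $u_g$ to the universal central extension $\widehat{\mathfrak{g}_S}=\mathfrak{g}_S\oplus\Omega_S/dS$. Put $\mathcal{L}_u=\{x\in\mathfrak{g}_S : u_g\,({}^{g}x)=x\ \forall g\in G\}$ and $\mathcal{L}_{\widehat{u}}=\{x\in\widehat{\mathfrak{g}_S} : \widehat{u}_g\,({}^{g}x)=x\ \forall g\in G\}$. The following conditions are equivalent: (1) $\mathcal{L}_{\widehat{u}}=\mathcal{L}_u\oplus\Omega_R/dR$ and $\mathcal{L}_u$ is stable under the action of the Galois group $G$. (2) $\widehat{u}_g(\mathcal{L}_u)\subset\mathcal{L}_u$ for all $g\in G$. If these conditions hold, then every $\theta\in\mathrm{Aut}_R(\mathcal{L}_u)$ lifts to an automorphism $\widehat{\theta}$ of $\mathcal{L}_{\widehat{u}}$ that fixes the centre of $\mathcal{L}_{\widehat{u}}$ pointwise.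
   Context: For a commutative, associative, unital $k$-algebra $A$, $\mathfrak{g}_A=\mathfrak{g}\otimes_k A$ is the Lie algebra with bracket $[x\otimes a,y\otimes b]=[x,y]\otimes ab$; it is both a $k$-Lie algebra and an $A$-Lie algebra. $\mathrm{Aut}_A$ and $\mathrm{Aut}_k$ denote groups of $A$-linear and $k$-linear Lie algebra automorphisms. $(\Omega_A,d)$ is the $A$-module of Kähler differentials of $A/k$, $dA\subset\Omega_A$ is the $k$-subspace $d(A)$, and $\overline{\omega}$ is the class of $\omega\in\Omega_A$ in the $k$-space $\Omega_A/dA$. Let $(\cdot|\cdot)$ be the Killing form of $\mathfrak{g}$. The $k$-Lie algebra $\widehat{\mathfrak{g}_A}$ has underlying space $\mathfrak{g}_A\oplus\Omega_A/dA$, with $\Omega_A/dA$ central and bracket satisfying $[x\otimes a,y\otimes b]_{\widehat{\mathfrak{g}_A}}=[x,y]\otimes ab+(x|y)\overline{a\,db}$. With the projection $\pi:\widehat{\mathfrak{g}_A}\to\mathfrak{g}_A$ with kernel $\Omega_A/dA$, it is the universal central extension of the perfect centreless $k$-Lie algebra $\mathfrak{g}_A$ (Kassel). Every $\theta\in\mathrm{Aut}_k(\mathfrak{g}_A)$ has a unique lift $\widehat{\theta}\in\mathrm{Aut}_k(\widehat{\mathfrak{g}_A})$, i.e. a unique $k$-Lie algebra automorphism with $\pi\circ\widehat{\theta}=\theta\circ\pi$ (known fact). $S/R$ finite Galois with group $G$: $G$ is a finite group acting on $S$ by $R$-algebra automorphisms, $S^G=R$, and $S\otimes_R S\to\prod_{g\in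 G}S$, $a\otimes b\mapsto(a\,{}^{g}b)_g$ is an isomorphism. $G$ acts on $\mathfrak{g}_S$ by ${}^{g}(x\otimes s)=x\otimes{}^{g}s$, on $\Omega_S/dS$ by ${}^{g}(\overline{s\,dt})=\overline{{}^{g}s\,d\,{}^{g}t}$, and on $\widehat{\mathfrak{g}_S}$ by ${}^{g}(x\otimes s+z)=x\otimes{}^{g}s+{}^{g}z$. $G$ acts on $\mathrm{Aut}_S(\mathfrak{g}_S)$ by conjugation, ${}^{g}\theta=g\circ\theta\circ g^{-1}$. A cocycle $u\in Z^1(G,\mathrm{Aut}_S(\mathfrak{g}_S))$ is a family $(u_g)_{g\in G}$ with $u_{gh}=u_g\,{}^{g}u_h$ for all $g,h\in G$. $\mathfrak{g}_S$ (hence $\mathcal{L}_u$) and $\Omega_S/dS$ are regarded as subspaces of $\widehat{\mathfrak{g}_S}=\mathfrak{g}_S\oplus\Omega_S/dS$. The canonical map $\Omega_R/dR\to\Omega_S/dS$ is injective with image $(\Omega_S/dS)^G$, and $\Omega_R/dR$ is identified with this subspace. $\mathcal{L}_u$ is an $R$-Lie algebra, $\mathcal{L}_{\widehat{u}}$ is a $k$-Lie subalgebra of $\widehat{\mathfrak{g}_S}$, and $\pi$ restricts to a central extension $\mathcal{L}_{\widehat{u}}\to\mathcal{L}_u$ of $k$-Lie algebras. An automorphism $\widehat{\theta}\in\mathrm{Aut}_k(\mathcal{L}_{\widehat{u}})$ is a lift of $\theta\in\mathrm{Aut}_R(\mathcal{L}_u)$ if $\pi\circ\widehat{\theta}=\theta\circ\pi$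 on $\mathcal{L}_{\widehat{u}}$. *)

theory Defs
  imports Complex_Main "HOL-Library.Poly_Mapping" "HOL-Library.FuncSet" "HOL-Algebra.Group_Action"
begin

section \<open>Finite-dimensional split simple Lie algebras\<close>

locale lie_algebra = vector_space scale
  for scale :: "'k::field \<Rightarrow> 'g::ab_group_add \<Rightarrow> 'g" +
  fixes br :: "'g \<Rightarrow> 'g \<Rightarrow> 'g"
  assumes br_linear_left: "Vector_Spaces.linear scale scale (\<lambda>x. br x y)"
    and br_linear_right: "Vector_Spaces.linear scale scale (br x)"
    and br_self: "br x x = 0"
    and jacobi: "br x (br y z) + br y (br z x) + br z (br x y) = 0"
begin

definition lie_ideal :: "'g set \<Rightarrow> bool" where
  "lie_ideal I \<longleftrightarrow> subspace I \<and> (\<forall>x. \<forall>y\<in>I. br x y \<in> I)"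

definition simple :: bool where
  "simple \<longleftrightarrow> (\<exists>x y. br x y \<noteq> 0) \<and> (\<forall>I. lie_ideal I \<longrightarrow> I = {0} \<or> I = UNIV)"

definition lie_subalgebra :: "'g set \<Rightarrow> bool" where
  "lie_subalgebra H \<longleftrightarrow> subspace H \<and> (\<forall>x\<in>H. \<forall>y\<in>H. br x y \<in> H)"

primrec lower_central :: "'g set \<Rightarrow> nat \<Rightarrow> 'g set" where
  "lower_central H 0 = H"
| "lower_central H (Suc n) = span {br x y | x y. x \<in> H \<and> y \<in> lower_central H n}"

definition normalizer :: "'g set \<Rightarrow> 'g set" where
  "normalizer H = {x. \<forall>h\<in>H. br x h \<in> H}"

definition cartan_subalgebra :: "'g set \<Rightarrow> bool" where
  "cartan_subalgebra H \<longleftrightarrow>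
     lie_subalgebra H \<and> (\<exists>n. lower_central H n = {0}) \<and> normalizer H = H"

definition triangularizable :: "('g \<Rightarrow> 'g) \<Rightarrow> bool" where
  "triangularizable f \<longleftrightarrow>
     (\<exists>bs. distinct bs \<and> independent (set bs) \<and> span (set bs) = UNIV \<and>
        (\<forall>i<length bs. f (bs ! i) \<in> span (set (take (Suc i) bs))))"

text \<open>Split in the sense of Bourbaki: some Cartan subalgebra acts by triangularizable
  endomorphisms.\<close>

definition split :: bool where
  "split \<longleftrightarrow> (\<exists>H. cartan_subalgebra H \<and> (\<forall>h\<in>H. triangularizable (br h)))"

definition finite_dim :: bool where
  "finite_dim \<longleftrightarrow> (\<exists>B. finite B \<and> span B = UNIV)"

definition trace :: "('g \<Rightarrow> 'g) \<Rightarrow> 'k" where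
  "trace f = (\<Sum>b\<in>extend_basis {}. representation (extend_basis {}) (f b) b)"

definition killing :: "'g \<Rightarrow> 'g \<Rightarrow> 'k" where
  "killing x y = trace (br x \<circ> br y)"

end

section \<open>Free modules and their quotients\<close>

text \<open>Commutative unital rings are types of sort \<open>{comm_ring, comm_monoid_mult}\<close>; unlike
  \<open>comm_ring_1\<close> this sort does not exclude the zero ring. A commutative algebra over such a
  ring is given by its structure homomorphism.\<close>

definition unital_ring_hom ::
  "('a::{comm_ring,comm_monoid_mult} \<Rightarrow> 'b::{comm_ring,comm_monoid_mult}) \<Rightarrow> bool" where
  "unital_ring_hom f \<longleftrightarrow>
     (\<forall>x y. f (x + y) = f x + f y) \<and> (\<forall>x y. f (x * y) = f x * f y) \<and> f 1 = 1"

definition alg_scale ::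
  "('a::{comm_ring,comm_monoid_mult} \<Rightarrow> 'b::{comm_ring,comm_monoid_mult}) \<Rightarrow> 'a \<Rightarrow> 'b \<Rightarrow> 'b" where
  "alg_scale f c x = f c * x"

text \<open>The free \<open>'c\<close>-module on the set \<open>'b\<close> is the type \<open>'b \<Rightarrow>\<^sub>0 'c\<close>.\<close>

definition fscale :: "'c::{comm_ring,comm_monoid_mult} \<Rightarrow> ('b \<Rightarrow>\<^sub>0 'c) \<Rightarrow> ('b \<Rightarrow>\<^sub>0 'c)" where
  "fscale c = Poly_Mapping.map ((*) c)"

definition gen :: "'b \<Rightarrow> ('b \<Rightarrow>\<^sub>0 'c::{comm_ring,comm_monoid_mult})" where
  "gen b = Poly_Mapping.single b 1"

definition fspan :: "('b \<Rightarrow>\<^sub>0 'c::{comm_ring,comm_monoid_mult}) set \<Rightarrow> ('b \<Rightarrow>\<^sub>0 'c) set" where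
  "fspan X = \<Inter>{N. X \<subseteq> N \<and> 0 \<in> N \<and> (\<forall>p\<in>N. \<forall>q\<in>N. p + q \<in> N) \<and> (\<forall>c. \<forall>p\<in>N. fscale c p \<in> N)}"

definition lin_ext :: "('c \<Rightarrow> 'm \<Rightarrow> 'm) \<Rightarrow> ('b \<Rightarrow> 'm) \<Rightarrow> ('b \<Rightarrow>\<^sub>0 'c::zero) \<Rightarrow> 'm::ab_group_add" where
  "lin_ext scale f p = (\<Sum>b\<in>Poly_Mapping.keys p. scale (Poly_Mapping.lookup p b) (f b))"

definition coset :: "'v::ab_group_add set \<Rightarrow> 'v \<Rightarrow> 'v set" where
  "coset N p = {(p, q). p - q \<in> N} `` {p}"

definition quot :: "'v::ab_group_add set \<Rightarrow> 'v set set" where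
  "quot N = UNIV // {(p, q). p - q \<in> N}"

text \<open>Unary and binary operations induced on quotients by operations on representatives.\<close>

definition lift1 :: "'w::ab_group_add set \<Rightarrow> ('v \<Rightarrow> 'w) \<Rightarrow> 'v set \<Rightarrow> 'w set" where
  "lift1 N f X = (\<Union>p\<in>X. coset N (f p))"

definition lift2 :: "'w::ab_group_add set \<Rightarrow> ('v \<Rightarrow> 'v \<Rightarrow> 'w) \<Rightarrow> 'v set \<Rightarrow> 'v set \<Rightarrow> 'w set" where
  "lift2 N f X Y = (\<Union>p\<in>X. \<Union>q\<in>Y. coset N (f p q))"

section \<open>Tensor products\<close>

text \<open>\<open>quot (tensor_null sV sW)\<close> is the tensor product of the modules \<open>'v\<close> and \<open>'w\<close>.\<close>

definition tensor_null ::
  "('c \<Rightarrow> 'v \<Rightarrow> 'v) \<Rightarrow> ('c \<Rightarrow> 'w \<Rightarrow> 'w) \<Rightarrow>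
     ('v::ab_group_add \<times> 'w::ab_group_add \<Rightarrow>\<^sub>0 'c::{comm_ring,comm_monoid_mult}) set" where
  "tensor_null sV sW = fspan
     ({gen (x + x', y) - gen (x, y) - gen (x', y) | x x' y. True} \<union>
      {gen (x, y + y') - gen (x, y) - gen (x, y') | x y y'. True} \<union>
      {gen (sV c x, y) - fscale c (gen (x, y)) | c x y. True} \<union>
      {gen (x, sW c y) - fscale c (gen (x, y)) | c x y. True})"

section \<open>Finite Galois extensions of rings\<close>

text \<open>The map \<open>S \<otimes>\<^sub>R S \<rightarrow> \<Prod>\<^sub>g S\<close>, \<open>a \<otimes> b \<mapsto> (a \<cdot> \<^sup>gb)\<^sub>g\<close>, evaluated on a coset. It is a
  homomorphism by construction, so that it is an isomorphism iff it is bijective.\<close>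

definition galois_map ::
  "('r::{comm_ring,comm_monoid_mult} \<Rightarrow> 's::{comm_ring,comm_monoid_mult}) \<Rightarrow> ('c, 'm) monoid_scheme \<Rightarrow>
     ('c \<Rightarrow> 's \<Rightarrow> 's) \<Rightarrow> ('s \<times> 's \<Rightarrow>\<^sub>0 'r) set \<Rightarrow> 'c \<Rightarrow> 's" where
  "galois_map \<iota> G act X =
     (\<lambda>g\<in>carrier G. the_elem (lin_ext (alg_scale \<iota>) (\<lambda>(a, b). a * act g b) ` X))"

definition galois_extension ::
  "('r::{comm_ring,comm_monoid_mult} \<Rightarrow> 's::{comm_ring,comm_monoid_mult}) \<Rightarrow> ('c, 'm) monoid_scheme \<Rightarrow>
     ('c \<Rightarrow> 's \<Rightarrow> 's) \<Rightarrow> bool" where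
  "galois_extension \<iota> G act \<longleftrightarrow>
     unital_ring_hom \<iota> \<and> inj \<iota> \<and>
     finite (carrier G) \<and> group_action G UNIV act \<and>
     (\<forall>g\<in>carrier G. unital_ring_hom (act g) \<and> (\<forall>r. act g (\<iota> r) = \<iota> r)) \<and>
     {s. \<forall>g\<in>carrier G. act g s = s} = range \<iota> \<and>
     bij_betw (galois_map \<iota> G act) (quot (tensor_null (alg_scale \<iota>) (alg_scale \<iota>)))
       (carrier G \<rightarrow>\<^sub>E UNIV)"

section \<open>Kaehler differentials modulo exact differentials\<close>

text \<open>Here \<open>gen a\<close> stands for \<open>da\<close> and \<open>Poly_Mapping.single a b\<close> for \<open>b da\<close>; \<open>\<kappa>\<close> is the structure
  homomorphism of the \<open>'k\<close>-algebra \<open>'a\<close>.\<close>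

definition kaehler_null ::
  "('k::{comm_ring,comm_monoid_mult} \<Rightarrow> 'a) \<Rightarrow> ('a::{comm_ring,comm_monoid_mult} \<Rightarrow>\<^sub>0 'a) set" where
  "kaehler_null \<kappa> = fspan
     ({gen (a + b) - gen a - gen b | a b. True} \<union>
      {gen (\<kappa> c * a) - fscale (\<kappa> c) (gen a) | c a. True} \<union>
      {gen (a * b) - fscale a (gen b) - fscale b (gen a) | a b. True})"

definition kaehler_d ::
  "('k::{comm_ring,comm_monoid_mult} \<Rightarrow> 'a) \<Rightarrow> 'a::{comm_ring,comm_monoid_mult} \<Rightarrow> ('a \<Rightarrow>\<^sub>0 'a) set" where
  "kaehler_d \<kappa> a = coset (kaehler_null \<kappa>) (gen a)"

text \<open>The quotient \<open>\<Omega>\<^sub>A/dA\<close> is formed in one step, as the quotient of the free module by the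
  preimage of \<open>dA\<close> under the projection onto \<open>\<Omega>\<^sub>A = quot (kaehler_null \<kappa>)\<close>.\<close>

definition exact_null ::
  "('k::{comm_ring,comm_monoid_mult} \<Rightarrow> 'a) \<Rightarrow> ('a::{comm_ring,comm_monoid_mult} \<Rightarrow>\<^sub>0 'a) set" where
  "exact_null \<kappa> = {p. coset (kaehler_null \<kappa>) p \<in> range (kaehler_d \<kappa>)}"

definition kaehler_mod_exact ::
  "('k::{comm_ring,comm_monoid_mult} \<Rightarrow> 'a) \<Rightarrow> ('a::{comm_ring,comm_monoid_mult} \<Rightarrow>\<^sub>0 'a) set set" where
  "kaehler_mod_exact \<kappa> = quot (exact_null \<kappa>)"

text \<open>The map \<open>\<Omega>\<^sub>A/dA \<rightarrow> \<Omega>\<^sub>B/dB\<close>, \<open>a da' \<mapsto> f(a) df(a')\<close>, induced by \<open>f : A \<rightarrow> B\<close>; here \<open>\<kappa>\<close>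
  is the structure homomorphism of \<open>B\<close>.\<close>

definition kaehler_map ::
  "('k::{comm_ring,comm_monoid_mult} \<Rightarrow> 'b) \<Rightarrow> ('a \<Rightarrow> 'b) \<Rightarrow>
     ('a::{comm_ring,comm_monoid_mult} \<Rightarrow>\<^sub>0 'a) set \<Rightarrow> ('b::{comm_ring,comm_monoid_mult} \<Rightarrow>\<^sub>0 'b) set" where
  "kaehler_map \<kappa> f = lift1 (exact_null \<kappa>)
     (\<lambda>p. \<Sum>a\<in>Poly_Mapping.keys p. Poly_Mapping.single (f a) (f (Poly_Mapping.lookup p a)))"

section \<open>Lie algebras with an explicit carrier\<close>

record ('c, 'l) lie_alg = "'l partial_object" +
  lzero :: 'l
  ladd :: "'l \<Rightarrow> 'l \<Rightarrow> 'l"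
  lscale :: "'c \<Rightarrow> 'l \<Rightarrow> 'l"
  lbr :: "'l \<Rightarrow> 'l \<Rightarrow> 'l"

text \<open>As for \<^const>\<open>Bij\<close>, automorphisms are extensional functions.\<close>

definition Aut :: "('c, 'l) lie_alg \<Rightarrow> ('l \<Rightarrow> 'l) set" where
  "Aut L = {f \<in> Bij (carrier L).
     (\<forall>x\<in>carrier L. \<forall>y\<in>carrier L. f (ladd L x y) = ladd L (f x) (f y)) \<and>
     (\<forall>c. \<forall>x\<in>carrier L. f (lscale L c x) = lscale L c (f x)) \<and>
     (\<forall>x\<in>carrier L. \<forall>y\<in>carrier L. f (lbr L x y) = lbr L (f x) (f y))}"

definition center :: "('c, 'l) lie_alg \<Rightarrow> 'l set" where
  "center L = {z \<in> carrier L. \<forall>x\<in>carrier L. lbr L z x = lzero L}"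

definition restrict_scalars :: "('b \<Rightarrow> 'c) \<Rightarrow> ('c, 'l) lie_alg \<Rightarrow> ('b, 'l) lie_alg" where
  "restrict_scalars f L =
     \<lparr>carrier = carrier L, lzero = lzero L, ladd = ladd L, lscale = (\<lambda>b. lscale L (f b)), lbr = lbr L\<rparr>"

section \<open>Current algebras and their universal central extensions\<close>

text \<open>From here on \<open>\<kappa>\<close> is the structure homomorphism of the \<open>'k\<close>-algebra \<open>'s\<close>, and \<open>sg\<close>, \<open>br\<close> are
  the scalar multiplication and the bracket of the Lie algebra \<open>'g\<close> over \<open>'k\<close>.\<close>

definition current_null ::
  "('k::field \<Rightarrow> 'g::ab_group_add \<Rightarrow> 'g) \<Rightarrow> ('k \<Rightarrow> 's::{comm_ring,comm_monoid_mult}) \<Rightarrow>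
     ('g \<times> 's \<Rightarrow>\<^sub>0 'k) set" where
  "current_null sg \<kappa> = tensor_null sg (alg_scale \<kappa>)"

text \<open>The map \<open>x \<otimes> s \<mapsto> x \<otimes> f(s)\<close>.\<close>

definition current_map ::
  "('k::field \<Rightarrow> 'g::ab_group_add \<Rightarrow> 'g) \<Rightarrow> ('k \<Rightarrow> 's::{comm_ring,comm_monoid_mult}) \<Rightarrow>
     ('s \<Rightarrow> 's) \<Rightarrow> ('g \<times> 's \<Rightarrow>\<^sub>0 'k) set \<Rightarrow> ('g \<times> 's \<Rightarrow>\<^sub>0 'k) set" where
  "current_map sg \<kappa> f = lift1 (current_null sg \<kappa>) (lin_ext fscale (\<lambda>(x, s). gen (x, f s)))"

definition current_algebra ::
  "('k::field \<Rightarrow> 'g::ab_group_add \<Rightarrow> 'g) \<Rightarrow> ('g \<Rightarrow> 'g \<Rightarrow> 'g) \<Rightarrow>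
     ('k \<Rightarrow> 's::{comm_ring,comm_monoid_mult}) \<Rightarrow> ('s, ('g \<times> 's \<Rightarrow>\<^sub>0 'k) set) lie_alg" where
  "current_algebra sg br \<kappa> =
     \<lparr>carrier = quot (current_null sg \<kappa>),
      lzero = coset (current_null sg \<kappa>) 0,
      ladd = lift2 (current_null sg \<kappa>) (+),
      lscale = (\<lambda>a. current_map sg \<kappa> ((*) a)),
      lbr = lift2 (current_null sg \<kappa>)
        (\<lambda>p q. lin_ext fscale (\<lambda>(x, a). lin_ext fscale (\<lambda>(y, b). gen (br x y, a * b)) q) p)\<rparr>"

text \<open>The bilinear map with \<open>(x \<otimes> a, y \<otimes> b) \<mapsto> (x|y) a db\<close> modulo exact differentials.\<close>

definition uce_cocycle ::
  "('k::field \<Rightarrow> 'g::ab_group_add \<Rightarrow> 'g) \<Rightarrow> ('g \<Rightarrow> 'g \<Rightarrow> 'g) \<Rightarrow>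
     ('k \<Rightarrow> 's::{comm_ring,comm_monoid_mult}) \<Rightarrow>
     ('g \<times> 's \<Rightarrow>\<^sub>0 'k) set \<Rightarrow> ('g \<times> 's \<Rightarrow>\<^sub>0 'k) set \<Rightarrow> ('s \<Rightarrow>\<^sub>0 's) set" where
  "uce_cocycle sg br \<kappa> = lift2 (exact_null \<kappa>)
     (\<lambda>p q. lin_ext (\<lambda>c. fscale (\<kappa> c))
        (\<lambda>(x, a). lin_ext (\<lambda>c. fscale (\<kappa> c))
           (\<lambda>(y, b). fscale (\<kappa> (lie_algebra.killing sg br x y)) (Poly_Mapping.single b a)) q) p)"

definition uce ::
  "('k::field \<Rightarrow> 'g::ab_group_add \<Rightarrow> 'g) \<Rightarrow> ('g \<Rightarrow> 'g \<Rightarrow> 'g) \<Rightarrow>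
     ('k \<Rightarrow> 's::{comm_ring,comm_monoid_mult}) \<Rightarrow>
     ('k, ('g \<times> 's \<Rightarrow>\<^sub>0 'k) set \<times> ('s \<Rightarrow>\<^sub>0 's) set) lie_alg" where
  "uce sg br \<kappa> =
     (let L = restrict_scalars \<kappa> (current_algebra sg br \<kappa>); N = exact_null \<kappa> in
      \<lparr>carrier = carrier L \<times> kaehler_mod_exact \<kappa>,
       lzero = (lzero L, coset N 0),
       ladd = (\<lambda>(X, Z) (Y, W). (ladd L X Y, lift2 N (+) Z W)),
       lscale = (\<lambda>c (X, Z). (lscale L c X, lift1 N (fscale (\<kappa> c)) Z)),
       lbr = (\<lambda>(X, Z) (Y, W). (lbr L X Y, uce_cocycle sg br \<kappa> X Y))\<rparr>)"

text \<open>The projection of \<^const>\<open>uce\<close> onto the current algebra is \<^const>\<open>fst\<close>. The unique lift of an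
  automorphism:\<close>

definition uce_lift ::
  "('k::field \<Rightarrow> 'g::ab_group_add \<Rightarrow> 'g) \<Rightarrow> ('g \<Rightarrow> 'g \<Rightarrow> 'g) \<Rightarrow>
     ('k \<Rightarrow> 's::{comm_ring,comm_monoid_mult}) \<Rightarrow>
     (('g \<times> 's \<Rightarrow>\<^sub>0 'k) set \<Rightarrow> ('g \<times> 's \<Rightarrow>\<^sub>0 'k) set) \<Rightarrow>
     ('g \<times> 's \<Rightarrow>\<^sub>0 'k) set \<times> ('s \<Rightarrow>\<^sub>0 's) set \<Rightarrow> ('g \<times> 's \<Rightarrow>\<^sub>0 'k) set \<times> ('s \<Rightarrow>\<^sub>0 's) set" where
  "uce_lift sg br \<kappa> \<theta> = (THE f. f \<in> Aut (uce sg br \<kappa>) \<and>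
     (\<forall>x\<in>carrier (uce sg br \<kappa>). fst (f x) = \<theta> (fst x)))"

definition uce_map ::
  "('k::field \<Rightarrow> 'g::ab_group_add \<Rightarrow> 'g) \<Rightarrow> ('k \<Rightarrow> 's::{comm_ring,comm_monoid_mult}) \<Rightarrow> ('s \<Rightarrow> 's) \<Rightarrow>
     ('g \<times> 's \<Rightarrow>\<^sub>0 'k) set \<times> ('s \<Rightarrow>\<^sub>0 's) set \<Rightarrow> ('g \<times> 's \<Rightarrow>\<^sub>0 'k) set \<times> ('s \<Rightarrow>\<^sub>0 's) set" where
  "uce_map sg \<kappa> f = map_prod (current_map sg \<kappa> f) (kaehler_map \<kappa> f)"

section \<open>Cocycles and twisted forms\<close>

definition cocycle ::
  "('k::field \<Rightarrow> 'g::ab_group_add \<Rightarrow> 'g) \<Rightarrow> ('g \<Rightarrow> 'g \<Rightarrow> 'g) \<Rightarrow>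
     ('k \<Rightarrow> 's::{comm_ring,comm_monoid_mult}) \<Rightarrow> ('c, 'm) monoid_scheme \<Rightarrow> ('c \<Rightarrow> 's \<Rightarrow> 's) \<Rightarrow>
     ('c \<Rightarrow> ('g \<times> 's \<Rightarrow>\<^sub>0 'k) set \<Rightarrow> ('g \<times> 's \<Rightarrow>\<^sub>0 'k) set) \<Rightarrow> bool" where
  "cocycle sg br \<kappa> G act u \<longleftrightarrow>
     (\<forall>g\<in>carrier G. u g \<in> Aut (current_algebra sg br \<kappa>)) \<and>
     (\<forall>g\<in>carrier G. \<forall>h\<in>carrier G. \<forall>x\<in>carrier (current_algebra sg br \<kappa>).
        u (g \<otimes>\<^bsub>G\<^esub> h) x =
          u g (current_map sg \<kappa> (act g) (u h (current_map sg \<kappa> (act (inv\<^bsub>G\<^esub> g)) x))))"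

definition twisted_form ::
  "('k::field \<Rightarrow> 'g::ab_group_add \<Rightarrow> 'g) \<Rightarrow> ('g \<Rightarrow> 'g \<Rightarrow> 'g) \<Rightarrow>
     ('k \<Rightarrow> 's::{comm_ring,comm_monoid_mult}) \<Rightarrow> ('c, 'm) monoid_scheme \<Rightarrow> ('c \<Rightarrow> 's \<Rightarrow> 's) \<Rightarrow>
     ('c \<Rightarrow> ('g \<times> 's \<Rightarrow>\<^sub>0 'k) set \<Rightarrow> ('g \<times> 's \<Rightarrow>\<^sub>0 'k) set) \<Rightarrow> ('g \<times> 's \<Rightarrow>\<^sub>0 'k) set set" where
  "twisted_form sg br \<kappa> G act u =
     {x \<in> carrier (current_algebra sg br \<kappa>).
        \<forall>g\<in>carrier G. u g (current_map sg \<kappa> (act g) x) = x}"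

definition twisted_uce ::
  "('k::field \<Rightarrow> 'g::ab_group_add \<Rightarrow> 'g) \<Rightarrow> ('g \<Rightarrow> 'g \<Rightarrow> 'g) \<Rightarrow>
     ('k \<Rightarrow> 's::{comm_ring,comm_monoid_mult}) \<Rightarrow> ('c, 'm) monoid_scheme \<Rightarrow> ('c \<Rightarrow> 's \<Rightarrow> 's) \<Rightarrow>
     ('c \<Rightarrow> ('g \<times> 's \<Rightarrow>\<^sub>0 'k) set \<Rightarrow> ('g \<times> 's \<Rightarrow>\<^sub>0 'k) set) \<Rightarrow>
     (('g \<times> 's \<Rightarrow>\<^sub>0 'k) set \<times> ('s \<Rightarrow>\<^sub>0 's) set) set" where
  "twisted_uce sg br \<kappa> G act u =
     {x \<in> carrier (uce sg br \<kappa>).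
        \<forall>g\<in>carrier G. uce_lift sg br \<kappa> (u g) (uce_map sg \<kappa> (act g) x) = x}"

end

theory Submission
  imports Defs "HOL-Library.Function_Algebras"
begin

text \<open>
  The lift of an \<open>S\<close>-linear automorphism \<open>\<theta>\<close> of \<open>g\<^sub>S\<close> has the form
  \<open>x + z \<mapsto> \<theta> x + f x + z\<close>, so that it fixes the centre \<open>\<Omega>\<^sub>S/dS\<close> pointwise. To find \<open>f\<close>, write
  \<open>\<theta> (x \<otimes> 1) = \<Sum> \<theta>\<^sub>i x \<otimes> s\<^sub>i\<close>. Since \<open>\<theta>\<close> preserves the \<open>S\<close>-bilinear Killing form
  (\<open>killing_S_aut\<close>), the condition on \<open>f\<close> becomes \<open>f ([x, y] \<otimes> ab) = ab \<psi> x y\<close> with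
  \<open>\<psi> x y = \<Sum> (\<theta>\<^sub>i x | \<theta>\<^sub>j y) s\<^sub>i ds\<^sub>j\<close>, which is an alternating 2-cocycle of \<open>g\<close> with trivial
  coefficients. Whitehead's second lemma makes it a coboundary (\<open>whitehead_second\<close>, where the
  Casimir element gives a primitive \<open>p\<close> explicitly), and \<open>f (x \<otimes> a)\<close> is the class of \<open>a p x\<close>
  (\<open>shift_brV\<close>). The lift is unique because the extension is perfect
  (\<open>uce_hom_unique\<close>). Both steps need the Killing form to be nonzero, hence nondegenerate; this is
  Cartan's criterion, which is proved here for a split algebra (\<open>killing_nonzero\<close>).

  Let \<open>f\<^sub>g\<close> be the map \<open>f\<close> belonging to \<open>u\<^sub>g\<close>. Condition (2) says that \<open>u\<^sub>g\<close> preserves \<open>L\<^sub>u\<close> and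
  \<open>f\<^sub>g\<close> vanishes there, whereas \<open>x + z\<close> lies in the twisted form of the extension iff
  \<open>x \<in> L\<^sub>u\<close> and \<open>f\<^sub>g (\<^sup>gx) + \<^sup>gz = z\<close> for all \<open>g\<close>. The two conditions are matched by the
  remark that if all \<open>u\<^sub>g\<close> preserve \<open>L\<^sub>u\<close>, then the cocycle identity forces
  \<open>u\<^sub>g x = \<^sup>hx\<close> with \<open>h = g\<^sup>-\<^sup>1\<close> for \<open>x \<in> L\<^sub>u\<close> (\<open>act_inv_eq_uc\<close>), and by the description of the
  Galois invariants of \<open>\<Omega>\<^sub>S/dS\<close> as the image of \<open>\<Omega>\<^sub>R/dR\<close> (\<open>invariant_forms\<close>): \<open>\<Omega>\<^sub>S\<close> is generated by
  \<open>dR\<close> over \<open>S\<close>, because \<open>S/R\<close> is unramified, and in characteristic 0 one can average over \<open>G\<close>.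

  For the last assertion, \<open>x \<mapsto> u\<^sub>g (\<^sup>gx)\<close> is a semilinear action of \<open>G\<close> on \<open>g\<^sub>S\<close> with invariants
  \<open>L\<^sub>u\<close>. By Galois descent an \<open>R\<close>-automorphism \<open>\<theta>\<close> of \<open>L\<^sub>u\<close> extends to an \<open>S\<close>-automorphism of
  \<open>g\<^sub>S\<close> commuting with this action (\<open>automorphism_extension\<close>). The lift of the extension
  commutes with the lifted action, since both composites lift the same map, and therefore restricts
  to the twisted form. Its centre is contained in \<open>\<Omega>\<^sub>S/dS\<close>, as \<open>L\<^sub>u\<close> spans the centreless algebra
  \<open>g\<^sub>S\<close> over \<open>S\<close>, and there the lift is the identity.
\<close>

section \<open>Finite-dimensional Lie algebras and traces\<close>

locale finite_lie_algebra = lie_algebra sg br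
  for sg :: "'k::field_char_0 \<Rightarrow> 'g::ab_group_add \<Rightarrow> 'g" and br +
  assumes finite_dimensional: finite_dim
begin

abbreviation lin :: "('g \<Rightarrow> 'g) \<Rightarrow> bool" where
  "lin \<equiv> Vector_Spaces.linear sg sg"

definition basis :: "'g set" where
  "basis = extend_basis {}"

definition coord :: "'g \<Rightarrow> 'g \<Rightarrow> 'k" where
  "coord = representation basis"

lemma independent_basis: "independent basis" and span_basis [simp]: "span basis = UNIV"
  unfolding basis_def by (simp_all add: independent_extend_basis independent_empty)

lemma finite_basis [simp]: "finite basis"
proof -
  obtain C where "finite C" "span C = UNIV"
    using finite_dimensional unfolding finite_dim_def by blast
  then show ?thesis
    using independent_span_bound[of C basis] independent_basis by auto
qed

sublocale finite_dimensional_vector_space sg basis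
  by unfold_locales (simp_all add: independent_basis)

lemma coord_add: "coord (x + y) b = coord x b + coord y b"
  unfolding coord_def by (simp add: representation_add independent_basis)

lemma coord_scale: "coord (sg c x) b = c * coord x b"
  unfolding coord_def by (simp add: representation_scale independent_basis)

lemma coord_sum: "coord (\<Sum>i\<in>I. h i) b = (\<Sum>i\<in>I. coord (h i) b)"
  unfolding coord_def by (simp add: representation_sum independent_basis)

lemma coord_outside: "b \<notin> basis \<Longrightarrow> coord x b = 0"
  unfolding coord_def using representation_ne_zero by blast

lemma coord_basis: "b \<in> basis \<Longrightarrow> coord b c = (if c = b then 1 else 0)"
  unfolding coord_def by (auto simp add: representation_basis independent_basis)

lemma sum_coord: "(\<Sum>b\<in>basis. sg (coord x b) b) = x"
  unfolding coord_def by (rule sum_representation_eq) (simp_all add: independent_basis)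

lemma linI: "(\<And>x y. f (x + y) = f x + f y) \<Longrightarrow> (\<And>c x. f (sg c x) = sg c (f x)) \<Longrightarrow> lin f"
  by (simp add: Vector_Spaces.linear_iff vector_space_axioms)

lemma lin_add: "lin f \<Longrightarrow> f (x + y) = f x + f y"
  and lin_scale: "lin f \<Longrightarrow> f (sg c x) = sg c (f x)"
  by (simp_all add: Vector_Spaces.linear_iff)

lemma lin_zero: "lin f \<Longrightarrow> f 0 = 0"
  using lin_scale[of f 0 0] by simp

lemma lin_diff: "lin f \<Longrightarrow> f (x - y) = f x - f y"
  by (metis add_diff_cancel diff_add_cancel lin_add)

lemma lin_sum: "lin f \<Longrightarrow> f (\<Sum>i\<in>I. h i) = (\<Sum>i\<in>I. f (h i))"
  by (induction I rule: infinite_finite_induct) (simp_all add: lin_zero lin_add)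

lemma lin_compose: "lin f \<Longrightarrow> lin g \<Longrightarrow> lin (\<lambda>x. f (g x))"
  by (simp add: Vector_Spaces.linear_iff)

lemma lin_expand: "lin f \<Longrightarrow> f x = (\<Sum>b\<in>basis. sg (coord x b) (f b))"
  by (metis (no_types, lifting) lin_scale lin_sum sum.cong sum_coord)

lemma trace_eq: "trace f = (\<Sum>b\<in>basis. coord (f b) b)"
  unfolding trace_def coord_def basis_def ..

lemma trace_add: "trace (\<lambda>x. f x + g x) = trace f + trace g"
  by (simp add: trace_eq coord_add sum.distrib)

lemma trace_scale: "trace (\<lambda>x. sg c (f x)) = c * trace f"
  by (simp add: trace_eq coord_scale sum_distrib_left)

lemma trace_diff: "trace (\<lambda>x. f x - g x) = trace f - trace g"
proof -
  have "coord (x - y) b = coord x b - coord y b" for x y b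
    by (metis add_diff_cancel coord_add diff_add_cancel)
  then show ?thesis by (simp add: trace_eq sum_subtractf)
qed

lemma trace_comm:
  assumes "lin f" "lin g"
  shows "trace (\<lambda>x. f (g x)) = trace (\<lambda>x. g (f x))"
proof -
  have *: "trace (\<lambda>x. f (g x)) = (\<Sum>b\<in>basis. \<Sum>c\<in>basis. coord (g b) c * coord (f c) b)"
    if "lin f" for f g
    unfolding trace_eq by (rule sum.cong[OF refl], subst lin_expand[OF that])
      (simp add: coord_sum coord_scale)
  show ?thesis
    unfolding *[OF assms(1)] *[OF assms(2)] by (subst sum.swap) (simp add: mult.commute)
qed

text \<open>The definition of the trace refers to one chosen basis; triangular bases give access to it only after a change of basis.\<close>

lemma trace_in_basis:
  assumes C: "independent C" "span C = UNIV" and f: "lin f"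
  shows "trace f = (\<Sum>c\<in>C. representation C (f c) c)"
proof -
  have fin: "finite C" using C(1) by (rule finiteI_independent)
  have expand: "x = (\<Sum>c\<in>C. sg (representation C x c) c)" for x
    by (rule sum_representation_eq[symmetric]) (simp_all add: C fin)
  have "trace f = (\<Sum>b\<in>basis. \<Sum>c\<in>C. representation C b c * coord (f c) b)"
    unfolding trace_eq
  proof (rule sum.cong[OF refl])
    fix b
    have "f b = (\<Sum>c\<in>C. sg (representation C b c) (f c))"
      using arg_cong[OF expand[of b], of f] by (simp add: lin_sum[OF f] lin_scale[OF f])
    then show "coord (f b) b = (\<Sum>c\<in>C. representation C b c * coord (f c) b)"
      by (simp add: coord_sum coord_scale)
  qed
  also have "\<dots> = (\<Sum>c\<in>C. \<Sum>b\<in>basis. coord (f c) b * representation C b c)"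
    by (subst sum.swap) (simp add: mult.commute)
  also have "\<dots> = (\<Sum>c\<in>C. representation C (f c) c)"
  proof (rule sum.cong[OF refl])
    fix c
    have "representation C (\<Sum>b\<in>basis. sg (coord (f c) b) b) c
        = (\<Sum>b\<in>basis. coord (f c) b * representation C b c)"
      using C by (simp add: representation_sum representation_scale)
    then show "(\<Sum>b\<in>basis. coord (f c) b * representation C b c) = representation C (f c) c"
      by (simp add: sum_coord)
  qed
  finally show ?thesis .
qed

lemma lin_br: "lin (br x)" and lin_br_left: "lin (\<lambda>x. br x y)"
  by (rule br_linear_right, rule br_linear_left)

lemmas br_simps = lin_add[OF lin_br] lin_add[OF lin_br_left] lin_scale[OF lin_br]
  lin_scale[OF lin_br_left] lin_zero[OF lin_br] lin_zero[OF lin_br_left]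
  lin_diff[OF lin_br] lin_diff[OF lin_br_left]

lemma br_antisym: "br y x = - br x y"
proof -
  have "br x x + br y x + (br x y + br y y) = 0"
    using br_self[of "x + y"] by (simp only: br_simps)
  then have "br x y + br y x = 0" by (simp add: br_self add.commute)
  then show ?thesis by (simp add: add_eq_0_iff)
qed

lemma br_minus: "br (- x) y = - br x y" "br x (- y) = - br x y"
  using lin_diff[OF lin_br_left, of 0 x y] lin_diff[OF lin_br, of x 0 y] by (simp_all add: br_simps)

lemma br_derivation: "br x (br y z) = br (br x y) z + br y (br x z)"
proof -
  have "br y (br z x) = - br y (br x z)" "br z (br x y) = - br (br x y) z"
    by (metis br_antisym br_minus(2), metis br_antisym)
  then show ?thesis using jacobi[of x y z] by (simp add: algebra_simps add_eq_0_iff)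
qed

lemma killing_eq: "killing x y = trace (\<lambda>z. br x (br y z))"
  unfolding killing_def comp_def ..

lemma killing_sym: "killing x y = killing y x"
  unfolding killing_eq by (rule trace_comm) (rule lin_br)+

lemma killing_add: "killing (x + y) z = killing x z + killing y z"
  unfolding killing_eq by (simp add: br_simps trace_add)

lemma killing_scale: "killing (sg c x) z = c * killing x z"
  unfolding killing_eq by (simp add: br_simps trace_scale)

lemma killing_add_right: "killing z (x + y) = killing z x + killing z y"
  and killing_scale_right: "killing z (sg c x) = c * killing z x"
  by (metis killing_add killing_sym, metis killing_scale killing_sym)

lemma killing_zero [simp]: "killing 0 z = 0" "killing z 0 = 0"
  using killing_scale[of 0 0 z] killing_sym[of z 0] by auto

lemma killing_sum: "killing (\<Sum>i\<in>I. h i) z = (\<Sum>i\<in>I. killing (h i) z)"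
  "killing z (\<Sum>i\<in>I. h i) = (\<Sum>i\<in>I. killing z (h i))"
  by (induction I rule: infinite_finite_induct) (simp_all add: killing_add killing_add_right)

text \<open>For \<open>D\<close> a derivation the right-hand side is the trace of \<open>ad (D x) \<circ> ad y\<close>, that is, the Killing
  form of \<open>D x\<close> and \<open>y\<close>. With \<open>D\<close> itself inner this is the invariance of the Killing form.\<close>

lemma trace_bracket:
  assumes "lin D"
  shows "trace (\<lambda>z. D (br (br x y) z)) = trace (\<lambda>z. D (br x (br y z)) - br x (D (br y z)))"
proof -
  have "trace (\<lambda>z. D (br (br x y) z)) = trace (\<lambda>z. D (br x (br y z)) - D (br y (br x z)))"
    by (simp add: br_derivation[of x y] lin_add[OF assms])
  also have "\<dots> = trace (\<lambda>z. D (br x (br y z))) - trace (\<lambda>z. D (br y (br x z)))"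
    by (rule trace_diff)
  also have "trace (\<lambda>z. D (br y (br x z))) = trace (\<lambda>z. br x (D (br y z)))"
    using trace_comm[of "\<lambda>z. D (br y z)" "br x"] by (simp add: assms lin_br lin_compose)
  finally show ?thesis by (simp add: trace_diff)
qed

lemma killing_invariant: "killing (br x y) z = killing x (br y z)"
proof -
  have "killing x (br y z) = trace (\<lambda>w. br x (br y (br z w)) - br x (br z (br y w)))"
    unfolding killing_eq br_derivation[of y z] by (simp add: lin_add[OF lin_br])
  also have "\<dots> = trace (\<lambda>w. br x (br y (br z w))) - trace (\<lambda>w. br x (br z (br y w)))"
    by (rule trace_diff)
  also have "trace (\<lambda>w. br x (br z (br y w))) = trace (\<lambda>w. br y (br x (br z w)))"
    using trace_comm[of "\<lambda>w. br x (br z w)" "br y"] by (simp add: lin_br lin_compose)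
  also have "trace (\<lambda>w. br x (br y (br z w))) - \<dots> = killing (br x y) z"
    unfolding killing_eq by (simp add: trace_diff[symmetric] br_derivation[of x y])
  finally show ?thesis ..
qed

end

section \<open>Cartan's criterion for split algebras\<close>

text \<open>Eigenvalues lie in an arbitrary field of characteristic 0, where a sum of squares may vanish.
  Functionals over the prime field \<open>\<rat>\<close> move the argument to \<open>\<rat>\<close>, where it cannot.\<close>

lemma rational_functional:
  fixes x :: "'k::field_char_0"
  assumes "x \<noteq> 0"
  obtains \<phi> :: "'k \<Rightarrow> rat" where "\<And>y z. \<phi> (y + z) = \<phi> y + \<phi> z"
    "\<And>q y. \<phi> (of_rat q * y) = q * \<phi> y" "\<phi> x = 1"
proof -
  interpret Q: vector_space "\<lambda>q (y::'k). of_rat q * y"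
    by unfold_locales (simp_all add: algebra_simps of_rat_add of_rat_mult)
  have ind: "Q.independent {x}" using assms by simp
  note ind' = Q.independent_extend_basis[OF ind] and sp = Q.span_extend_basis[OF ind]
  have "x \<in> Q.extend_basis {x}" using Q.extend_basis_superset[OF ind] by simp
  then show ?thesis
    by (intro that[of "\<lambda>y. Q.representation (Q.extend_basis {x}) y x"])
      (simp_all add: Q.representation_add Q.representation_scale Q.representation_basis ind' sp)
qed

context finite_lie_algebra
begin

definition gen_eig :: "('g \<Rightarrow> 'g) \<Rightarrow> 'k \<Rightarrow> 'g set" where
  "gen_eig f l = {x. \<exists>N. ((\<lambda>v. f v - sg l v) ^^ N) x = 0}"

lemma gen_eig_preimage:
  "f x - sg l x \<in> gen_eig f l \<longleftrightarrow> x \<in> gen_eig f l" (is "?y \<in> _ \<longleftrightarrow> _")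
  if f: "lin f"
proof -
  let ?A = "\<lambda>v. f v - sg l v"
  have A0: "?A 0 = 0" using f by (metis diff_zero lin_zero scale_zero_right)
  have "\<exists>N. (?A ^^ N) ?y = 0" if "(?A ^^ N) x = 0" for N
    by (rule exI[of _ N]) (metis A0 funpow_swap1 that)
  moreover have "\<exists>N. (?A ^^ N) x = 0" if "(?A ^^ N) ?y = 0" for N
    by (rule exI[of _ "Suc N"]) (simp add: funpow_Suc_right that del: funpow.simps)
  ultimately show ?thesis unfolding gen_eig_def by blast
qed

lemma subspace_gen_eig:
  assumes f: "lin f"
  shows "subspace (gen_eig f l)"
proof -
  let ?A = "\<lambda>v. f v - sg l v"
  interpret f: Vector_Spaces.linear sg sg f by (rule f)
  have pow: "(?A ^^ N) (x + y) = (?A ^^ N) x + (?A ^^ N) y"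
    "(?A ^^ N) (sg c x) = sg c ((?A ^^ N) x)" "(?A ^^ N) 0 = 0" for N x y c
    by (induction N) (simp_all add: f.add f.scale scale_right_distrib scale_right_diff_distrib mult.commute)
  have mono: "(?A ^^ (M + N)) x = 0" if "(?A ^^ N) x = 0" for M N x
    by (simp add: funpow_add that pow)
  have "x + y \<in> gen_eig f l" if "(?A ^^ N) x = 0" "(?A ^^ M) y = 0" for x y M N
    unfolding gen_eig_def using mono[OF that(1), of M] mono[OF that(2), of N]
    by (auto intro!: exI[of _ "M + N"] simp add: pow add.commute)
  then show ?thesis
    by (intro subspaceI) (auto simp: gen_eig_def pow intro: exI[of _ 0])
qed

text \<open>On the generalized eigenspace of \<open>m \<noteq> l\<close> the map \<open>f - l\<close> is the invertible scalar \<open>m - l\<close> plus a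
  nilpotent map, hence invertible; the preimage is found without leaving the given invariant
  subspace.\<close>

lemma gen_eig_solve:
  assumes f: "lin f" and "l \<noteq> m" and U: "subspace U" "f ` U \<subseteq> U"
    and x: "x \<in> gen_eig f m" "x \<in> U"
  shows "\<exists>v\<in>U. f v - sg l v = x"
proof -
  interpret f: Vector_Spaces.linear sg sg f by (rule f)
  let ?A = "\<lambda>v. f v - sg m v"
  have "\<exists>v\<in>U. f v - sg l v = x" if "(?A ^^ N) x = 0" "x \<in> U" for N
    using that
  proof (induction N arbitrary: x)
    case 0
    then show ?case using U by (intro bexI[of _ 0]) (auto simp: f.zero subspace_0)
  next
    case (Suc N)
    have "?A x \<in> U" using Suc.prems U by (auto intro!: subspace_diff subspace_scale)
    moreover have "(?A ^^ N) (?A x) = 0" using Suc.prems(1) by (simp add: funpow_Suc_right del: funpow.simps)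
    ultimately obtain v where v: "v \<in> U" "f v - sg l v = ?A x"
      using Suc.IH by blast
    define w where "w = sg (inverse (m - l)) (x - v)"
    have "f w - sg l w = sg (inverse (m - l)) (f x - sg l x - (f v - sg l v))"
      unfolding w_def f.scale f.diff scale_left_commute[of l] by (simp add: algebra_simps)
    also have "\<dots> = sg (inverse (m - l)) (sg (m - l) x)"
      unfolding v(2) by (simp add: algebra_simps)
    also have "\<dots> = x" using \<open>l \<noteq> m\<close> by simp
    finally show ?case
      using v Suc.prems U by (intro bexI[of _ w]) (auto simp: w_def intro!: subspace_diff subspace_scale)
  qed
  with x show ?thesis unfolding gen_eig_def by auto
qed


text \<open>The derivation rule \<open>(f - (l + m)) [x, y] = [(f - l) x, y] + [x, (f - m) y]\<close> lowers one of the two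
  exponents at each application.\<close>

lemma gen_eig_derivation:
  assumes "lin f" and der: "\<And>x y. f (br x y) = br (f x) y + br x (f y)"
    and x: "x \<in> gen_eig f l" and y: "y \<in> gen_eig f m"
  shows "br x y \<in> gen_eig f (l + m)"
proof -
  let ?A = "\<lambda>l v. f v - sg l v"
  note sub = subspace_gen_eig[OF \<open>lin f\<close>, of "l + m"]
  have "br x y \<in> gen_eig f (l + m)" if "(?A l ^^ M) x = 0" "(?A m ^^ N) y = 0" for M N
    using that
  proof (induction "M + N" arbitrary: M N x y)
    case 0
    then show ?case using subspace_0[OF sub] by (simp add: br_simps)
  next
    case (Suc n)
    have *: "br (?A l x) y + br x (?A m y) \<in> gen_eig f (l + m)"
    proof (rule subspace_add[OF sub])
      show "br (?A l x) y \<in> gen_eig f (l + m)"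
      proof (cases M)
        case 0
        then show ?thesis using Suc.prems subspace_0[OF sub] \<open>lin f\<close> by (simp add: br_simps lin_zero)
      next
        case (Suc M')
        show ?thesis
          using Suc.hyps(1)[of M' N "?A l x" y] Suc.hyps(2) Suc.prems unfolding Suc
          by (simp add: funpow_Suc_right del: funpow.simps)
      qed
      show "br x (?A m y) \<in> gen_eig f (l + m)"
      proof (cases N)
        case 0
        then show ?thesis using Suc.prems subspace_0[OF sub] \<open>lin f\<close> by (simp add: br_simps lin_zero)
      next
        case (Suc N')
        show ?thesis
          using Suc.hyps(1)[of M N' x "?A m y"] Suc.hyps(2) Suc.prems unfolding Suc
          by (simp add: funpow_Suc_right del: funpow.simps)
      qed
    qed
    have "br (?A l x) y + br x (?A m y) = ?A (l + m) (br x y)"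
      by (simp add: br_simps der algebra_simps)
    then show ?case using * gen_eig_preimage[OF \<open>lin f\<close>] by simp
  qed
  with x y show ?thesis unfolding gen_eig_def by blast
qed

text \<open>A triangular basis can be corrected, one vector at a time, to consist of generalized
  eigenvectors. If \<open>b\<close> is the next vector and \<open>U\<close> the span of the earlier ones, then \<open>f b - lam b \<in> U\<close>
  for some \<open>lam\<close>. The components of this error in the generalized eigenspaces of other
  eigenvalues are values of \<open>f - lam\<close> on \<open>U\<close>, so they disappear after subtracting an element
  of \<open>U\<close> from \<open>b\<close>. This preserves the triangular shape, from which traces can be read off.\<close>

lemma triangular_gen_eigenbasis:
  assumes f: "lin f" and "triangularizable f"
  obtains n c l where "span (c ` {..<n}) = UNIV" "independent (c ` {..<n})" "inj_on c {..<n::nat}"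
    "\<And>i. i < n \<Longrightarrow> c i \<in> gen_eig f (l i)"
    "\<And>i. i < n \<Longrightarrow> f (c i) - sg (l i) (c i) \<in> span (c ` {..<i})"
proof -
  interpret f: Vector_Spaces.linear sg sg f by (rule f)
  obtain bs where bs: "distinct bs" "independent (set bs)" "span (set bs) = UNIV"
    "\<And>i. i < length bs \<Longrightarrow> f (bs ! i) \<in> span (set (take (Suc i) bs))"
    using assms(2) unfolding triangularizable_def by blast
  have "\<exists>c l. (\<forall>i\<le>n. span (c ` {..<i}) = span (set (take i bs))) \<and>
      (\<forall>i<n. c i \<in> gen_eig f (l i) \<and> f (c i) - sg (l i) (c i) \<in> span (c ` {..<i}))"
    if "n \<le> length bs" for n
    using that
  proof (induction n)
    case 0
    then show ?case by simp
  next
    case (Suc n)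
    then obtain c l where sp: "\<And>i. i \<le> n \<Longrightarrow> span (c ` {..<i}) = span (set (take i bs))"
      and ge: "\<And>i. i < n \<Longrightarrow> c i \<in> gen_eig f (l i)"
      and tri: "\<And>i. i < n \<Longrightarrow> f (c i) - sg (l i) (c i) \<in> span (c ` {..<i})"
      by (metis Suc_leD)
    define U where "U = span (c ` {..<n})"
    have subU: "subspace U" unfolding U_def by simp
    have cU: "c i \<in> U" if "i < n" for i using that by (auto simp: U_def intro: span_base)
    have fcU: "f (c i) \<in> U" if "i < n" for i
    proof -
      have "span (c ` {..<i}) \<subseteq> U" unfolding U_def using that by (intro span_mono) auto
      then have "(f (c i) - sg (l i) (c i)) + sg (l i) (c i) \<in> U"
        using tri[OF that] cU[OF that] by (intro subspace_add[OF subU] subspace_scale[OF subU]) auto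
      then show ?thesis by simp
    qed
    have fU: "f ` U \<subseteq> U"
    proof -
      have "f ` U = span (f ` c ` {..<n})" unfolding U_def by (simp add: f.span_image)
      also have "\<dots> \<subseteq> U" using fcU by (intro span_minimal subU) auto
      finally show ?thesis .
    qed
    define b where "b = bs ! n"
    have take: "set (take (Suc n) bs) = insert b (set (take n bs))"
      using Suc.prems by (simp add: b_def take_Suc_conv_app_nth)
    have "f b \<in> span (insert b (c ` {..<n}))"
    proof -
      have "f b \<in> span (insert b (set (take n bs)))"
        using bs(4)[of n] Suc.prems take by (simp add: b_def)
      then show ?thesis by (simp add: span_breakdown_eq sp[of n])
    qed
    then obtain lam where lam: "f b - sg lam b \<in> U" by (auto simp: span_breakdown_eq U_def)
    \<comment> \<open>split the error term into generalized eigenvectors and remove those that are in the image\<close>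
    have "\<exists>v\<in>U. u - (f v - sg lam v) \<in> gen_eig f lam" if "u \<in> U" for u
      using that unfolding U_def
    proof (induction rule: span_induct_alt)
      case base
      show ?case using subspace_0[OF subspace_gen_eig[OF f]]
        by (intro bexI[of _ 0]) (auto simp: f.zero span_zero)
    next
      case (step k x y)
      then obtain i where i: "i < n" "x = c i" by auto
      obtain v where v: "v \<in> U" "y - (f v - sg lam v) \<in> gen_eig f lam"
        using step.IH unfolding U_def by blast
      show ?case
      proof (cases "l i = lam")
        case True
        have "sg k x + (y - (f v - sg lam v)) \<in> gen_eig f lam"
          using v(2) ge[OF i(1)] True i(2)
          by (intro subspace_add subspace_scale subspace_gen_eig[OF f]) auto
        then show ?thesis using v(1) by (intro bexI[of _ v]) (auto simp: algebra_simps U_def)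
      next
        case False
        then obtain w where w: "w \<in> U" "f w - sg lam w = c i"
          using gen_eig_solve[OF f _ subU fU ge[OF i(1)] cU[OF i(1)], of lam] by auto
        have eq: "sg k x + y - (f (v + sg k w) - sg lam (v + sg k w)) =
            sg k x + y - (f v - sg lam v) - sg k (f w - sg lam w)"
          by (simp add: f.add f.scale scale_right_distrib scale_right_diff_distrib mult.commute)
        also have "\<dots> = y - (f v - sg lam v)" unfolding w(2) i(2) by simp
        finally show ?thesis
          using v w by (intro bexI[of _ "v + sg k w"])
            (simp_all only:, auto simp: U_def intro: span_add span_scale)
      qed
    qed
    then obtain v where v: "v \<in> U" "f b - sg lam b - (f v - sg lam v) \<in> gen_eig f lam"
      using lam by blast
    define c' where "c' = c(n := b - v)"
    define l' where "l' = l(n := lam)"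
    have c'_less: "c' ` {..<i} = c ` {..<i}" if "i \<le> n" for i using that by (auto simp: c'_def)
    have "f (b - v) - sg lam (b - v) = f b - sg lam b - (f v - sg lam v)"
      by (simp add: f.diff scale_right_diff_distrib)
    then have geb: "b - v \<in> gen_eig f lam"
      using v(2) gen_eig_preimage[OF f] by metis
    have "f v - sg lam v \<in> U" using v(1) fU subU by (auto intro: subspace_diff subspace_scale)
    then have trib: "f (b - v) - sg lam (b - v) \<in> U"
      using \<open>f (b - v) - sg lam (b - v) = _\<close> lam subU by (simp add: subspace_diff)
    have "span (c' ` {..<Suc n}) = span (insert (b - v) (c ` {..<n}))"
      using c'_less[of n] by (simp add: lessThan_Suc) (simp add: c'_def)
    also have "\<dots> = span (insert b (c ` {..<n}))"
      by (rule eq_span_insert_eq) (use v(1) in \<open>simp add: U_def span_neg\<close>)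
    also have "\<dots> = span (set (take (Suc n) bs))"
      unfolding take by (auto simp: set_eq_iff span_breakdown_eq sp)
    finally have "span (c' ` {..<i}) = span (set (take i bs))" if "i \<le> Suc n" for i
      using that sp[of i] c'_less[of i] by (cases "i = Suc n") auto
    moreover have "c' i \<in> gen_eig f (l' i) \<and> f (c' i) - sg (l' i) (c' i) \<in> span (c' ` {..<i})"
      if "i < Suc n" for i
      using that ge[of i] tri[of i] geb trib c'_less[of i] unfolding U_def
      by (cases "i = n") (auto simp: c'_def l'_def)
    ultimately show ?case by blast
  qed
  from this[OF order_refl] obtain c l where
    sp: "\<And>i. i \<le> length bs \<Longrightarrow> span (c ` {..<i}) = span (set (take i bs))" and
    ge: "\<And>i. i < length bs \<Longrightarrow> c i \<in> gen_eig f (l i)" and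
    tri: "\<And>i. i < length bs \<Longrightarrow> f (c i) - sg (l i) (c i) \<in> span (c ` {..<i})"
    by blast
  have sp': "span (c ` {..<length bs}) = UNIV" using sp[of "length bs"] bs(3) by simp
  have d: "dim (UNIV :: 'g set) = length bs"
    using dim_eq_card[of "set bs" UNIV] bs by (simp add: distinct_card)
  have le: "dim (UNIV :: 'g set) \<le> card (c ` {..<length bs})"
    by (rule dim_le_card) (simp_all add: sp')
  then have "inj_on c {..<length bs}"
    using d card_image_le[of "{..<length bs}" c] by (intro eq_card_imp_inj_on) simp_all
  moreover have "independent (c ` {..<length bs})"
    by (rule card_le_dim_spanning[of _ UNIV])
      (simp_all add: sp' d dim_UNIV[symmetric] card_image[OF calculation] del: dim_UNIV)
  ultimately show thesis using that[of c "length bs" l] sp' ge tri by blast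
qed

text \<open>Cartan's trick. For a \<open>\<rat>\<close>-linear \<open>\<phi>\<close> with values in \<open>\<rat>\<close>, let \<open>D\<close> act on the generalized eigenspace of \<open>l\<close>
  as the scalar \<open>\<phi> l\<close>. Additivity of \<open>\<phi>\<close> makes \<open>D\<close> a derivation, so for \<open>h = [x, y]\<close> the trace of \<open>D \<circ> ad h\<close> is the
  Killing form of \<open>D x\<close> and \<open>y\<close>, which is 0. This trace is also the sum of all \<open>\<phi> l * l\<close>. Applying
  \<open>\<phi>\<close> gives a vanishing sum of rational squares, so \<open>\<phi> l = 0\<close> for all eigenvalues \<open>l\<close>
  and all \<open>\<phi>\<close>, and every eigenvalue is 0.\<close>

lemma nilpotent_if_killing_zero:
  assumes kill: "\<And>x y. killing x y = 0" and h: "h \<in> span {br x y | x y. True}"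
    and tri: "triangularizable (br h)"
  shows "x \<in> gen_eig (br h) 0"
proof -
  let ?f = "br h"
  obtain c n l where sp: "span (c ` {..<n}) = UNIV" and ind: "independent (c ` {..<n})"
    and inj: "inj_on c {..<n::nat}"
    and ge: "\<And>i. i < n \<Longrightarrow> c i \<in> gen_eig ?f (l i)"
    and tr: "\<And>i. i < n \<Longrightarrow> ?f (c i) - sg (l i) (c i) \<in> span (c ` {..<i})"
    using triangular_gen_eigenbasis[OF lin_br tri, of thesis] that by blast
  let ?C = "c ` {..<n}"
  let ?rep = "representation ?C"
  note rep_simps = representation_add[OF ind] representation_scale[OF ind] representation_diff[OF ind]
  have notin: "c i \<notin> span (c ` {..<i})" if "i < n" for i
  proof -
    have "c ` {..<i} \<subseteq> ?C - {c i}" using that inj by (auto dest: inj_onD)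
    then have "span (c ` {..<i}) \<subseteq> span (?C - {c i})" by (rule span_mono)
    moreover have "c i \<notin> span (?C - {c i})" using ind that unfolding dependent_def by auto
    ultimately show ?thesis by blast
  qed
  have rep0: "?rep x (c i) = 0" if "i < n" "x \<in> span (c ` {..<i})" for i x
  proof -
    have "c ` {..<i} \<subseteq> ?C" using that by auto
    then have "?rep x = representation (c ` {..<i}) x"
      using representation_extend[OF ind that(2)] by simp
    moreover have "c i \<notin> c ` {..<i}" using notin[OF that(1)] by (metis span_base)
    ultimately show ?thesis using representation_ne_zero[of "c ` {..<i}" x "c i"] by auto
  qed
  have repc: "?rep (c i) (c i) = 1" if "i < n" for i
    using that by (simp add: representation_basis[OF ind])
  have fc: "?rep (?f (c i)) (c i) = l i" if "i < n" for i
  proof -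
    have "?rep (?f (c i) - sg (l i) (c i)) (c i) = 0" using rep0 tr that by blast
    then show ?thesis by (simp add: rep_simps sp repc that)
  qed
  note subge = subspace_gen_eig[OF lin_br, of h]
  have "l i = 0" if i: "i < n" for i
  proof (rule ccontr)
    assume "l i \<noteq> 0"
    then obtain \<phi> :: "'k \<Rightarrow> rat" where \<phi>: "\<And>y z. \<phi> (y + z) = \<phi> y + \<phi> z"
      "\<And>q y. \<phi> (of_rat q * y) = q * \<phi> y" "\<phi> (l i) = 1"
      by (rule rational_functional) blast
    have \<phi>_sum: "\<phi> (sum g I) = (\<Sum>i\<in>I. \<phi> (g i))" for g and I :: "nat set"
      using \<phi>(2)[of 0 0] by (induction I rule: infinite_finite_induct) (simp_all add: \<phi>(1))
    define D where "D x = (\<Sum>i<n. sg (?rep x (c i) * of_rat (\<phi> (l i))) (c i))" for x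
    have linD: "lin D"
      by (rule linI) (simp_all add: D_def rep_simps sp algebra_simps sum.distrib scale_sum_right)
    have Dc: "D (c j) = sg (of_rat (\<phi> (l j))) (c j)" if "j < n" for j
    proof -
      have "D (c j) = (\<Sum>i<n. if i = j then sg (of_rat (\<phi> (l j))) (c j) else 0)"
        unfolding D_def using that
        by (intro sum.cong refl) (auto simp: representation_basis[OF ind] inj_on_eq_iff[OF inj])
      then show ?thesis using that by simp
    qed
    \<comment> \<open>the triangular shape shows that a generalized eigenvector only involves
      basis vectors of its own eigenvalue\<close>
    have D_eigen: "D x = sg (of_rat (\<phi> m)) x" if "x \<in> gen_eig ?f m" for x m
    proof -
      have "D x = sg (of_rat (\<phi> m)) x" if "x \<in> span (c ` {..<k})" "x \<in> gen_eig ?f m" "k \<le> n" for x k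
        using that
      proof (induction k arbitrary: x)
        case 0
        then show ?case by (simp add: lin_zero[OF linD])
      next
        case (Suc k)
        let ?A = "\<lambda>v. ?f v - sg m v"
        have k: "k < n" using Suc by simp
        have "x \<in> span (insert (c k) (c ` {..<k}))" using Suc.prems(1) by (simp add: lessThan_Suc)
        then obtain a where a: "x - sg a (c k) \<in> span (c ` {..<k})" by (auto simp: span_breakdown_eq)
        have f_span: "?f v \<in> span (c ` {..<k})" if "v \<in> span (c ` {..<k})" for v
          using that
        proof (induction rule: span_induct_alt)
          case base
          then show ?case by (simp add: br_simps span_zero)
        next
          case (step b u v)
          then obtain j where j: "j < k" "u = c j" by auto
          have "span (c ` {..<j}) \<subseteq> span (c ` {..<k})" using j(1) by (intro span_mono) auto
          then have "?f (c j) - sg (l j) (c j) \<in> span (c ` {..<k})" using tr[of j] j k by auto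
          then have "?f (c j) - sg (l j) (c j) + sg (l j) (c j) \<in> span (c ` {..<k})"
            using j by (intro span_add span_scale) (auto intro: span_base)
          then show ?case using step j by (auto simp: br_simps intro: span_add span_scale)
        qed
        \<comment> \<open>modulo earlier basis vectors, \<open>f - m\<close> multiplies \<open>c k\<close> by \<open>l k - m\<close>\<close>
        have pow: "(?A ^^ N) x - sg ((l k - m) ^ N * a) (c k) \<in> span (c ` {..<k})" for N
        proof (induction N)
          case 0
          then show ?case using a by simp
        next
          case (Suc N)
          let ?v = "(?A ^^ N) x" and ?b = "(l k - m) ^ N * a"
          have "?A (?v - sg ?b (c k)) + sg ?b (?f (c k) - sg (l k) (c k)) \<in> span (c ` {..<k})"
            by (rule span_add[OF span_diff[OF f_span[OF Suc.IH] span_scale[OF Suc.IH]] span_scale[OF tr[OF k]]])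
          also have "?A (?v - sg ?b (c k)) + sg ?b (?f (c k) - sg (l k) (c k)) =
              ?A ?v - sg ((l k - m) ^ Suc N * a) (c k)"
            by (simp add: br_simps algebra_simps)
          finally show ?case by simp
        qed
        obtain N where "(?A ^^ N) x = 0" using Suc.prems(2) unfolding gen_eig_def by blast
        then have "sg ((l k - m) ^ N * a) (c k) \<in> span (c ` {..<k})"
          using pow[of N] span_neg by fastforce
        then have "(l k - m) ^ N * a = 0"
          using notin[OF k] span_scale[of "sg ((l k - m) ^ N * a) (c k)" _ "inverse ((l k - m) ^ N * a)"]
          by (metis left_inverse scale_one scale_scale)
        then consider "a = 0" | "l k = m" by auto
        then show ?case
        proof cases
          case 1
          then show ?thesis using Suc a by simp
        next
          case 2
          have "x - sg a (c k) \<in> gen_eig ?f m"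
            using Suc.prems(2) ge[OF k] 2 by (intro subspace_diff[OF subge] subspace_scale[OF subge]) auto
          then have "D (x - sg a (c k)) = sg (of_rat (\<phi> m)) (x - sg a (c k))"
            using Suc.IH a k by simp
          then show ?thesis
            by (simp add: lin_diff[OF linD] lin_scale[OF linD] Dc[OF k] 2 scale_right_diff_distrib mult.commute)
        qed
      qed
      from this[of x n] that sp show ?thesis by simp
    qed
    have "D (br x y) = br (D x) y + br x (D y)" for x y
    proof -
      have cc: "D (br (c i) (c j)) = br (D (c i)) (c j) + br (c i) (D (c j))" if "i < n" "j < n" for i j
      proof -
        have "br (c i) (c j) \<in> gen_eig ?f (l i + l j)"
          by (rule gen_eig_derivation[OF lin_br br_derivation ge[OF that(1)] ge[OF that(2)]])
        then show ?thesis
          by (simp add: D_eigen Dc that \<phi>(1) of_rat_add br_simps scale_left_distrib)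
      qed
      have "y \<in> span ?C" "x \<in> span ?C" using sp by auto
      have c1: "D (br (c i) y) = br (D (c i)) y + br (c i) (D y)" if "i < n" for i
        using \<open>y \<in> span ?C\<close>
      proof (induction rule: span_induct_alt)
        case base
        show ?case by (simp add: br_simps lin_zero[OF linD])
      next
        case (step a u v)
        then obtain j where "j < n" "u = c j" by auto
        with step show ?case using cc[OF that, of j]
          by (simp add: br_simps lin_add[OF linD] lin_scale[OF linD] algebra_simps)
      qed
      show ?thesis
        using \<open>x \<in> span ?C\<close>
      proof (induction rule: span_induct_alt)
        case base
        show ?case by (simp add: br_simps lin_zero[OF linD])
      next
        case (step a u v)
        then obtain j where "j < n" "u = c j" by auto
        with step show ?case using c1[of j]
          by (simp add: br_simps lin_add[OF linD] lin_scale[OF linD] algebra_simps)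
      qed
    qed
    then have tr0: "trace (\<lambda>z. D (br (br x y) z)) = 0" for x y
      using kill[of "D x" y] unfolding trace_bracket[OF linD] killing_eq by simp
    have "trace (\<lambda>z. D (br h z)) = 0"
      using h
    proof (induction rule: span_induct_alt)
      case base
      have "trace (\<lambda>z. sg 0 z) = 0" unfolding trace_scale by simp
      then show ?case by (simp add: br_simps lin_zero[OF linD])
    next
      case (step a u v)
      then show ?case using tr0
        by (auto simp: br_simps lin_add[OF linD] lin_scale[OF linD] trace_add trace_scale)
    qed
    moreover have "trace (\<lambda>z. D (br h z)) = (\<Sum>x\<in>?C. ?rep (D (br h x)) x)"
      by (rule trace_in_basis) (simp_all add: ind sp lin_compose linD lin_br)
    moreover have "\<dots> = (\<Sum>i<n. of_rat (\<phi> (l i)) * l i)"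
    proof (subst sum.reindex[OF inj], rule sum.cong[OF refl])
      fix i assume "i \<in> {..<n}"
      then have i: "i < n" by simp
      have "?f (c i) - sg (l i) (c i) \<in> gen_eig ?f (l i)"
        using gen_eig_preimage[OF lin_br] ge[OF i] by blast
      then have "?f (c i) - sg (l i) (c i) + sg (l i) (c i) \<in> gen_eig ?f (l i)"
        using ge[OF i] by (intro subspace_add[OF subge] subspace_scale[OF subge])
      then have "D (?f (c i)) = sg (of_rat (\<phi> (l i))) (?f (c i))" using D_eigen by simp
      then show "((\<lambda>x. ?rep (D (br h x)) x) \<circ> c) i = of_rat (\<phi> (l i)) * l i"
        by (simp add: rep_simps sp fc[OF i])
    qed
    ultimately have "\<phi> (\<Sum>i<n. of_rat (\<phi> (l i)) * l i) = 0"
      using \<phi>(2)[of 0 0] by simp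
    then have "(\<Sum>i<n. \<phi> (l i) * \<phi> (l i)) = 0" by (simp add: \<phi>_sum \<phi>(2))
    then have "\<phi> (l i) = 0" using i by (simp add: sum_nonneg_eq_0_iff)
    with \<phi>(3) show False by simp
  qed
  then have "?C \<subseteq> gen_eig ?f 0" using ge by force
  then have "span ?C \<subseteq> gen_eig ?f 0" by (rule span_minimal) (rule subge)
  with sp show ?thesis by auto
qed

text \<open>An instance of Engel's theorem. If \<open>H \<noteq> UNIV\<close>, let \<open>W\<close> be minimal among the
  \<open>H\<close>-stable subspaces that properly contain \<open>H\<close>. Descending along the lower central series, every
  term maps \<open>W\<close> into \<open>H\<close>: if the next term does, then for \<open>h\<close> in the present one the
  elements of \<open>W\<close> that \<open>h\<close> maps into \<open>H\<close> form an \<open>H\<close>-stable subspace, larger than \<open>H\<close> since \<open>h\<close> acts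
  nilpotently, so that it is all of \<open>W\<close>. In the end \<open>W\<close> normalizes \<open>H\<close>, which is absurd.\<close>

lemma cartan_subalgebra_nilpotent_action:
  assumes H: "cartan_subalgebra H" and nil: "\<And>h x. h \<in> H \<Longrightarrow> x \<in> gen_eig (br h) 0"
  shows "H = UNIV"
proof (rule ccontr)
  assume "H \<noteq> UNIV"
  obtain N where sH: "subspace H" and HH: "\<And>x y. x \<in> H \<Longrightarrow> y \<in> H \<Longrightarrow> br x y \<in> H"
    and N: "lower_central H N = {0}" and norm: "normalizer H = H"
    using H unfolding cartan_subalgebra_def lie_subalgebra_def by blast
  define good where "good W \<longleftrightarrow> subspace W \<and> H \<subset> W \<and> (\<forall>h\<in>H. \<forall>w\<in>W. br h w \<in> W)" for W
  have "good UNIV" using \<open>H \<noteq> UNIV\<close> by (auto simp: good_def)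
  then obtain W where W: "good W" and min: "\<And>W'. good W' \<Longrightarrow> dim W \<le> dim W'"
    using arg_min_nat_lemma[of good UNIV dim] by blast
  then have sW: "subspace W" and HW: "H \<subset> W" and stab: "\<And>h w. h \<in> H \<Longrightarrow> w \<in> W \<Longrightarrow> br h w \<in> W"
    by (auto simp: good_def)
  have lcH: "lower_central H n \<subseteq> H" for n
  proof (induction n)
    case (Suc n)
    then show ?case unfolding lower_central.simps by (intro span_minimal sH) (auto intro: HH)
  qed simp
  have step: "br h w \<in> H" if "n \<le> N" "h \<in> lower_central H n" "w \<in> W" for n h w
    using that
  proof (induction n arbitrary: h w rule: inc_induct)
    case base
    then show ?case using N subspace_0[OF sH] by (simp add: br_simps)
  next
    case (step n)
    have hH: "h \<in> H" using lcH step.prems by blast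
    define W' where "W' = {w \<in> W. br h w \<in> H}"
    have sW': "subspace W'"
      unfolding W'_def using sW sH
      by (intro subspaceI) (auto simp: br_simps subspace_0 intro: subspace_add subspace_scale)
    have "br h' w \<in> W'" if "h' \<in> H" "w \<in> W'" for h' w
    proof -
      have w: "w \<in> W" "br h w \<in> H" using that by (auto simp: W'_def)
      have "br h' h \<in> lower_central H (Suc n)"
        using that(1) step.prems(1) by (auto intro!: span_base)
      then have "- br (br h' h) w + br h' (br h w) \<in> H"
        using step.IH[OF _ w(1)] HH[OF that(1) w(2)] by (intro subspace_add[OF sH] subspace_neg[OF sH])
      also have "- br (br h' h) w + br h' (br h w) = br h (br h' w)"
        using br_derivation[of h' h w] by simp
      finally show ?thesis using stab[OF that(1) w(1)] by (simp add: W'_def)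
    qed
    moreover have "H \<subset> W'"
    proof -
      obtain w0 where w0: "w0 \<in> W" "w0 \<notin> H" using HW by blast
      obtain M where "(br h ^^ M) w0 = 0" using nil[OF hH, of w0] by (auto simp: gen_eig_def)
      then have ex: "(br h ^^ M) w0 \<in> H" using subspace_0[OF sH] by simp
      define M0 where "M0 = (LEAST M. (br h ^^ M) w0 \<in> H)"
      have M0: "(br h ^^ M0) w0 \<in> H" unfolding M0_def by (rule LeastI) (rule ex)
      with w0 obtain M1 where M1: "M0 = Suc M1" by (cases M0) auto
      have "(br h ^^ M1) w0 \<notin> H" using not_less_Least[of M1 "\<lambda>M. (br h ^^ M) w0 \<in> H"] M1 unfolding M0_def by simp
      moreover have "(br h ^^ k) w0 \<in> W" for k
        by (induction k) (simp_all add: w0 stab hH)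
      ultimately have "(br h ^^ M1) w0 \<in> W' - H" using M0 M1 by (simp add: W'_def)
      moreover have "H \<subseteq> W'" using HW HH hH by (auto simp: W'_def)
      ultimately show ?thesis by blast
    qed
    ultimately have "good W'" using sW' by (simp add: good_def)
    then have "dim W \<le> dim W'" by (rule min)
    moreover have "W' \<subseteq> W" by (auto simp: W'_def)
    ultimately have "W' = W" using subspace_dim_equal[OF sW' sW] by blast
    then show ?case using step.prems by (auto simp: W'_def)
  qed
  have "W \<subseteq> normalizer H"
  proof
    fix w assume "w \<in> W"
    then have "- br h w \<in> H" if "h \<in> H" for h
      using step[of 0 h w] that by (intro subspace_neg[OF sH]) simp
    then show "w \<in> normalizer H" unfolding normalizer_def by (simp add: br_antisym[of w])
  qed
  with norm HW show False by blast
qed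

end

locale split_simple_lie_algebra = finite_lie_algebra sg br
  for sg :: "'k::field_char_0 \<Rightarrow> 'g::ab_group_add \<Rightarrow> 'g" and br +
  assumes simple: simple and split: split
begin

lemma perfect: "span {br x y | x y. True} = UNIV"
proof -
  have "lie_ideal (span {br x y | x y. True})"
    unfolding lie_ideal_def by (auto intro!: span_base)
  moreover have "span {br x y | x y. True} \<noteq> {0}"
    using simple span_base[of _ "{br x y | x y. True}"] unfolding simple_def by blast
  ultimately show ?thesis using simple unfolding simple_def by blast
qed

theorem killing_nonzero: "\<exists>x y. killing x y \<noteq> 0"
proof (rule ccontr)
  assume "\<not> ?thesis"
  then have kill: "killing x y = 0" for x y by blast
  obtain H where H: "cartan_subalgebra H" and tri: "\<And>h. h \<in> H \<Longrightarrow> triangularizable (br h)"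
    using split unfolding split_def by blast
  have "x \<in> gen_eig (br h) 0" if "h \<in> H" for h x
    by (rule nilpotent_if_killing_zero) (simp_all only: kill perfect UNIV_I tri that)
  then have "H = UNIV" by (rule cartan_subalgebra_nilpotent_action[OF H])
  moreover have "lower_central UNIV n = UNIV" for n
    using perfect by (induction n) simp_all
  ultimately have "(UNIV :: 'g set) = {0}" using H unfolding cartan_subalgebra_def by metis
  moreover obtain x y where "br x y \<noteq> 0" using simple unfolding simple_def by blast
  ultimately show False by auto
qed

theorem killing_nondegenerate:
  assumes "\<And>y. killing x y = 0"
  shows "x = 0"
proof -
  let ?R = "{x. \<forall>y. killing x y = 0}"
  have "lie_ideal ?R"
    unfolding lie_ideal_def
  proof (intro conjI subspaceI)
    have "killing (br x y) z = 0" if "\<forall>z. killing y z = 0" for x y z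
    proof -
      have "killing (br x y) z = - killing (br y x) z"
        using killing_add[of "br x y" "br y x" z] by (simp add: br_antisym[of x y] eq_neg_iff_add_eq_0)
      then show ?thesis using that by (simp add: killing_invariant)
    qed
    then show "\<forall>x. \<forall>y\<in>?R. br x y \<in> ?R" by simp
  qed (simp_all add: killing_add killing_scale)
  then have "?R = {0} \<or> ?R = UNIV" using simple unfolding simple_def by blast
  then show ?thesis using assms killing_nonzero by blast
qed

end

section \<open>The Casimir element and Whitehead's second lemma\<close>

context split_simple_lie_algebra
begin

lemma killing_minus: "killing (- x) y = - killing x y" "killing x (- y) = - killing x y"
proof -
  show "killing (- x) y = - killing x y" using killing_scale[of "-1" x y] by simp
  then show "killing x (- y) = - killing x y"
    using killing_scale_right[of x "-1" y] by simp
qed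

lemma killing_ad_skew: "killing (br x y) z = - killing y (br x z)"
  by (simp add: br_antisym[of x y] killing_minus killing_invariant)

lemma killing_eqI:
  assumes "\<And>b. b \<in> basis \<Longrightarrow> killing x b = killing y b"
  shows "x = y"
proof -
  have "killing (x - y) z = 0" for z
  proof -
    have "killing x z = killing y z"
      by (subst (1 2) sum_coord[of z, symmetric])
        (simp add: killing_sum killing_scale_right assms)
    then show ?thesis using killing_add[of "x - y" y z] by simp
  qed
  then show ?thesis using killing_nondegenerate[of "x - y"] by simp
qed

definition dual :: "'g \<Rightarrow> 'g" where
  "dual b = (SOME x. \<forall>c\<in>basis. killing x c = (if c = b then 1 else 0))"

lemma killing_dual:
  assumes "b \<in> basis" "c \<in> basis"
  shows "killing (dual b) c = (if c = b then 1 else 0)"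
proof -
  define T where "T x = (\<Sum>c\<in>basis. sg (killing x c) c)" for x
  have lin: "lin T"
    by (rule linI) (simp_all add: T_def killing_add killing_scale scale_left_distrib sum.distrib scale_sum_right)
  have coordT: "coord (T x) c = killing x c" if "c \<in> basis" for x c
  proof -
    have "coord (T x) c = (\<Sum>d\<in>basis. if c = d then killing x d else 0)"
      unfolding T_def coord_sum coord_scale by (intro sum.cong) (auto simp: coord_basis)
    then show ?thesis using that by simp
  qed
  have "inj T"
  proof (rule injI)
    fix x y assume "T x = T y"
    then show "x = y" by (intro killing_eqI) (metis coordT)
  qed
  then have "surj T" using linear_inj_imp_surj[OF lin] by blast
  then obtain x where "T x = b" by (metis surj_def)
  then have "\<forall>c\<in>basis. killing x c = (if c = b then 1 else 0)"
    using coordT[of _ x] assms(1) by (metis coord_basis)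
  then have "\<forall>c\<in>basis. killing (dual b) c = (if c = b then 1 else 0)"
    unfolding dual_def by (rule someI)
  then show ?thesis using assms(2) by blast
qed

lemma dual_expand: "x = (\<Sum>b\<in>basis. sg (killing x b) (dual b))"
proof (rule killing_eqI)
  fix c assume c: "c \<in> basis"
  have "killing (\<Sum>b\<in>basis. sg (killing x b) (dual b)) c = (\<Sum>b\<in>basis. if c = b then killing x b else 0)"
    unfolding killing_sum killing_scale using c by (intro sum.cong) (auto simp: killing_dual)
  then show "killing x c = killing (\<Sum>b\<in>basis. sg (killing x b) (dual b)) c" using c by simp
qed

lemma coord_eq_killing_dual: "b \<in> basis \<Longrightarrow> coord x b = killing x (dual b)"
proof -
  assume b: "b \<in> basis"
  have "killing x (dual b) = killing (dual b) (\<Sum>c\<in>basis. sg (coord x c) c)"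
    by (simp only: sum_coord killing_sym)
  also have "\<dots> = (\<Sum>c\<in>basis. coord x c * killing (dual b) c)"
    by (simp add: killing_sum killing_scale_right)
  also have "\<dots> = (\<Sum>c\<in>basis. if c = b then coord x c else 0)"
    using b by (intro sum.cong refl) (auto simp: killing_dual)
  finally have "killing x (dual b) = (\<Sum>c\<in>basis. if c = b then coord x c else 0)" .
  then show ?thesis using b by simp
qed

lemma expand_in_basis: "x = (\<Sum>b\<in>basis. sg (killing x (dual b)) b)"
  using sum_coord[of x] by (simp add: coord_eq_killing_dual)

end

text \<open>The Casimir element is the tensor \<open>\<Sum> b \<otimes> dual b\<close>, with \<open>b\<close> running through a basis. Its properties are stated
  through its values under arbitrary bilinear maps.\<close>

locale bilinear_map = split_simple_lie_algebra sg br + W: vector_space sW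
  for sg :: "'k::field_char_0 \<Rightarrow> 'g::ab_group_add \<Rightarrow> 'g" and br
    and sW :: "'k \<Rightarrow> 'w::ab_group_add \<Rightarrow> 'w" +
  fixes \<beta> :: "'g \<Rightarrow> 'g \<Rightarrow> 'w"
  assumes bil: "\<beta> (x + x') y = \<beta> x y + \<beta> x' y" "\<beta> x (y + y') = \<beta> x y + \<beta> x y'"
    "\<beta> (sg c x) y = sW c (\<beta> x y)" "\<beta> x (sg c y) = sW c (\<beta> x y)"
begin

lemma bil_zero: "\<beta> 0 y = 0" "\<beta> x 0 = 0"
  using bil(3)[of 0 0 y] bil(4)[of x 0 0] by simp_all

lemma bil_sum: "\<beta> (\<Sum>i\<in>I. h i) y = (\<Sum>i\<in>I. \<beta> (h i) y)" "\<beta> x (\<Sum>i\<in>I. h i) = (\<Sum>i\<in>I. \<beta> x (h i))"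
  by (induction I rule: infinite_finite_induct) (simp_all add: bil bil_zero)

lemma bil_minus: "\<beta> (- x) y = - \<beta> x y" "\<beta> x (- y) = - \<beta> x y"
  using bil(3)[of "-1" x y] bil(4)[of x "-1" y] by simp_all

lemma casimir_symmetric: "(\<Sum>b\<in>basis. \<beta> b (dual b)) = (\<Sum>b\<in>basis. \<beta> (dual b) b)"
proof -
  have "(\<Sum>b\<in>basis. \<beta> b (dual b)) = (\<Sum>b\<in>basis. \<Sum>c\<in>basis. sW (killing (dual b) (dual c)) (\<beta> b c))"
    by (subst (1) expand_in_basis[of "dual _"]) (simp add: bil_sum bil)
  moreover have "(\<Sum>b\<in>basis. \<beta> (dual b) b) = (\<Sum>b\<in>basis. \<Sum>c\<in>basis. sW (killing (dual b) (dual c)) (\<beta> c b))"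
    by (subst (1) expand_in_basis[of "dual _"]) (simp add: bil_sum bil)
  ultimately show ?thesis by (subst (asm) (2) sum.swap) (simp add: killing_sym)
qed

lemma casimir_invariant:
  "(\<Sum>b\<in>basis. \<beta> (br y b) (dual b)) = - (\<Sum>b\<in>basis. \<beta> b (br y (dual b)))"
proof -
  have inv: "killing (br y (dual c)) b = - killing (br y b) (dual c)" for b c
    by (simp add: killing_ad_skew killing_sym)
  have "(\<Sum>b\<in>basis. \<beta> (br y b) (dual b)) =
      (\<Sum>b\<in>basis. \<Sum>c\<in>basis. sW (killing (br y b) (dual c)) (\<beta> c (dual b)))"
    by (subst (1) expand_in_basis[of "br y _"]) (simp add: bil_sum bil)
  also have "\<dots> = (\<Sum>b\<in>basis. \<Sum>c\<in>basis. - sW (killing (br y (dual b)) c) (\<beta> b (dual c)))"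
    by (subst sum.swap) (simp add: inv)
  also have "\<dots> = - (\<Sum>b\<in>basis. \<beta> b (br y (dual b)))"
    by (subst (2) dual_expand[of "br y _"]) (simp add: bil_sum bil sum_negf)
  finally show ?thesis .
qed

end

context split_simple_lie_algebra
begin

lemma bilinear_br: "bilinear_map sg br sg (\<lambda>b c. br b (br c x))"
  by unfold_locales (simp_all add: br_simps)

lemma casimir_adjoint: "(\<Sum>b\<in>basis. br b (br (dual b) x)) = x"
proof (rule killing_eqI)
  fix z
  have "killing (\<Sum>b\<in>basis. br b (br (dual b) x)) z = (\<Sum>b\<in>basis. killing b (br (br (dual b) x) z))"
    by (simp add: killing_sum killing_invariant)
  also have "\<dots> = (\<Sum>b\<in>basis. coord (br x (br z b)) b)"
  proof (rule sum.cong[OF refl])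
    fix b assume b: "b \<in> basis"
    have "br (br (dual b) x) z = br z (br x (dual b))"
      by (simp add: br_antisym[of _ z] br_antisym[of "dual b" x] br_minus)
    then show "killing b (br (br (dual b) x) z) = coord (br x (br z b)) b"
      by (simp add: coord_eq_killing_dual b killing_ad_skew)
  qed
  also have "\<dots> = killing x z" unfolding killing_eq trace_eq ..
  finally show "killing (\<Sum>b\<in>basis. br b (br (dual b) x)) z = killing x z" .
qed

end

context bilinear_map
begin

text \<open>Write \<open>P x y\<close> and \<open>T x y\<close> for the sums of \<open>\<beta> [x, [y, b]] (dual b)\<close> and \<open>\<beta> [dual b, x] [y, b]\<close>. Symmetry
  of the Casimir element makes \<open>T\<close> antisymmetric and its invariance gives \<open>T = P\<close>. The cocycle identity,
  with the fact that the Casimir element acts as the identity on the adjoint representation, yields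
  \<open>P x y = \<beta> x y - T x y\<close>. So \<open>P x y - P y x = 2 P x y = \<beta> x y\<close>.\<close>

theorem whitehead_second:
  assumes alt: "\<And>x y. \<beta> y x = - \<beta> x y"
    and cocycle: "\<And>x y z. \<beta> (br x y) z + \<beta> (br y z) x + \<beta> (br z x) y = 0"
  shows "(\<Sum>b\<in>basis. \<beta> (br (br x y) b) (dual b)) = \<beta> x y"
proof -
  define P where "P x y = (\<Sum>b\<in>basis. \<beta> (br x (br y b)) (dual b))" for x y
  define T where "T x y = (\<Sum>b\<in>basis. \<beta> (br (dual b) x) (br y b))" for x y
  have T_anti: "T y x = - T x y" for x y
  proof -
    interpret B: bilinear_map sg br sW "\<lambda>b c. \<beta> (br c x) (br y b)"
      by unfold_locales (simp_all add: br_simps bil)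
    have "T x y = (\<Sum>b\<in>basis. \<beta> (br b x) (br y (dual b)))"
      unfolding T_def by (rule B.casimir_symmetric)
    also have "\<dots> = (\<Sum>b\<in>basis. - \<beta> (br (dual b) y) (br x b))"
      by (simp add: alt[of "br x _" "br (dual _) y"] br_antisym[of _ x] br_antisym[of y] bil_minus)
    finally show ?thesis by (simp add: T_def sum_negf)
  qed
  have TP: "T x y = P x y" for x y
  proof -
    interpret B: bilinear_map sg br sW "\<lambda>b c. \<beta> (br c x) b"
      by unfold_locales (simp_all add: br_simps bil)
    interpret B': bilinear_map sg br sW "\<lambda>b c. \<beta> (br x (br y b)) c"
      by unfold_locales (simp_all add: br_simps bil)
    have "T x y = - (\<Sum>b\<in>basis. \<beta> (br (br y (dual b)) x) b)"
      unfolding T_def by (rule B.casimir_invariant)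
    also have "\<dots> = (\<Sum>b\<in>basis. \<beta> (br x (br y (dual b))) b)"
      by (simp add: br_antisym[of _ x] bil_minus sum_negf)
    also have "\<dots> = P x y" unfolding P_def by (rule B'.casimir_symmetric[symmetric])
    finally show ?thesis .
  qed
  have "P x y = \<beta> x y - T x y"
  proof -
    have "P x y = (\<Sum>b\<in>basis. - \<beta> (br (br y b) (dual b)) x - \<beta> (br (dual b) x) (br y b))"
      unfolding P_def
    proof (rule sum.cong[OF refl])
      fix b
      show "\<beta> (br x (br y b)) (dual b) = - \<beta> (br (br y b) (dual b)) x - \<beta> (br (dual b) x) (br y b)"
        using cocycle[of x "br y b" "dual b"] by (simp add: eq_diff_eq eq_neg_iff_add_eq_0 algebra_simps)
    qed
    also have "\<dots> = - \<beta> (\<Sum>b\<in>basis. br (br y b) (dual b)) x - T x y"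
      by (simp add: sum_subtractf sum_negf bil_sum T_def)
    also have "(\<Sum>b\<in>basis. br (br y b) (dual b)) = (\<Sum>b\<in>basis. br (dual b) (br b y))"
      by (intro sum.cong refl) (metis br_antisym br_minus(2) minus_minus)
    also have "\<dots> = y"
      using bilinear_map.casimir_symmetric[OF bilinear_br, of y] casimir_adjoint[of y] by simp
    finally show ?thesis by (simp add: alt[of x y])
  qed
  then have "P x y + P x y = \<beta> x y" by (simp add: TP eq_diff_eq)
  moreover have "P y x = - P x y" using T_anti TP by metis
  moreover have "(\<Sum>b\<in>basis. \<beta> (br (br x y) b) (dual b)) = P x y - P y x"
  proof -
    have "br (br x y) b = br x (br y b) + - br y (br x b)" for b
      using br_derivation[of x y b] by simp
    then show ?thesis by (simp only: bil bil_minus P_def sum.distrib sum_negf) simp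
  qed
  ultimately show ?thesis by simp
qed

end

section \<open>Free modules\<close>

abbreviation "single \<equiv> Poly_Mapping.single"
abbreviation "lookup \<equiv> Poly_Mapping.lookup"
abbreviation "keys \<equiv> Poly_Mapping.keys"

lemma poly_mapping_sum_single: "(\<Sum>a\<in>keys p. single a (lookup p a)) = p"
proof (rule poly_mapping_eqI)
  fix b
  have "(\<Sum>a\<in>keys p. lookup (single a (lookup p a)) b) =
      (\<Sum>a\<in>keys p. if a = b then lookup p b else 0)"
    by (intro sum.cong refl) (auto simp: lookup_single when_def)
  then show "lookup (\<Sum>a\<in>keys p. single a (lookup p a)) b =
      lookup p b"
    by (simp add: lookup_sum in_keys_iff)
qed

lemma poly_mapping_single_induct [case_names zero add]:
  fixes p :: "'a \<Rightarrow>\<^sub>0 'c::comm_monoid_add"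
  assumes "P 0" and "\<And>a c p. P p \<Longrightarrow> P (single a c + p)"
  shows "P p"
proof -
  have "P (\<Sum>a\<in>A. single a (lookup p a))" if "finite A" for A
    using that by induction (simp_all add: assms)
  from this[of "keys p"] show ?thesis by (simp add: poly_mapping_sum_single)
qed

lemmas additive_zero = additive.zero[OF additive.intro]
lemmas additive_diff = additive.diff[OF additive.intro]
lemmas additive_sum = additive.sum[OF additive.intro]

lemma additive_eqI:
  fixes f g :: "('a \<Rightarrow>\<^sub>0 'c::ab_group_add) \<Rightarrow> 'm::ab_group_add"
  assumes f: "\<And>p q. f (p + q) = f p + f q" and g: "\<And>p q. g (p + q) = g p + g q"
    and "\<And>a c. f (single a c) = g (single a c)"
  shows "f p = g p"
proof (induction p rule: poly_mapping_single_induct)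
  case zero
  show ?case using additive_zero[of f] additive_zero[of g] f g by simp
qed (simp add: assms)

lemma lin_ext_superset:
  assumes "\<And>x. sc 0 x = 0" "finite A" "keys p \<subseteq> A"
  shows "lin_ext sc f p = (\<Sum>b\<in>A. sc (lookup p b) (f b))"
  unfolding lin_ext_def using assms by (intro sum.mono_neutral_left) (auto simp: in_keys_iff)

lemma lin_ext_add:
  fixes sc :: "'c::ab_group_add \<Rightarrow> 'm::ab_group_add \<Rightarrow> 'm"
  assumes sc: "\<And>c d x. sc (c + d) x = sc c x + sc d x"
  shows "lin_ext sc f (p + q) = lin_ext sc f p + lin_ext sc f q"
proof -
  have 0: "sc 0 x = 0" for x using sc by (rule additive_zero)
  let ?A = "keys p \<union> keys q"
  have "lin_ext sc f r = (\<Sum>b\<in>?A. sc (lookup r b) (f b))" if "keys r \<subseteq> ?A" for r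
    by (rule lin_ext_superset) (simp_all add: 0 that)
  then show ?thesis by (simp add: keys_add lookup_add sc sum.distrib)
qed

lemma lin_ext_single:
  assumes "\<And>x. sc 0 x = 0"
  shows "lin_ext sc f (single b c) = sc c (f b)"
  by (subst lin_ext_superset[where A = "{b}"]) (simp_all add: assms)

lemma lookup_fscale [simp]: "lookup (fscale c p) x = c * lookup p x"
  unfolding fscale_def by (simp add: map.rep_eq when_def)

lemma fscale_simps [simp]:
  "fscale c (p + q) = fscale c p + fscale c q"
  "fscale c (p - q) = fscale c p - fscale c q"
  "fscale c (- p) = - fscale c p"
  "fscale c (fscale d p) = fscale (c * d) p"
  "fscale 1 p = p" "fscale c 0 = 0" "fscale 0 p = 0"
  "fscale c (single b a) = single b (c * a)"
  "fscale c (gen b) = single b c"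
  by (rule poly_mapping_eqI, simp add: lookup_add lookup_minus algebra_simps lookup_single when_def gen_def)+

lemma fscale_add_left: "fscale (c + d) p = fscale c p + fscale d p"
  by (rule poly_mapping_eqI) (simp add: lookup_add algebra_simps)

lemma fscale_sum: "fscale c (\<Sum>i\<in>I. h i) = (\<Sum>i\<in>I. fscale c (h i))"
  by (rule additive_sum) simp

lemma fspan_base: "x \<in> X \<Longrightarrow> x \<in> fspan X" and fspan_zero: "0 \<in> fspan X"
  and fspan_add: "p \<in> fspan X \<Longrightarrow> q \<in> fspan X \<Longrightarrow> p + q \<in> fspan X"
  and fspan_scale: "p \<in> fspan X \<Longrightarrow> fscale c p \<in> fspan X"
  unfolding fspan_def by auto

lemma fspan_least:
  assumes "p \<in> fspan X" "X \<subseteq> N" "0 \<in> N" "\<And>p q. p \<in> N \<Longrightarrow> q \<in> N \<Longrightarrow> p + q \<in> N"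
    "\<And>c p. p \<in> N \<Longrightarrow> fscale c p \<in> N"
  shows "p \<in> N"
  using assms unfolding fspan_def by auto

lemma fspan_minus: "p \<in> fspan X \<Longrightarrow> - p \<in> fspan X"
proof -
  assume "p \<in> fspan X"
  then have "fscale (- 1) p \<in> fspan X" by (rule fspan_scale)
  moreover have "fscale (- 1) p = - p" by (rule poly_mapping_eqI) simp
  ultimately show ?thesis by simp
qed

lemma fspan_diff: "p \<in> fspan X \<Longrightarrow> q \<in> fspan X \<Longrightarrow> p - q \<in> fspan X"
  using fspan_add[of p X "- q"] fspan_minus[of q X] by simp

section \<open>Quotients presented by a homomorphism\<close>

lemma mem_coset_iff: "q \<in> coset N p \<longleftrightarrow> p - q \<in> N"
  unfolding coset_def by simp

text \<open>Elements of a quotient by \<open>N\<close> are sets, on which there is no addition from a type class. A homomorphism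
  with kernel \<open>N\<close> replaces them by elements of an abelian group, and calculations modulo \<open>N\<close> by equations.\<close>

definition presents :: "('v::ab_group_add \<Rightarrow> 'w::ab_group_add) \<Rightarrow> 'v set \<Rightarrow> bool" where
  "presents \<pi> N \<longleftrightarrow> (\<forall>p q. \<pi> (p + q) = \<pi> p + \<pi> q) \<and> (\<forall>p. \<pi> p = 0 \<longleftrightarrow> p \<in> N)"

definition value_on :: "('v \<Rightarrow> 'w) \<Rightarrow> 'v set \<Rightarrow> 'w" where
  "value_on \<pi> X = the_elem (\<pi> ` X)"

lemma coset_presents:
  assumes "presents \<pi> N"
  shows "coset N p = {q. \<pi> q = \<pi> p}"
proof -
  have "p - q \<in> N \<longleftrightarrow> \<pi> q = \<pi> p" for q
  proof -
    have "\<pi> (p - q) = \<pi> p - \<pi> q"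
      using assms unfolding presents_def by (intro additive_diff) blast
    then show ?thesis using assms unfolding presents_def by (metis right_minus_eq)
  qed
  then show ?thesis unfolding coset_def by auto
qed

lemma coset_eq_iff: "presents \<pi> N \<Longrightarrow> coset N p = coset N q \<longleftrightarrow> \<pi> p = \<pi> q"
  by (auto simp: coset_presents)

lemma value_on_coset: "presents \<pi> N \<Longrightarrow> value_on \<pi> (coset N p) = \<pi> p"
  unfolding value_on_def coset_presents by (rule the_elem_image_unique) auto

lemma quot_eq: "quot N = range (coset N)"
  unfolding quot_def quotient_def coset_def by auto

lemma coset_in_quot [simp]: "coset N p \<in> quot N"
  by (simp add: quot_eq)

lemma lift1_coset:
  assumes "presents \<pi> N" "presents \<rho> M" and "\<And>p q. \<pi> p = \<pi> q \<Longrightarrow> \<rho> (f p) = \<rho> (f q)"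
  shows "lift1 M f (coset N p) = coset M (f p)"
proof -
  have "coset M (f q) = coset M (f p)" if "q \<in> coset N p" for q
    using that assms(3)[of q p] by (simp add: coset_eq_iff[OF assms(2)] coset_presents[OF assms(1)])
  moreover have "p \<in> coset N p" by (simp add: coset_presents[OF assms(1)])
  ultimately show ?thesis unfolding lift1_def by blast
qed

lemma lift2_coset:
  assumes "presents \<pi> N" "presents \<rho> M"
    and "\<And>p p' q q'. \<pi> p = \<pi> p' \<Longrightarrow> \<pi> q = \<pi> q' \<Longrightarrow> \<rho> (f p q) = \<rho> (f p' q')"
  shows "lift2 M f (coset N p) (coset N q) = coset M (f p q)"
proof -
  have "coset M (f p' q') = coset M (f p q)" if "p' \<in> coset N p" "q' \<in> coset N q" for p' q'
    using that assms(3)[of p' p q' q] by (simp add: coset_eq_iff[OF assms(2)] coset_presents[OF assms(1)])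
  moreover have "p \<in> coset N p" "q \<in> coset N q" by (simp_all add: coset_presents[OF assms(1)])
  ultimately show ?thesis unfolding lift2_def by blast
qed

text \<open>Extend a basis of the subspace to a basis of the whole space, and send the former to 0.\<close>

lemma subspace_projection:
  assumes "vector_space sc" "module.subspace sc N"
  obtains P where "Vector_Spaces.linear sc sc P" "\<And>x. P x = 0 \<longleftrightarrow> x \<in> N" "\<And>x. P (P x) = P x"
proof -
  interpret vector_space sc by fact
  interpret vector_space_pair sc sc ..
  obtain C where C: "C \<subseteq> N" "independent C" "N \<subseteq> span C"
    using basis_exists[of N] by metis
  have spC: "span C = N" using C assms(2) by (metis span_subspace)
  define D where "D = extend_basis C"
  have D: "independent D" "span D = UNIV" "C \<subseteq> D"
    unfolding D_def using C(2) by (simp_all add: independent_extend_basis extend_basis_superset)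
  define P where "P = construct D (\<lambda>b. if b \<in> C then 0 else b)"
  have lin: "Vector_Spaces.linear sc sc P" unfolding P_def by (rule linear_construct[OF D(1)])
  interpret P: Vector_Spaces.linear sc sc P by (rule lin)
  have Pb: "P b = (if b \<in> C then 0 else b)" if "b \<in> D" for b
    unfolding P_def by (rule construct_basis[OF D(1) that])
  have diff: "x - P x \<in> N" for x
  proof -
    have "x \<in> span D" using D(2) by simp
    then show ?thesis
    proof (induction rule: span_induct_alt)
      case base
      show ?case using subspace_0[OF assms(2)] by (simp add: P.zero)
    next
      case (step c b y)
      have "b - P b \<in> N" using step(1) C(1) subspace_0[OF assms(2)] by (auto simp: Pb)
      then have "sc c (b - P b) + (y - P y) \<in> N"
        using step.IH by (intro subspace_add[OF assms(2)] subspace_scale[OF assms(2)])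
      then show ?case by (simp add: P.add P.scale algebra_simps)
    qed
  qed
  have ker: "P x = 0" if "x \<in> N" for x
  proof -
    have "x \<in> span C" using that spC by simp
    then show ?thesis
      by (rule P.eq_0_on_span[rotated]) (use Pb D(3) in auto)
  qed
  show thesis
  proof (rule that[OF lin])
    fix x
    show "P x = 0 \<longleftrightarrow> x \<in> N" using ker diff[of x] by auto
    show "P (P x) = P x" using ker[OF diff[of x]] by (simp add: P.diff)
  qed
qed

lemma unital_ring_homD:
  assumes "unital_ring_hom f"
  shows "f (x + y) = f x + f y" "f (x * y) = f x * f y" "f 1 = 1" "f 0 = 0" "f (- x) = - f x"
    "f (x - y) = f x - f y" "f (\<Sum>i\<in>I. h i) = (\<Sum>i\<in>I. f (h i))"
proof -
  have add: "f (x + y) = f x + f y" for x y using assms unfolding unital_ring_hom_def by blast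
  show "f (x + y) = f x + f y" by (rule add)
  show "f (x * y) = f x * f y" "f 1 = 1" using assms unfolding unital_ring_hom_def by auto
  show 0: "f 0 = 0" using add by (rule additive_zero)
  show diff: "f (x - y) = f x - f y" for x y using add by (rule additive_diff)
  show "f (- x) = - f x" using diff[of 0 x] 0 by simp
  show "f (\<Sum>i\<in>I. h i) = (\<Sum>i\<in>I. f (h i))" using add by (rule additive_sum)
qed

lemma unital_ring_hom_comp: "unital_ring_hom f \<Longrightarrow> unital_ring_hom g \<Longrightarrow> unital_ring_hom (f \<circ> g)"
  unfolding unital_ring_hom_def by simp

lemma fscale_vector_space:
  assumes "unital_ring_hom (\<kappa> :: 'k::field \<Rightarrow> 'a::{comm_ring,comm_monoid_mult})"
  shows "vector_space (\<lambda>c (p :: 'b \<Rightarrow>\<^sub>0 'a). fscale (\<kappa> c) p)"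
  by unfold_locales (simp_all add: unital_ring_homD[OF assms] fscale_add_left)

section \<open>Differentials modulo exact differentials\<close>

lemma kaehler_null_gens:
  shows kaehler_null_add: "gen (a + b) - gen a - gen b \<in> kaehler_null \<kappa>"
    and kaehler_null_scale: "gen (\<kappa> c * a) - single a (\<kappa> c) \<in> kaehler_null \<kappa>"
    and kaehler_null_mult: "gen (a * b) - single b a - single a b \<in> kaehler_null \<kappa>"
  unfolding kaehler_null_def by (rule fspan_base, simp, blast)+

lemma kaehler_null_closed:
  shows kaehler_null_0: "0 \<in> kaehler_null \<kappa>"
    and kaehler_null_plus: "p \<in> kaehler_null \<kappa> \<Longrightarrow> q \<in> kaehler_null \<kappa> \<Longrightarrow> p + q \<in> kaehler_null \<kappa>"
    and kaehler_null_diff: "p \<in> kaehler_null \<kappa> \<Longrightarrow> q \<in> kaehler_null \<kappa> \<Longrightarrow> p - q \<in> kaehler_null \<kappa>"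
    and kaehler_null_fscale: "p \<in> kaehler_null \<kappa> \<Longrightarrow> fscale a p \<in> kaehler_null \<kappa>"
  unfolding kaehler_null_def by (simp_all add: fspan_zero fspan_add fspan_diff fspan_scale)

lemma exact_null_iff: "p \<in> exact_null \<kappa> \<longleftrightarrow> (\<exists>a. p - gen a \<in> kaehler_null \<kappa>)"
proof -
  have "coset (kaehler_null \<kappa>) p = coset (kaehler_null \<kappa>) q \<longleftrightarrow> p - q \<in> kaehler_null \<kappa>" for p q
  proof
    assume "coset (kaehler_null \<kappa>) p = coset (kaehler_null \<kappa>) q"
    moreover have "q \<in> coset (kaehler_null \<kappa>) q" by (simp add: mem_coset_iff kaehler_null_0)
    ultimately have "q \<in> coset (kaehler_null \<kappa>) p" by simp
    then show "p - q \<in> kaehler_null \<kappa>" by (simp only: mem_coset_iff)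
  next
    assume *: "p - q \<in> kaehler_null \<kappa>"
    have "p - r \<in> kaehler_null \<kappa> \<longleftrightarrow> q - r \<in> kaehler_null \<kappa>" for r
      using kaehler_null_plus[OF *, of "q - r"] kaehler_null_diff[OF _ *, of "p - r"] by auto
    then show "coset (kaehler_null \<kappa>) p = coset (kaehler_null \<kappa>) q" by (auto simp: mem_coset_iff)
  qed
  then show ?thesis unfolding exact_null_def kaehler_d_def by auto
qed

lemma kaehler_null_exact: "p \<in> kaehler_null \<kappa> \<Longrightarrow> p \<in> exact_null \<kappa>"
  if "unital_ring_hom \<kappa>"
proof -
  assume p: "p \<in> kaehler_null \<kappa>"
  have "gen (\<kappa> 0 * 0) - single 0 (\<kappa> 0) \<in> kaehler_null \<kappa>" by (rule kaehler_null_scale)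
  then have "gen 0 \<in> kaehler_null \<kappa>" using that by (simp add: unital_ring_homD)
  with p show ?thesis using kaehler_null_diff exact_null_iff by blast
qed

locale differentials =
  fixes \<kappa> :: "'k::field \<Rightarrow> 'a::{comm_ring,comm_monoid_mult}"
  assumes hom: "unital_ring_hom \<kappa>"
begin

abbreviation "Knull \<equiv> kaehler_null \<kappa>"
abbreviation "E \<equiv> exact_null \<kappa>"

sublocale F: vector_space "\<lambda>c (p :: 'a \<Rightarrow>\<^sub>0 'a). fscale (\<kappa> c) p"
  using hom by (rule fscale_vector_space)

lemma subspace_exact_null: "F.subspace (E)"
proof (rule F.subspaceI)
  show "0 \<in> E" using kaehler_null_exact[OF hom] kaehler_null_0 by blast
  fix p assume "p \<in> E"
  then obtain a where a: "p - gen a \<in> Knull" by (auto simp: exact_null_iff)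
  show "p + q \<in> E" if q: "q \<in> E" for q
  proof -
    obtain b where b: "q - gen b \<in> Knull" using q by (auto simp: exact_null_iff)
    have "(p - gen a) + (q - gen b) - (gen (a + b) - gen a - gen b) \<in> Knull"
      by (intro kaehler_null_closed kaehler_null_gens a b)
    then have "p + q - gen (a + b) \<in> Knull" by (simp add: algebra_simps)
    then show ?thesis by (auto simp: exact_null_iff)
  qed
  fix c
  have "fscale (\<kappa> c) (p - gen a) - (gen (\<kappa> c * a) - single a (\<kappa> c)) \<in> Knull"
    by (intro kaehler_null_closed kaehler_null_gens a)
  then have "fscale (\<kappa> c) p - gen (\<kappa> c * a) \<in> Knull" by (simp add: algebra_simps)
  then show "fscale (\<kappa> c) p \<in> E" by (auto simp: exact_null_iff)
qed

text \<open>The coset of \<open>p\<close> in \<open>\<Omega>/dA\<close> is represented by the value at \<open>p\<close> of a fixed \<open>k\<close>-linear projection whose kernel is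
  the subspace divided out.\<close>

definition proj :: "('a \<Rightarrow>\<^sub>0 'a) \<Rightarrow> ('a \<Rightarrow>\<^sub>0 'a)" where
  "proj = (SOME P. Vector_Spaces.linear (\<lambda>c. fscale (\<kappa> c)) (\<lambda>c. fscale (\<kappa> c)) P \<and>
     (\<forall>p. P p = 0 \<longleftrightarrow> p \<in> E) \<and> (\<forall>p. P (P p) = P p))"

lemma proj: "Vector_Spaces.linear (\<lambda>c. fscale (\<kappa> c)) (\<lambda>c. fscale (\<kappa> c)) proj \<and>
     (\<forall>p. proj p = 0 \<longleftrightarrow> p \<in> E) \<and> (\<forall>p. proj (proj p) = proj p)"
proof -
  have "\<exists>P. Vector_Spaces.linear (\<lambda>c. fscale (\<kappa> c)) (\<lambda>c. fscale (\<kappa> c)) P \<and>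
      (\<forall>p. P p = 0 \<longleftrightarrow> p \<in> E) \<and> (\<forall>p. P (P p) = P p)"
    using subspace_projection[OF F.vector_space_axioms subspace_exact_null] by metis
  from someI_ex[OF this] show ?thesis unfolding proj_def .
qed

lemma proj_add: "proj (p + q) = proj p + proj q"
  and proj_scale: "proj (fscale (\<kappa> c) p) = fscale (\<kappa> c) (proj p)"
  and proj_eq_0: "proj p = 0 \<longleftrightarrow> p \<in> E"
  and proj_proj: "proj (proj p) = proj p"
  using proj by (simp_all add: Vector_Spaces.linear_iff)

lemmas proj_zero = additive_zero[of proj, OF proj_add]
lemmas proj_diff = additive_diff[of proj, OF proj_add]
lemmas proj_sum = additive_sum[of proj, OF proj_add]

lemma presents_proj: "presents proj (E)"
  unfolding presents_def by (simp add: proj_add proj_eq_0)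

text \<open>The class of \<open>a db\<close>.\<close>

definition dform :: "'a \<Rightarrow> 'a \<Rightarrow> ('a \<Rightarrow>\<^sub>0 'a)" where
  "dform a b = proj (single b a)"

lemma proj_kaehler_null: "p \<in> Knull \<Longrightarrow> proj p = 0"
  using kaehler_null_exact[OF hom] proj_eq_0 by blast

lemma dform_add_left: "dform (a + a') b = dform a b + dform a' b"
  unfolding dform_def by (simp add: single_add proj_add)

lemma dform_scale_left: "dform (\<kappa> c * a) b = fscale (\<kappa> c) (dform a b)"
  unfolding dform_def proj_scale[symmetric] by simp

lemma dform_add_right: "dform a (b + b') = dform a b + dform a b'"
proof -
  have "proj (fscale a (gen (b + b') - gen b - gen b')) = 0"
    by (intro proj_kaehler_null kaehler_null_closed kaehler_null_gens)
  then show ?thesis unfolding dform_def by (simp add: proj_diff) (simp add: diff_eq_eq add.commute)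
qed

lemma dform_scale_right: "dform a (\<kappa> c * b) = dform (\<kappa> c * a) b"
proof -
  have "proj (fscale a (gen (\<kappa> c * b) - single b (\<kappa> c))) = 0"
    by (intro proj_kaehler_null kaehler_null_closed kaehler_null_gens)
  then show ?thesis unfolding dform_def by (simp add: proj_diff mult.commute)
qed

lemma dform_leibniz: "dform a (b * c) = dform (a * b) c + dform (a * c) b"
proof -
  have "proj (fscale a (gen (b * c) - single c b - single b c)) = 0"
    by (intro proj_kaehler_null kaehler_null_closed kaehler_null_gens)
  then show ?thesis unfolding dform_def by (simp add: proj_diff) (simp add: diff_eq_eq ac_simps)
qed

lemmas dform_sum_left = additive_sum[of "\<lambda>a. dform a _", OF dform_add_left]
lemmas dform_zero_left = additive_zero[of "\<lambda>a. dform a _", OF dform_add_left]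
lemmas dform_zero_right = additive_zero[of "\<lambda>b. dform _ b", OF dform_add_right]

text \<open>The Leibniz rule for \<open>d(1 * 1)\<close> gives \<open>a d1 = 0\<close>.\<close>

lemma dform_constant: "dform a (\<kappa> c) = 0"
proof -
  have "dform a 1 = dform a 1 + dform a 1" using dform_leibniz[of a 1 1] by simp
  then have "dform a 1 = 0" by simp
  then show ?thesis using dform_scale_right[of a c 1] dform_scale_left[of c a 1] by simp
qed

end

definition push_form :: "('a \<Rightarrow> 'b) \<Rightarrow> ('a::{comm_ring,comm_monoid_mult} \<Rightarrow>\<^sub>0 'a) \<Rightarrow> ('b::{comm_ring,comm_monoid_mult} \<Rightarrow>\<^sub>0 'b)" where
  "push_form f p = (\<Sum>a\<in>keys p. single (f a) (f (lookup p a)))"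

lemma
  assumes "unital_ring_hom f"
  shows push_form_add: "push_form f (p + q) = push_form f p + push_form f q"
    and push_form_single [simp]: "push_form f (single a c) = single (f a) (f c)"
proof -
  note f = unital_ring_homD[OF assms]
  have eq: "push_form f r = lin_ext (\<lambda>c. fscale (f c)) (\<lambda>b. gen (f b)) r" for r
    unfolding push_form_def lin_ext_def by simp
  show "push_form f (p + q) = push_form f p + push_form f q"
    unfolding eq by (rule lin_ext_add) (simp add: f fscale_add_left)
  show "push_form f (single a c) = single (f a) (f c)"
    unfolding eq by (subst lin_ext_single) (simp_all add: f)
qed

lemmas push_form_diff = additive_diff[of "push_form f", OF push_form_add] for f
lemmas push_form_zero = additive_zero[of "push_form f", OF push_form_add] for f

lemma push_form_fscale:
  assumes "unital_ring_hom f"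
  shows "push_form f (fscale a p) = fscale (f a) (push_form f p)"
  by (rule additive_eqI) (simp_all add: push_form_add assms unital_ring_homD[OF assms])

lemma push_form_kaehler_null:
  assumes f: "unital_ring_hom f" and "f \<circ> \<kappa> = \<kappa>'" and p: "p \<in> kaehler_null \<kappa>"
  shows "push_form f p \<in> kaehler_null \<kappa>'"
proof -
  note push = push_form_add[OF f] push_form_fscale[OF f] push_form_diff[OF f]
  have gen: "push_form f (gen a) = gen (f a)" for a
    unfolding gen_def using f by (simp add: unital_ring_homD)
  have \<kappa>: "f (\<kappa> c) = \<kappa>' c" for c using assms(2) by auto
  have "p \<in> {p. push_form f p \<in> kaehler_null \<kappa>'}"
    by (rule fspan_least[OF p[unfolded kaehler_null_def]])
      (auto simp: push gen unital_ring_homD[OF f] \<kappa> push_form_single[OF f]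
        push_form_zero[OF f]
        intro: kaehler_null_closed kaehler_null_gens)
  then show ?thesis by simp
qed

lemma push_form_exact_null:
  assumes f: "unital_ring_hom f" and "f \<circ> \<kappa> = \<kappa>'" and p: "p \<in> exact_null \<kappa>"
  shows "push_form f p \<in> exact_null \<kappa>'"
proof -
  obtain a where "p - gen a \<in> kaehler_null \<kappa>" using p by (auto simp: exact_null_iff)
  then have "push_form f (p - gen a) \<in> kaehler_null \<kappa>'" by (rule push_form_kaehler_null[OF f assms(2)])
  moreover have "push_form f (p - gen a) = push_form f p - gen (f a)"
    using push_form_diff[OF f] f by (simp add: gen_def unital_ring_homD)
  ultimately show ?thesis unfolding exact_null_iff by auto
qed

lemma kaehler_map_coset:
  fixes \<kappa> :: "'k::field \<Rightarrow> 'a::{comm_ring,comm_monoid_mult}" and \<kappa>' :: "'k \<Rightarrow> 'b::{comm_ring,comm_monoid_mult}"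
  assumes \<kappa>: "unital_ring_hom \<kappa>" and f: "unital_ring_hom f" and f\<kappa>: "f \<circ> \<kappa> = \<kappa>'"
  shows "kaehler_map \<kappa>' f (coset (exact_null \<kappa>) p) = coset (exact_null \<kappa>') (push_form f p)"
proof -
  interpret A: differentials \<kappa> by unfold_locales fact
  interpret B: differentials \<kappa>' using unital_ring_hom_comp[OF f \<kappa>] unfolding f\<kappa> by unfold_locales
  have "B.proj (push_form f p) = B.proj (push_form f q)" if "A.proj p = A.proj q" for p q
  proof -
    have "p - q \<in> exact_null \<kappa>" using that by (simp add: A.proj_eq_0[symmetric] A.proj_diff)
    then have "push_form f (p - q) \<in> exact_null \<kappa>'" by (rule push_form_exact_null[OF f f\<kappa>])
    then show ?thesis
      using push_form_diff[OF f]
      by (simp add: B.proj_eq_0[symmetric] B.proj_diff)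
  qed
  then show ?thesis
    unfolding kaehler_map_def push_form_def[symmetric]
    by (intro lift1_coset[OF A.presents_proj B.presents_proj])
qed

section \<open>The current algebra in coordinates\<close>

context bilinear_map
begin

lemma bil_expand: "\<beta> x y = (\<Sum>i\<in>basis. \<Sum>j\<in>basis. sW (coord x i * coord y j) (\<beta> i j))"
proof -
  have "\<beta> x y = \<beta> (\<Sum>i\<in>basis. sg (coord x i) i) (\<Sum>j\<in>basis. sg (coord y j) j)"
    by (simp only: sum_coord)
  also have "\<dots> = (\<Sum>i\<in>basis. \<beta> (sg (coord x i) i) (\<Sum>j\<in>basis. sg (coord y j) j))"
    by (rule bil_sum(1))
  also have "\<dots> = (\<Sum>i\<in>basis. \<Sum>j\<in>basis. \<beta> (sg (coord x i) i) (sg (coord y j) j))"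
    by (simp only: bil_sum(2))
  finally show ?thesis by (simp only: bil(3,4) W.scale_scale mult.commute)
qed

end

lemma sum_fun_apply: "(\<Sum>i\<in>I. h i) x = (\<Sum>i\<in>I. h i x)"
  for h :: "'i \<Rightarrow> 'a \<Rightarrow> 'b::ab_group_add"
  by (induction I rule: infinite_finite_induct) (simp_all add: plus_fun_apply zero_fun_apply)

definition smul :: "'s::times \<Rightarrow> ('g \<Rightarrow> 's) \<Rightarrow> 'g \<Rightarrow> 's" where
  "smul a v = (\<lambda>b. a * v b)"

lemma smul_apply: "smul a v b = a * v b"
  by (simp add: smul_def)

text \<open>The pointwise rules stay out of the simpset. Induction produces eta-expanded sums of functions, in which
  these rules would unfold the addition.\<close>

declare plus_fun_apply [simp del] zero_fun_apply [simp del]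

lemmas fun_simps = plus_fun_apply zero_fun_apply smul_apply fun_eq_iff

lemma smul_simps [simp]:
  fixes a c :: "'s::{comm_ring,comm_monoid_mult}"
  shows "smul a (v + w) = smul a v + smul a w" "smul a (smul c v) = smul (a * c) v" "smul 1 v = v"
    "smul a 0 = 0" "smul 0 v = 0"
  by (simp_all add: fun_simps algebra_simps)

lemma smul_add_left: "smul (a + c) v = smul a v + smul c v"
  for a c :: "'s::{comm_ring,comm_monoid_mult}"
  by (simp add: fun_simps algebra_simps)

lemma smul_sum: "smul a (\<Sum>i\<in>I. h i) = (\<Sum>i\<in>I. smul a (h i))"
  for a :: "'s::{comm_ring,comm_monoid_mult}"
  by (rule additive_sum[of "smul a"]) simp

lemma smul_sum_left: "smul (\<Sum>i\<in>I. h i) v = (\<Sum>i\<in>I. smul (h i) v)"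
  for v :: "'g \<Rightarrow> 's::{comm_ring,comm_monoid_mult}"
  by (rule additive_sum[of "\<lambda>a. smul a v"]) (rule smul_add_left)

locale current = split_simple_lie_algebra sg br + differentials \<kappa>
  for sg :: "'k::field_char_0 \<Rightarrow> 'g::ab_group_add \<Rightarrow> 'g" and br
    and \<kappa> :: "'k \<Rightarrow> 's::{comm_ring,comm_monoid_mult}"
begin

lemmas \<kappa> = unital_ring_homD[OF hom]

text \<open>With \<open>v b\<close> the coefficient of the basis vector \<open>b\<close>, the tensor product \<open>g \<otimes> S\<close> becomes the space \<open>V\<close>
  of functions supported on the basis, and \<open>ten x s\<close> is \<open>x \<otimes> s\<close>.\<close>

definition ten :: "'g \<Rightarrow> 's \<Rightarrow> 'g \<Rightarrow> 's" where
  "ten x s = (\<lambda>b. \<kappa> (coord x b) * s)"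

definition V :: "('g \<Rightarrow> 's) set" where
  "V = {v. \<forall>b. b \<notin> basis \<longrightarrow> v b = 0}"

lemma V_closed [simp]: "0 \<in> V" "v \<in> V \<Longrightarrow> w \<in> V \<Longrightarrow> v + w \<in> V" "v \<in> V \<Longrightarrow> smul a v \<in> V" "ten x s \<in> V"
  by (simp_all add: V_def ten_def coord_outside \<kappa> fun_simps)

lemma V_sum: "(\<And>i. i \<in> I \<Longrightarrow> h i \<in> V) \<Longrightarrow> (\<Sum>i\<in>I. h i) \<in> V"
  by (induction I rule: infinite_finite_induct) simp_all

lemma ten_add_left: "ten (x + y) s = ten x s + ten y s"
  and ten_add_right: "ten x (s + t) = ten x s + ten x t"
  and ten_scale: "ten (sg c x) s = smul (\<kappa> c) (ten x s)"
  and ten_mult: "ten x (a * s) = smul a (ten x s)"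
  by (simp_all add: ten_def fun_simps coord_add coord_scale \<kappa> algebra_simps)

lemma smul_ten: "smul a (ten x s) = ten x (a * s)"
  by (simp add: ten_mult)

lemma V_expand: "v \<in> V \<Longrightarrow> v = (\<Sum>b\<in>basis. ten b (v b))"
proof
  fix c assume v: "v \<in> V"
  have "(\<Sum>b\<in>basis. ten b (v b) c) = (\<Sum>b\<in>basis. if b = c then v c else 0)"
    by (intro sum.cong refl) (auto simp: ten_def coord_basis \<kappa>)
  then show "v c = (\<Sum>b\<in>basis. ten b (v b)) c" using v by (simp add: sum_fun_apply V_def)
qed

lemma V_induct [consumes 1, case_names zero add ten]:
  assumes "v \<in> V" "P 0" "\<And>v w. v \<in> V \<Longrightarrow> w \<in> V \<Longrightarrow> P v \<Longrightarrow> P w \<Longrightarrow> P (v + w)" "\<And>x s. P (ten x s)"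
  shows "P v"
proof -
  have "(\<Sum>b\<in>A. ten b (v b)) \<in> V \<and> P (\<Sum>b\<in>A. ten b (v b))" for A
    by (induction A rule: infinite_finite_induct) (simp_all add: assms)
  then show ?thesis using V_expand[OF assms(1)] by metis
qed

definition brV :: "('g \<Rightarrow> 's) \<Rightarrow> ('g \<Rightarrow> 's) \<Rightarrow> 'g \<Rightarrow> 's" where
  "brV v w = (\<lambda>b. \<Sum>i\<in>basis. \<Sum>j\<in>basis. v i * w j * \<kappa> (coord (br i j) b))"

text \<open>The cocycle \<open>(x \<otimes> a, y \<otimes> b) \<mapsto> (x|y) a db\<close> that defines the central extension, as a differential form and
  modulo exact forms. Ring homomorphisms act on forms, but they need not be compatible with the chosen
  projection.\<close>

definition tau_form :: "('g \<Rightarrow> 's) \<Rightarrow> ('g \<Rightarrow> 's) \<Rightarrow> ('s \<Rightarrow>\<^sub>0 's)" where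
  "tau_form v w = (\<Sum>i\<in>basis. \<Sum>j\<in>basis. single (w j) (\<kappa> (killing i j) * v i))"

definition tau :: "('g \<Rightarrow> 's) \<Rightarrow> ('g \<Rightarrow> 's) \<Rightarrow> ('s \<Rightarrow>\<^sub>0 's)" where
  "tau v w = proj (tau_form v w)"

definition killing_S :: "('g \<Rightarrow> 's) \<Rightarrow> ('g \<Rightarrow> 's) \<Rightarrow> 's" where
  "killing_S v w = (\<Sum>i\<in>basis. \<Sum>j\<in>basis. \<kappa> (killing i j) * v i * w j)"

lemma tau_eq: "tau v w = (\<Sum>i\<in>basis. \<Sum>j\<in>basis. dform (\<kappa> (killing i j) * v i) (w j))"
  unfolding tau_def tau_form_def by (simp add: proj_sum dform_def)

lemma brV_in_V [simp]: "brV v w \<in> V"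
  by (simp add: V_def brV_def coord_outside \<kappa>)

lemma brV_add: "brV (v + v') w = brV v w + brV v' w" "brV v (w + w') = brV v w + brV v w'"
  by (simp_all add: brV_def fun_simps algebra_simps sum.distrib)

lemma brV_smul: "brV (smul a v) w = smul a (brV v w)" "brV v (smul a w) = smul a (brV v w)"
  by (simp_all add: brV_def fun_simps sum_distrib_left algebra_simps)

lemma brV_zero [simp]: "brV 0 w = 0" "brV v 0 = 0"
  by (simp_all add: brV_def fun_simps)

lemma killing_S_add: "killing_S (v + v') w = killing_S v w + killing_S v' w" "killing_S v (w + w') = killing_S v w + killing_S v w'"
  by (simp_all add: killing_S_def fun_simps algebra_simps sum.distrib)

lemma killing_S_zero [simp]: "killing_S 0 w = 0" "killing_S v 0 = 0"
  by (simp_all add: killing_S_def fun_simps)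

lemma tau_add: "tau (v + v') w = tau v w + tau v' w" "tau v (w + w') = tau v w + tau v w'"
  by (simp_all add: tau_eq fun_simps dform_add_left dform_add_right sum.distrib distrib_left)

lemma tau_zero [simp]: "tau 0 w = 0" "tau v 0 = 0"
  by (simp_all add: tau_eq fun_simps dform_zero_left dform_zero_right)

lemma tau_scale: "tau (smul (\<kappa> c) v) w = fscale (\<kappa> c) (tau v w)"
  "tau v (smul (\<kappa> c) w) = fscale (\<kappa> c) (tau v w)"
proof -
  have "dform (x * (\<kappa> c * a)) b = fscale (\<kappa> c) (dform (x * a) b)" for x a b
    using dform_scale_left[of c "x * a" b] by (simp add: mult.left_commute)
  then show "tau (smul (\<kappa> c) v) w = fscale (\<kappa> c) (tau v w)"
    by (simp add: tau_eq smul_apply fscale_sum)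
  show "tau v (smul (\<kappa> c) w) = fscale (\<kappa> c) (tau v w)"
    by (simp add: tau_eq smul_apply fscale_sum dform_scale_right dform_scale_left)
qed

lemma scalar_bilinear:
  "bilinear_map sg br (*) killing" "bilinear_map sg br (*) (\<lambda>x y. coord (br x y) b)"
proof -
  show "bilinear_map sg br (*) killing"
    by unfold_locales (simp_all add: killing_add killing_add_right killing_scale killing_scale_right algebra_simps)
  show "bilinear_map sg br (*) (\<lambda>x y. coord (br x y) b)"
    by unfold_locales (simp_all add: br_simps coord_add coord_scale algebra_simps)
qed

lemma brV_ten: "brV (ten x a) (ten y c) = ten (br x y) (a * c)"
proof
  fix b
  show "brV (ten x a) (ten y c) b = ten (br x y) (a * c) b"
    unfolding brV_def ten_def bilinear_map.bil_expand[OF scalar_bilinear(2), of x y b]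
    by (simp add: \<kappa> sum_distrib_left sum_distrib_right mult.assoc mult.left_commute mult.commute)
qed

lemma killing_S_ten: "killing_S (ten x a) (ten y c) = \<kappa> (killing x y) * a * c"
  unfolding killing_S_def ten_def bilinear_map.bil_expand[OF scalar_bilinear(1), of x y]
  by (simp add: \<kappa> sum_distrib_left sum_distrib_right mult.assoc mult.left_commute mult.commute)

lemma tau_ten: "tau (ten x a) (ten y c) = dform (\<kappa> (killing x y) * a) c"
proof -
  have "tau (ten x a) (ten y c) = (\<Sum>i\<in>basis. \<Sum>j\<in>basis. dform (\<kappa> (coord x i * coord y j * killing i j) * a) c)"
    unfolding tau_eq ten_def dform_scale_right by (simp add: \<kappa> ac_simps)
  also have "\<dots> = dform (\<kappa> (killing x y) * a) c"
    unfolding bilinear_map.bil_expand[OF scalar_bilinear(1), of x y]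
    by (simp add: \<kappa>(7) sum_distrib_right dform_sum_left)
  finally show ?thesis .
qed

text \<open>On pure tensors the following three identities are instances of the Leibniz rule.\<close>

lemma tau_leibniz_left:
  assumes "v \<in> V" "w \<in> V"
  shows "tau (smul a v) w + tau (smul a w) v = dform a (killing_S v w)"
  using assms(1)
proof (induction rule: V_induct)
  case (ten x p)
  show ?case using assms(2)
  proof (induction rule: V_induct)
    case (ten y q)
    have "dform a (\<kappa> (killing x y) * p * q) = dform (\<kappa> (killing x y) * a) (p * q)"
      by (simp add: dform_scale_right mult.assoc)
    then show ?case
      by (simp add: smul_ten tau_ten killing_S_ten dform_leibniz killing_sym[of y x] mult.assoc)
  next
  case (add v' w')
  show ?case using arg_cong2[OF add(3) add(4), of "(+)"] by (simp add: dform_zero_right tau_add killing_S_add dform_add_right ac_simps)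
qed (simp add: dform_zero_right tau_add killing_S_add dform_add_right)
next
  case (add v' w')
  show ?case using arg_cong2[OF add(3) add(4), of "(+)"] by (simp add: dform_zero_right tau_add killing_S_add dform_add_right ac_simps)
qed (simp add: dform_zero_right tau_add killing_S_add dform_add_right)

lemma tau_smul_right:
  assumes "v \<in> V" "w \<in> V"
  shows "tau (smul a v) (smul c w) = tau (smul (a * c) v) w + dform (a * killing_S v w) c"
  using assms(1)
proof (induction rule: V_induct)
  case (ten x p)
  show ?case using assms(2)
  proof (induction rule: V_induct)
    case (ten y q)
    then show ?case by (simp add: smul_ten tau_ten killing_S_ten dform_leibniz ac_simps)
  next
  case (add v' w')
  show ?case using arg_cong2[OF add(3) add(4), of "(+)"] by (simp add: dform_zero_left tau_add killing_S_add dform_add_left distrib_left ac_simps)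
qed (simp add: dform_zero_left tau_add killing_S_add dform_add_left distrib_left)
next
  case (add v' w')
  show ?case using arg_cong2[OF add(3) add(4), of "(+)"] by (simp add: dform_zero_left tau_add killing_S_add dform_add_left distrib_left ac_simps)
qed (simp add: dform_zero_left tau_add killing_S_add dform_add_left distrib_left)

lemma tau_cyclic:
  assumes "u \<in> V" "v \<in> V" "w \<in> V"
  shows "tau (smul a (brV u v)) w + tau (smul a (brV v w)) u + tau (smul a (brV w u)) v =
    dform a (killing_S (brV u v) w)"
  using assms(1)
proof (induction rule: V_induct)
  case (ten x p)
  show ?case using assms(2)
  proof (induction rule: V_induct)
    case (ten y q)
    show ?case using assms(3)
    proof (induction rule: V_induct)
      case (ten z r)
      let ?K = "\<kappa> (killing (br x y) z)"
      have K: "killing (br y z) x = killing (br x y) z" "killing (br z x) y = killing (br x y) z"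
        by (metis killing_invariant killing_sym)+
      have "dform a (?K * (p * q * r)) = dform (?K * a) (p * (q * r))"
        by (simp add: dform_scale_right mult.assoc)
      also have "\<dots> = dform (?K * a * p * q) r + dform (?K * a * q * r) p + dform (?K * a * r * p) q"
        by (simp add: dform_leibniz ac_simps)
      finally show ?case
        by (simp add: brV_ten smul_ten tau_ten killing_S_ten K ac_simps)
    next
  case (add v' w')
  show ?case using arg_cong2[OF add(3) add(4), of "(+)"] by (simp add: dform_zero_right tau_add killing_S_add brV_add dform_add_right ac_simps)
qed (simp add: dform_zero_right tau_add killing_S_add brV_add dform_add_right)
  next
  case (add v' w')
  show ?case using arg_cong2[OF add(3) add(4), of "(+)"] by (simp add: dform_zero_right tau_add killing_S_add brV_add dform_add_right ac_simps)
qed (simp add: dform_zero_right tau_add killing_S_add brV_add dform_add_right)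
next
  case (add v' w')
  show ?case using arg_cong2[OF add(3) add(4), of "(+)"] by (simp add: dform_zero_right tau_add killing_S_add brV_add dform_add_right ac_simps)
qed (simp add: dform_zero_right tau_add killing_S_add brV_add dform_add_right)

section \<open>The Killing form under \<open>S\<close>-linear automorphisms\<close>

definition S_linear :: "(('g \<Rightarrow> 's) \<Rightarrow> 'g \<Rightarrow> 's) \<Rightarrow> bool" where
  "S_linear A \<longleftrightarrow> (\<forall>v\<in>V. A v \<in> V) \<and> (\<forall>v\<in>V. \<forall>w\<in>V. A (v + w) = A v + A w) \<and> (\<forall>a. \<forall>v\<in>V. A (smul a v) = smul a (A v))"

lemma S_linearD:
  assumes "S_linear A" "v \<in> V"
  shows "A v \<in> V" "w \<in> V \<Longrightarrow> A (v + w) = A v + A w" "A (smul a v) = smul a (A v)" "A 0 = 0"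
  using assms unfolding S_linear_def by (blast, blast, blast, metis V_closed(1) smul_simps(5))

lemma S_linear_sum:
  assumes "S_linear A" "\<And>i. i \<in> I \<Longrightarrow> h i \<in> V"
  shows "A (\<Sum>i\<in>I. h i) = (\<Sum>i\<in>I. A (h i))"
  using assms(2)
  by (induction I rule: infinite_finite_induct)
    (simp_all add: S_linearD[OF assms(1)] S_linearD(4)[OF assms(1) V_closed(1)] V_sum)

lemma S_linear_expand:
  assumes "S_linear A" "v \<in> V"
  shows "A v = (\<Sum>b\<in>basis. smul (v b) (A (ten b 1)))"
proof -
  have "A v = A (\<Sum>b\<in>basis. smul (v b) (ten b 1))"
    using V_expand[OF assms(2)] by (simp add: smul_ten)
  then show ?thesis by (simp add: S_linear_sum[OF assms(1)] S_linearD[OF assms(1)])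
qed

definition trace_S :: "(('g \<Rightarrow> 's) \<Rightarrow> 'g \<Rightarrow> 's) \<Rightarrow> 's" where
  "trace_S A = (\<Sum>b\<in>basis. A (ten b 1) b)"

lemma trace_S_add: "trace_S (\<lambda>v. A v + C v) = trace_S A + trace_S C"
  by (simp add: trace_S_def sum.distrib plus_fun_apply)

lemma trace_S_zero: "trace_S (\<lambda>v. 0) = 0"
  by (simp add: trace_S_def zero_fun_apply)

lemma trace_S_comm:
  assumes "S_linear A" "S_linear C"
  shows "trace_S (\<lambda>v. A (C v)) = trace_S (\<lambda>v. C (A v))"
proof -
  have *: "trace_S (\<lambda>v. A (C v)) = (\<Sum>b\<in>basis. \<Sum>c\<in>basis. C (ten b 1) c * A (ten c 1) b)"
    if "S_linear A" "S_linear C" for A C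
    unfolding trace_S_def
    by (intro sum.cong refl, subst S_linear_expand[OF that(1)]) (simp_all add: S_linearD[OF that(2)] sum_fun_apply smul_apply)
  show ?thesis
    unfolding *[OF assms] *[OF assms(2,1)] by (subst sum.swap) (simp add: mult.commute)
qed

lemma killing_S_eq_trace:
  assumes "v \<in> V" "w \<in> V"
  shows "killing_S v w = trace_S (\<lambda>z. brV v (brV w z))"
  using assms(1)
proof (induction rule: V_induct)
  case (ten x p)
  show ?case using assms(2)
  proof (induction rule: V_induct)
    case (ten y q)
    show ?case
      by (simp add: killing_S_ten trace_S_def brV_ten killing_eq trace_eq \<kappa> sum_distrib_right)
        (simp add: ten_def mult.assoc)
  qed (simp_all add: killing_S_add brV_add trace_S_add trace_S_zero)
qed (simp_all add: killing_S_add brV_add trace_S_add trace_S_zero)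

definition S_aut :: "(('g \<Rightarrow> 's) \<Rightarrow> 'g \<Rightarrow> 's) \<Rightarrow> bool" where
  "S_aut \<theta> \<longleftrightarrow> S_linear \<theta> \<and> bij_betw \<theta> V V \<and> (\<forall>v\<in>V. \<forall>w\<in>V. \<theta> (brV v w) = brV (\<theta> v) (\<theta> w))"

text \<open>The Killing form of \<open>g\<^sub>S\<close> is a trace over \<open>S\<close>, and conjugation by \<open>\<theta>\<close> turns \<open>ad v\<close> into \<open>ad (\<theta> v)\<close>.\<close>

lemma killing_S_aut:
  assumes "S_aut \<theta>" "v \<in> V" "w \<in> V"
  shows "killing_S (\<theta> v) (\<theta> w) = killing_S v w"
proof -
  have S_linear: "S_linear \<theta>" and bij: "bij_betw \<theta> V V" and br: "\<And>v w. v \<in> V \<Longrightarrow> w \<in> V \<Longrightarrow> \<theta> (brV v w) = brV (\<theta> v) (\<theta> w)"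
    using assms(1) unfolding S_aut_def by auto
  define \<eta> where "\<eta> = inv_into V \<theta>"
  have \<eta>: "\<eta> z \<in> V" "\<theta> (\<eta> z) = z" if "z \<in> V" for z
    using that bij unfolding \<eta>_def by (simp_all add: bij_betw_def inv_into_into f_inv_into_f)
  have \<eta>\<theta>: "\<eta> (\<theta> z) = z" if "z \<in> V" for z
    using that bij unfolding \<eta>_def by (simp add: bij_betw_inv_into_left)
  have "S_linear \<eta>"
    unfolding S_linear_def
  proof (intro conjI ballI allI)
    fix v w a assume v: "v \<in> V"
    show "\<eta> v \<in> V" using v by (rule \<eta>)
    have "\<theta> (smul a (\<eta> v)) = smul a v" using S_linearD[OF S_linear] \<eta> v by simp
    then show "\<eta> (smul a v) = smul a (\<eta> v)" using \<eta>\<theta>[of "smul a (\<eta> v)"] \<eta> v by simp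
    assume w: "w \<in> V"
    have "\<theta> (\<eta> v + \<eta> w) = v + w" using S_linearD[OF S_linear] \<eta> v w by simp
    then show "\<eta> (v + w) = \<eta> v + \<eta> w" using \<eta>\<theta>[of "\<eta> v + \<eta> w"] \<eta> v w by simp
  qed
  then have SL2: "S_linear (\<lambda>z. brV v (brV w (\<eta> z)))"
    by (simp add: S_linear_def brV_add brV_smul)
  have "killing_S (\<theta> v) (\<theta> w) = trace_S (\<lambda>z. brV (\<theta> v) (brV (\<theta> w) z))"
    using assms S_linear by (intro killing_S_eq_trace) (auto dest: S_linearD)
  also have "\<dots> = trace_S (\<lambda>z. \<theta> (brV v (brV w (\<eta> z))))"
    unfolding trace_S_def by (simp add: br assms \<eta>)
  also have "\<dots> = trace_S (\<lambda>z. brV v (brV w (\<eta> (\<theta> z))))"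
    by (rule trace_S_comm[OF S_linear SL2])
  also have "\<dots> = trace_S (\<lambda>z. brV v (brV w z))"
    unfolding trace_S_def by (simp add: \<eta>\<theta>)
  also have "\<dots> = killing_S v w" using assms by (simp add: killing_S_eq_trace)
  finally show ?thesis .
qed

section \<open>The correction term of a lift\<close>

text \<open>For \<open>v = z \<otimes> a\<close> this is the Casimir primitive at \<open>z\<close> of the 2-cocycle \<open>(x, y) \<mapsto> tau (a \<theta>(x \<otimes> 1)) (\<theta>(y \<otimes> 1))\<close> of \<open>g\<close>.\<close>

definition shift :: "(('g \<Rightarrow> 's) \<Rightarrow> 'g \<Rightarrow> 's) \<Rightarrow> ('g \<Rightarrow> 's) \<Rightarrow> ('s \<Rightarrow>\<^sub>0 's)" where
  "shift \<theta> v = (\<Sum>i\<in>basis. \<Sum>b\<in>basis. tau (smul (v i) (\<theta> (ten (br i b) 1))) (\<theta> (ten (dual b) 1)))"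

lemma shift_add: "shift \<theta> (v + w) = shift \<theta> v + shift \<theta> w"
  by (simp add: shift_def plus_fun_apply smul_add_left tau_add sum.distrib)

lemma shift_scale: "shift \<theta> (smul (\<kappa> c) v) = fscale (\<kappa> c) (shift \<theta> v)"
  by (simp add: shift_def smul_apply tau_scale fscale_sum flip: smul_simps(2))

lemma shift_zero [simp]: "shift \<theta> 0 = 0"
  by (simp add: shift_def zero_fun_apply)

lemma proj_tau [simp]: "proj (tau v w) = tau v w"
  by (simp add: tau_def proj_proj)

lemma proj_shift [simp]: "proj (shift \<theta> v) = shift \<theta> v"
  by (simp add: shift_def proj_sum)

text \<open>Modulo exact forms, \<open>tau (\<theta>(x \<otimes> a)) (\<theta>(y \<otimes> c))\<close> is \<open>ac tau (\<theta>(x \<otimes> 1)) (\<theta>(y \<otimes> 1)) + (x|y) a dc\<close>, because \<open>\<theta>\<close>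
  preserves the Killing form. The second term is \<open>tau (x \<otimes> a) (y \<otimes> c)\<close>. The first is
  a 2-cocycle of \<open>g\<close> in \<open>x\<close> and \<open>y\<close>: its defects are of the form \<open>a d(c)\<close> with \<open>c \<in> k\<close>, again by
  invariance of the Killing form. Whitehead's lemma applies to it.\<close>

theorem shift_brV:
  assumes "S_aut \<theta>" "v \<in> V" "w \<in> V"
  shows "shift \<theta> (brV v w) = tau (\<theta> v) (\<theta> w) - tau v w"
proof -
  have S_linear: "S_linear \<theta>" and br: "\<And>v w. v \<in> V \<Longrightarrow> w \<in> V \<Longrightarrow> \<theta> (brV v w) = brV (\<theta> v) (\<theta> w)"
    using assms(1) unfolding S_aut_def by auto
  note linD = S_linearD(1-3)[OF S_linear] S_linearD(4)[OF S_linear V_closed(1)]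
  let ?t = "\<lambda>x. \<theta> (ten x 1)"
  have \<theta>_ten: "\<theta> (ten x s) = smul s (?t x)" for x s
    using linD(3)[of "ten x 1" s] by (simp add: smul_ten)
  have t_add: "?t (x + y) = ?t x + ?t y" and t_scale: "?t (sg c x) = smul (\<kappa> c) (?t x)"
    and t_br: "?t (br_x_y) = brV (?t x) (?t y)" if "br_x_y = br x y" for x y c br_x_y
    using br[of "ten x 1" "ten y 1"] by (simp_all add: that ten_add_left ten_scale linD brV_ten)
  have tV [simp]: "?t x \<in> V" for x by (simp add: linD)
  have KSt: "killing_S (?t x) (?t y) = \<kappa> (killing x y)" for x y
    by (simp add: killing_S_aut assms(1) killing_S_ten)
  have W: "bilinear_map sg br (\<lambda>c. fscale (\<kappa> c)) (\<lambda>x y. tau (smul a (?t x)) (?t y))" for a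
  proof unfold_locales
    show "tau (smul a (?t (sg c x))) (?t y) = fscale (\<kappa> c) (tau (smul a (?t x)) (?t y))" for c x y
      using tau_scale(1)[of c "smul a (?t x)"] by (simp add: t_scale[OF refl] mult.commute)
  qed (simp_all add: t_add[OF refl] t_scale[OF refl] tau_add tau_scale)
  have shift_ten: "shift \<theta> (ten (br x y) a) = tau (smul a (?t x)) (?t y)" for x y a
  proof -
    interpret W: bilinear_map sg br "\<lambda>c. fscale (\<kappa> c)" "\<lambda>x y. tau (smul a (?t x)) (?t y)"
      by (rule W)
    have "shift \<theta> (ten z a) = (\<Sum>b\<in>basis. tau (smul a (?t (br z b))) (?t (dual b)))" for z
    proof -
      have expand: "(\<Sum>i\<in>basis. sg (coord z i) (br i b)) = br z b" for b
        using lin_expand[OF lin_br_left, of z b] by simp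
      have "shift \<theta> (ten z a) = (\<Sum>b\<in>basis. \<Sum>i\<in>basis. fscale (\<kappa> (coord z i)) (tau (smul a (?t (br i b))) (?t (dual b))))"
        unfolding shift_def ten_def by (subst sum.swap) (simp add: tau_scale flip: smul_simps(2))
      also have "\<dots> = (\<Sum>b\<in>basis. tau (smul a (?t (\<Sum>i\<in>basis. sg (coord z i) (br i b)))) (?t (dual b)))"
        by (simp add: W.bil_sum W.bil)
      finally show ?thesis by (simp add: expand)
    qed
    moreover have "(\<Sum>b\<in>basis. tau (smul a (?t (br (br x y) b))) (?t (dual b))) = tau (smul a (?t x)) (?t y)"
    proof (rule W.whitehead_second)
      fix x y z
      show "tau (smul a (?t y)) (?t x) = - tau (smul a (?t x)) (?t y)"
        using tau_leibniz_left[OF tV tV, of a y x] by (simp add: KSt dform_constant eq_neg_iff_add_eq_0)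
      show "tau (smul a (?t (br x y))) (?t z) + tau (smul a (?t (br y z))) (?t x) + tau (smul a (?t (br z x))) (?t y) = 0"
        using tau_cyclic[OF tV tV tV, of a x y z]
        by (simp add: t_br[OF refl, symmetric] KSt dform_constant)
    qed
    ultimately show ?thesis by simp
  qed
  show ?thesis using assms(2)
  proof (induction rule: V_induct)
    case (ten x a)
    show ?case using assms(3)
    proof (induction rule: V_induct)
      case (ten y c)
      have "tau (\<theta> (ten x a)) (\<theta> (ten y c)) = tau (smul (a * c) (?t x)) (?t y) + dform (a * \<kappa> (killing x y)) c"
        unfolding \<theta>_ten[of x a] \<theta>_ten[of y c] by (simp add: tau_smul_right KSt)
      then show ?case by (simp add: brV_ten shift_ten tau_ten mult.commute)
    qed (simp_all add: brV_add shift_add tau_add linD)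
  qed (simp_all add: brV_add shift_add tau_add linD)
qed

end

section \<open>The current algebra and its central extension as quotients\<close>

context current
begin

abbreviation "N \<equiv> current_null sg \<kappa>"
abbreviation "gS \<equiv> current_algebra sg br \<kappa>"
abbreviation "U \<equiv> uce sg br \<kappa>"

definition vec :: "('g \<times> 's \<Rightarrow>\<^sub>0 'k) \<Rightarrow> 'g \<Rightarrow> 's" where
  "vec = lin_ext (\<lambda>c. smul (\<kappa> c)) (\<lambda>(x, s). ten x s)"

definition unvec :: "('g \<Rightarrow> 's) \<Rightarrow> ('g \<times> 's \<Rightarrow>\<^sub>0 'k)" where
  "unvec v = (\<Sum>b\<in>basis. gen (b, v b))"

lemma vec_add: "vec (p + q) = vec p + vec q"
  unfolding vec_def by (rule lin_ext_add) (simp add: \<kappa> smul_add_left)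

lemma vec_single: "vec (single (x, s) c) = smul (\<kappa> c) (ten x s)"
  unfolding vec_def by (subst lin_ext_single) (simp_all add: \<kappa>)

lemma vec_gen [simp]: "vec (gen (x, s)) = ten x s"
  unfolding gen_def by (simp add: vec_single \<kappa>)

lemmas vec_zero = additive_zero[of vec, OF vec_add]
lemmas vec_diff = additive_diff[of vec, OF vec_add]
lemmas vec_sum = additive_sum[of vec, OF vec_add]

lemma vec_fscale: "vec (fscale c p) = smul (\<kappa> c) (vec p)"
proof (rule additive_eqI)
  fix a :: "'g \<times> 's" and d
  show "vec (fscale c (single a d)) = smul (\<kappa> c) (vec (single a d))"
    by (cases a) (simp add: vec_single \<kappa>)
qed (simp_all add: vec_add)

lemma vec_in_V [simp]: "vec p \<in> V"
proof (induction p rule: poly_mapping_single_induct)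
  case (add a c p)
  then show ?case by (cases a) (simp add: vec_add vec_single)
qed (simp add: vec_zero)

lemma vec_unvec: "v \<in> V \<Longrightarrow> vec (unvec v) = v"
  using V_expand[of v] by (simp add: unvec_def vec_sum)

lemma N_closed: "0 \<in> N" "p \<in> N \<Longrightarrow> q \<in> N \<Longrightarrow> p + q \<in> N" "p \<in> N \<Longrightarrow> fscale c p \<in> N"
  unfolding current_null_def tensor_null_def by (simp_all add: fspan_zero fspan_add fspan_scale)

lemma N_gens: "gen (x + x', y) - gen (x, y) - gen (x', y) \<in> N"
    "gen (x, y + y') - gen (x, y) - gen (x, y') \<in> N"
    "gen (sg c x, y) - single (x, y) c \<in> N"
    "gen (x, \<kappa> c * y) - single (x, y) c \<in> N"
  unfolding current_null_def tensor_null_def alg_scale_def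
  by (rule fspan_base, simp, blast)+

lemma vec_null: "p \<in> N \<Longrightarrow> vec p = 0"
proof -
  assume p: "p \<in> N"
  have "p \<in> {p. vec p = 0}"
    by (rule fspan_least[OF p[unfolded current_null_def tensor_null_def]])
      (auto simp: vec_add vec_diff vec_zero vec_fscale vec_single ten_add_left ten_add_right ten_scale
        alg_scale_def smul_ten)
  then show ?thesis by simp
qed

text \<open>A bilinear map such as \<open>(x, s) \<mapsto> x \<otimes> s\<close> is determined by its values at \<open>(b, s)\<close> with \<open>b\<close> in the basis, so that an
  element of \<open>g \<otimes> S\<close> is determined by its coordinates.\<close>

lemma presents_vec: "presents vec N"
proof -
  have vs: "vector_space (fscale :: 'k \<Rightarrow> ('g \<times> 's \<Rightarrow>\<^sub>0 'k) \<Rightarrow> _)"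
    using fscale_vector_space[of "\<lambda>x::'k. x"] by (simp add: unital_ring_hom_def)
  interpret K: vector_space "fscale :: 'k \<Rightarrow> ('g \<times> 's \<Rightarrow>\<^sub>0 'k) \<Rightarrow> _" by (rule vs)
  have sub: "K.subspace N" by (rule K.subspaceI) (simp_all add: N_closed)
  obtain P :: "('g \<times> 's \<Rightarrow>\<^sub>0 'k) \<Rightarrow> ('g \<times> 's \<Rightarrow>\<^sub>0 'k)" where lin: "Vector_Spaces.linear fscale fscale P" and ker: "\<And>p. P p = 0 \<longleftrightarrow> p \<in> N"
    by (rule subspace_projection[OF vs sub]) blast
  have P_add: "P (p + q) = P p + P q" and P_scale: "P (fscale c p) = fscale c (P p)" for p q c
    using lin by (simp_all add: Vector_Spaces.linear_iff)
  note P_diff = additive_diff[of P, OF P_add]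
  let ?g = "\<lambda>x s. P (gen (x, s))"
  have single: "P (single (x, s) c) = fscale c (?g x s)" for x s c
    by (simp add: P_scale[symmetric])
  have g_add: "?g (x + x') s = ?g x s + ?g x' s" "?g x (s + s') = ?g x s + ?g x s'" for x x' s s'
    using N_gens(1)[of x x' s] N_gens(2)[of x s s'] unfolding ker[symmetric]
    by (simp_all add: P_diff) (simp_all add: diff_eq_eq ac_simps)
  have g_scale: "?g (sg c x) s = fscale c (?g x s)" "?g x (\<kappa> c * s) = fscale c (?g x s)" for c x s
    using N_gens(3)[of c x s] N_gens(4)[of x c s] unfolding ker[symmetric]
    by (simp_all add: P_diff single)
  have g_expand: "?g x s = (\<Sum>b\<in>basis. ?g b (\<kappa> (coord x b) * s))" for x s
  proof -
    have "?g (\<Sum>b\<in>basis. sg (coord x b) b) s = (\<Sum>b\<in>basis. ?g (sg (coord x b) b) s)"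
      by (rule additive_sum[of "\<lambda>x. ?g x s"]) (rule g_add)
    then show ?thesis by (simp add: sum_coord g_scale)
  qed
  have P_eq: "P p = (\<Sum>b\<in>basis. ?g b (vec p b))" for p
  proof (rule additive_eqI[of P "\<lambda>p. \<Sum>b\<in>basis. ?g b (vec p b)"])
    fix a :: "'g \<times> 's" and c
    show "P (single a c) = (\<Sum>b\<in>basis. ?g b (vec (single a c) b))"
    proof (cases a)
      case (Pair x s)
      show ?thesis
        unfolding Pair single vec_single
        by (subst g_expand) (simp add: fscale_sum smul_apply ten_def g_scale)
    qed
  qed (simp_all add: P_add vec_add plus_fun_apply g_add sum.distrib)
  have g0: "?g b 0 = 0" for b by (rule additive_zero[of "?g b"]) (rule g_add)
  have "P p = 0" if "vec p = 0" for p
    unfolding P_eq[of p] that by (simp add: zero_fun_apply g0)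
  then have "p \<in> N" if "vec p = 0" for p using that ker by blast
  then show ?thesis unfolding presents_def using vec_add vec_null by blast
qed

text \<open>The bijection \<open>point\<close> from \<open>V\<close> onto the current algebra, and later \<open>el\<close> from pairs onto the central
  extension, turn all operations into operations on coordinates.\<close>

definition point :: "('g \<Rightarrow> 's) \<Rightarrow> ('g \<times> 's \<Rightarrow>\<^sub>0 'k) set" where
  "point v = coset N (unvec v)"

definition coords :: "('g \<times> 's \<Rightarrow>\<^sub>0 'k) set \<Rightarrow> 'g \<Rightarrow> 's" where
  "coords = value_on vec"

lemma coset_N: "coset N p = point (vec p)"
  unfolding point_def by (simp add: coset_eq_iff[OF presents_vec] vec_unvec)

lemma coords_point [simp]: "v \<in> V \<Longrightarrow> coords (point v) = v"
  unfolding point_def coords_def by (simp add: value_on_coset[OF presents_vec] vec_unvec)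

lemma carrier_gS: "carrier gS = point ` V"
proof -
  have "carrier gS = range (coset N)" by (simp add: current_algebra_def quot_eq)
  also have "\<dots> = point ` V"
    by (auto simp: coset_N) (metis coset_N rangeI vec_unvec)
  finally show ?thesis .
qed

lemma point_in_carrier [simp]: "v \<in> V \<Longrightarrow> point v \<in> carrier gS"
  by (simp add: carrier_gS)

lemma coords_in_V [simp]: "X \<in> carrier gS \<Longrightarrow> coords X \<in> V"
  and point_coords [simp]: "X \<in> carrier gS \<Longrightarrow> point (coords X) = X"
  by (auto simp: carrier_gS)

lemma point_eq_iff [simp]: "v \<in> V \<Longrightarrow> w \<in> V \<Longrightarrow> point v = point w \<longleftrightarrow> v = w"
  by (metis coords_point)

lemma vec_map:
  assumes "\<And>a b. f (a + b) = f a + f b" "\<And>c a. f (\<kappa> c * a) = \<kappa> c * f a"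
  shows "vec (lin_ext fscale (\<lambda>(x, s). gen (x, f s)) p) = f \<circ> vec p"
proof (rule additive_eqI)
  fix a :: "'g \<times> 's" and c
  show "vec (lin_ext fscale (\<lambda>(x, s). gen (x, f s)) (single a c)) = f \<circ> vec (single a c)"
    by (cases a) (simp add: lin_ext_single vec_single vec_fscale, simp add: fun_simps ten_def assms(2))
qed (simp_all add: lin_ext_add fscale_add_left vec_add fun_simps assms(1))

lemma current_map_point:
  assumes "\<And>a b. f (a + b) = f a + f b" "\<And>c a. f (\<kappa> c * a) = \<kappa> c * f a" and "v \<in> V"
  shows "current_map sg \<kappa> f (point v) = point (f \<circ> v)"
proof -
  have "current_map sg \<kappa> f (coset N (unvec v)) = coset N (lin_ext fscale (\<lambda>(x, s). gen (x, f s)) (unvec v))"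
    unfolding current_map_def
    by (rule lift1_coset[OF presents_vec presents_vec]) (simp only: vec_map[of f, OF assms(1,2)])
  then show ?thesis by (simp add: coset_N vec_map[of f, OF assms(1,2)] vec_unvec[OF assms(3)])
qed

lemma lzero_gS: "lzero gS = point 0"
  by (simp add: current_algebra_def coset_N vec_zero)

lemma ladd_gS:
  assumes "v \<in> V" "w \<in> V"
  shows "ladd gS (point v) (point w) = point (v + w)"
proof -
  have "ladd gS (coset N (unvec v)) (coset N (unvec w)) = coset N (unvec v + unvec w)"
    unfolding current_algebra_def lie_alg.simps
    by (rule lift2_coset[OF presents_vec presents_vec]) (simp add: vec_add)
  then show ?thesis by (simp add: coset_N vec_add vec_unvec assms)
qed

lemma lscale_gS: "v \<in> V \<Longrightarrow> lscale gS a (point v) = point (smul a v)"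
proof -
  assume v: "v \<in> V"
  have "(*) a \<circ> v = smul a v" by (simp add: fun_simps)
  then show ?thesis
    using current_map_point[of "(*) a" v] v by (simp add: current_algebra_def distrib_left mult.left_commute)
qed

text \<open>Two nested linear extensions of a map on generators form a bilinear map, which is known from its values at pure tensors.\<close>

lemma lin_ext_bilinear:
  fixes sc :: "'k \<Rightarrow> 'm::ab_group_add \<Rightarrow> 'm" and h :: "'g \<Rightarrow> 's \<Rightarrow> 'g \<Rightarrow> 's \<Rightarrow> 'm"
    and \<pi> :: "'m \<Rightarrow> 'n::ab_group_add"
  assumes sc: "\<And>c d x. sc (c + d) x = sc c x + sc d x" "\<And>c x y. sc c (x + y) = sc c x + sc c y"
    and \<pi>: "\<And>x y. \<pi> (x + y) = \<pi> x + \<pi> y"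
    and B: "\<And>v v' w. B (v + v') w = B v w + B v' w" "\<And>v w w'. B v (w + w') = B v w + B v w'"
    and eq: "\<And>x a y b c d. \<pi> (sc c (sc d (h x a y b))) = B (smul (\<kappa> c) (ten x a)) (smul (\<kappa> d) (ten y b))"
  shows "\<pi> (lin_ext sc (\<lambda>(x, a). lin_ext sc (\<lambda>(y, b). h x a y b) q) p) = B (vec p) (vec q)"
proof (rule additive_eqI[where p = p])
  fix r :: "'g \<times> 's" and c
  have sc0: "sc 0 x = 0" "sc e 0 = 0" for x e
    using additive_zero[of "\<lambda>c. sc c x"] additive_zero[of "sc e"] sc by blast+
  obtain x a where r: "r = (x, a)" by (cases r)
  have "\<pi> (sc c (lin_ext sc (\<lambda>(y, b). h x a y b) q)) = B (smul (\<kappa> c) (ten x a)) (vec q)"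
  proof (rule additive_eqI[where p = q])
    fix t :: "'g \<times> 's" and d
    show "\<pi> (sc c (lin_ext sc (\<lambda>(y, b). h x a y b) (single t d))) =
        B (smul (\<kappa> c) (ten x a)) (vec (single t d))"
      by (cases t) (simp only: lin_ext_single[of sc, OF sc0(1)] prod.case vec_single eq)
  qed (simp_all add: lin_ext_add sc \<pi> B vec_add)
  then show "\<pi> (lin_ext sc (\<lambda>(x, a). lin_ext sc (\<lambda>(y, b). h x a y b) q) (single r c)) =
      B (vec (single r c)) (vec q)"
    by (simp add: r lin_ext_single[of sc, OF sc0(1)] vec_single)
qed (simp_all add: lin_ext_add sc \<pi> B vec_add)

lemma lbr_gS:
  assumes "v \<in> V" "w \<in> V"
  shows "lbr gS (point v) (point w) = point (brV v w)"
proof -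
  let ?f = "\<lambda>p q. lin_ext fscale (\<lambda>(x, a). lin_ext fscale (\<lambda>(y, b). gen (br x y, a * b)) q) p"
  have f: "vec (?f p q) = brV (vec p) (vec q)" for p q
    by (rule lin_ext_bilinear)
      (simp_all add: fscale_add_left vec_add brV_add vec_fscale vec_single brV_smul brV_ten \<kappa> mult.commute)
  have "lbr gS (coset N (unvec v)) (coset N (unvec w)) = coset N (?f (unvec v) (unvec w))"
    unfolding current_algebra_def lie_alg.simps
    by (rule lift2_coset[OF presents_vec presents_vec]) (simp only: f)
  then show ?thesis by (simp add: coset_N f vec_unvec assms)
qed

lemma uce_cocycle_point:
  assumes "v \<in> V" "w \<in> V"
  shows "uce_cocycle sg br \<kappa> (point v) (point w) = coset E (tau v w)"
proof -
  let ?f = "\<lambda>p q. lin_ext (\<lambda>c. fscale (\<kappa> c)) (\<lambda>(x, a). lin_ext (\<lambda>c. fscale (\<kappa> c))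
      (\<lambda>(y, b). fscale (\<kappa> (killing x y)) (single b a)) q) p"
  have f: "proj (?f p q) = tau (vec p) (vec q)" for p q
  proof (rule lin_ext_bilinear)
    fix x a y b c d
    show "proj (fscale (\<kappa> c) (fscale (\<kappa> d) (fscale (\<kappa> (killing x y)) (single b a)))) =
        tau (smul (\<kappa> c) (ten x a)) (smul (\<kappa> d) (ten y b))"
      by (simp only: proj_scale tau_scale tau_ten dform_def[symmetric] dform_scale_left)
        (simp add: mult.left_commute)
  qed (simp_all add: fscale_add_left proj_add tau_add \<kappa>)
  have "uce_cocycle sg br \<kappa> (coset N (unvec v)) (coset N (unvec w)) = coset E (?f (unvec v) (unvec w))"
    unfolding uce_cocycle_def
    by (rule lift2_coset[OF presents_vec presents_proj]) (simp only: f)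
  also have "\<dots> = coset E (tau v w)"
    by (simp only: coset_eq_iff[OF presents_proj] f vec_unvec assms proj_tau)
  finally show ?thesis unfolding point_def .
qed

text \<open>The second component may be any representative; \<open>el_eq_iff\<close> decides equality.\<close>

definition el :: "('g \<Rightarrow> 's) \<Rightarrow> ('s \<Rightarrow>\<^sub>0 's) \<Rightarrow> ('g \<times> 's \<Rightarrow>\<^sub>0 'k) set \<times> ('s \<Rightarrow>\<^sub>0 's) set" where
  "el v z = (point v, coset E z)"

lemma fst_el [simp]: "fst (el v z) = point v"
  by (simp add: el_def)

lemma el_eq_iff: "v \<in> V \<Longrightarrow> w \<in> V \<Longrightarrow> el v z = el w y \<longleftrightarrow> v = w \<and> proj z = proj y"
  by (simp add: el_def coset_eq_iff[OF presents_proj])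

lemma el_proj: "el v (proj z) = el v z"
  by (simp add: el_def coset_eq_iff[OF presents_proj] proj_proj)

lemma carrier_U: "carrier U = carrier gS \<times> range (coset E)"
  by (simp add: uce_def Let_def restrict_scalars_def kaehler_mod_exact_def quot_eq)

lemma carrier_U_el: "x \<in> carrier U \<longleftrightarrow> (\<exists>v\<in>V. \<exists>z. x = el v z)"
  by (auto simp: carrier_U carrier_gS el_def)

lemma carrier_U_cases:
  assumes "x \<in> carrier U"
  obtains v z where "x = el v z" "v \<in> V"
  using assms carrier_U_el by blast

lemma el_in_carrier [simp]: "v \<in> V \<Longrightarrow> el v z \<in> carrier U"
  by (auto simp: carrier_U_el)

lemma lift_E: "lift2 E (+) (coset E z) (coset E y) = coset E (z + y)"
    "lift1 E (fscale (\<kappa> c)) (coset E z) = coset E (fscale (\<kappa> c) z)"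
  by (rule lift2_coset[OF presents_proj presents_proj], simp add: proj_add)
    (rule lift1_coset[OF presents_proj presents_proj], simp add: proj_scale)

lemma U_el:
  assumes "v \<in> V" "w \<in> V"
  shows ladd_U: "ladd U (el v z) (el w y) = el (v + w) (z + y)"
    and lscale_U: "lscale U c (el v z) = el (smul (\<kappa> c) v) (fscale (\<kappa> c) z)"
    and lbr_U: "lbr U (el v z) (el w y) = el (brV v w) (tau v w)"
  using assms ladd_gS[of v w] lscale_gS[of v "\<kappa> c"] lbr_gS[of v w]
  by (simp_all add: uce_def Let_def restrict_scalars_def el_def lift_E uce_cocycle_point)

lemma lzero_U: "lzero U = el 0 0"
  using lzero_gS by (simp add: uce_def Let_def restrict_scalars_def el_def)

section \<open>Lifts of automorphisms\<close>

definition uce_hom where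
  "uce_hom H \<longleftrightarrow> (\<forall>x\<in>carrier U. H x \<in> carrier U) \<and>
     (\<forall>x\<in>carrier U. \<forall>y\<in>carrier U. H (ladd U x y) = ladd U (H x) (H y)) \<and>
     (\<forall>c. \<forall>x\<in>carrier U. H (lscale U c x) = lscale U c (H x)) \<and>
     (\<forall>x\<in>carrier U. \<forall>y\<in>carrier U. H (lbr U x y) = lbr U (H x) (H y))"

lemma Aut_uce_hom: "H \<in> Aut U \<Longrightarrow> uce_hom H"
  unfolding Aut_def uce_hom_def using Bij_imp_funcset by blast

lemma uce_hom_compose: "uce_hom H \<Longrightarrow> uce_hom K \<Longrightarrow> uce_hom (\<lambda>x. H (K x))"
  unfolding uce_hom_def by simp

lemma uce_homI:
  assumes "\<And>v z. v \<in> V \<Longrightarrow> H (el v z) \<in> carrier U"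
    and "\<And>v z w y. v \<in> V \<Longrightarrow> w \<in> V \<Longrightarrow> H (el (v + w) (z + y)) = ladd U (H (el v z)) (H (el w y))"
    and "\<And>c v z. v \<in> V \<Longrightarrow> H (el (smul (\<kappa> c) v) (fscale (\<kappa> c) z)) = lscale U c (H (el v z))"
    and "\<And>v z w y. v \<in> V \<Longrightarrow> w \<in> V \<Longrightarrow> H (el (brV v w) (tau v w)) = lbr U (H (el v z)) (H (el w y))"
  shows "uce_hom H"
  unfolding uce_hom_def using assms
  by (intro conjI ballI allI) (elim carrier_U_el[THEN iffD1, elim_format] bexE exE, simp add: U_el)+

text \<open>Brackets in a central extension only depend on the images under the projection, so \<open>H\<close> and \<open>K\<close> agree on
  all brackets. The brackets span: \<open>[x \<otimes> s, y \<otimes> 1] = [x, y] \<otimes> s\<close> exhausts \<open>g\<^sub>S\<close> because \<open>g\<close> is perfect, and the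
  \<open>\<Omega>/dS\<close>-component of \<open>[x \<otimes> a, y \<otimes> b]\<close> exhausts \<open>\<Omega>/dS\<close> as soon as \<open>(x|y) \<noteq> 0\<close>.\<close>

theorem uce_hom_unique:
  assumes H: "uce_hom H" and K: "uce_hom K" and eq: "\<And>x. x \<in> carrier U \<Longrightarrow> fst (H x) = fst (K x)"
    and x: "x \<in> carrier U"
  shows "H x = K x"
proof -
  define Q where "Q v z \<longleftrightarrow> H (el v z) = K (el v z)" for v z
  have Q_add: "Q (v + w) (z + y)" if "Q v z" "Q w y" "v \<in> V" "w \<in> V" for v w z y
    using that H K unfolding Q_def uce_hom_def ladd_U[OF that(3,4), symmetric] by simp
  have Q_scale: "Q (smul (\<kappa> c) v) (fscale (\<kappa> c) z)" if "Q v z" "v \<in> V" for v z c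
    using that H K unfolding Q_def uce_hom_def lscale_U[OF that(2,2), symmetric] by simp
  have Q_br: "Q (brV v w) (tau v w)" if "v \<in> V" "w \<in> V" for v w
  proof -
    have fst_dep: "lbr U x y = lbr U x' y'" if "fst x = fst x'" "fst y = fst y'" for x y x' y'
      using that by (cases x; cases y; cases x'; cases y') (simp add: uce_def Let_def)
    have "H (lbr U (el v 0) (el w 0)) = K (lbr U (el v 0) (el w 0))"
      using H K that fst_dep[OF eq eq, of "el v 0" "el w 0"] unfolding uce_hom_def by simp
    then show ?thesis using that by (simp add: Q_def lbr_U)
  qed
  have Q_V: "Q v 0" if "v \<in> V" for v
    using that
  proof (induction rule: V_induct)
    have 0: "Q 0 0" using Q_br[of 0 0] by simp
    show "Q 0 0" by (rule 0)
    show "Q (v + w) 0" if "v \<in> V" "w \<in> V" "Q v 0" "Q w 0" for v w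
      using Q_add[OF that(3,4,1,2)] by simp
    fix x s
    have "x \<in> span {br x y |x y. True}" using perfect by simp
    then show "Q (ten x s) 0"
    proof (induction rule: span_induct_alt)
      case base
      have "ten 0 s = 0" using ten_scale[of 0 0 s] by (simp add: \<kappa>)
      then show ?case using 0 by simp
    next
      case (step c z y)
      then obtain x1 x2 where z: "z = br x1 x2" by auto
      have "Q (ten z s) 0"
        using Q_br[of "ten x1 s" "ten x2 1"] dform_constant[of _ 1]
        by (simp add: z brV_ten tau_ten \<kappa>(3))
      then show ?case
        using Q_add[OF Q_scale[of "ten z s" 0 c] step.IH] by (simp add: ten_add_left ten_scale)
    qed
  qed
  have Q_tau: "Q 0 (tau v w)" if "v \<in> V" "w \<in> V" for v w
  proof -
    have "Q (smul (\<kappa> (-1)) (brV v w)) 0" using Q_scale[OF Q_V, of "brV v w" "-1"] by simp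
    from Q_add[OF Q_br[OF that] this] show ?thesis
      using smul_add_left[of 1 "- 1" "brV v w"] by (simp add: \<kappa>(3,5))
  qed
  obtain x1 x2 where k: "killing x1 x2 \<noteq> 0" using killing_nonzero by blast
  have Q_dform: "Q 0 (dform a b)" for a b
  proof -
    have "\<kappa> (killing x1 x2) * (\<kappa> (inverse (killing x1 x2)) * a) = a"
      using k by (simp add: mult.assoc[symmetric] \<kappa>(2)[symmetric] \<kappa>(3))
    then show ?thesis
      using Q_tau[of "ten x1 (\<kappa> (inverse (killing x1 x2)) * a)" "ten x2 b"] by (simp add: tau_ten)
  qed
  have "Q 0 (proj z)" for z
  proof (induction z rule: poly_mapping_single_induct)
    case (add b a p)
    then show ?case using Q_add[OF Q_dform add] by (simp add: proj_add dform_def)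
  qed (simp add: proj_zero Q_V)
  then have "Q v z" if "v \<in> V" for v z
    using Q_add[OF Q_V[OF that], of 0 "proj z"] that by (simp add: Q_def el_proj)
  then show ?thesis using x by (auto simp: carrier_U_el Q_def)
qed

definition in_coords :: "(('g \<times> 's \<Rightarrow>\<^sub>0 'k) set \<Rightarrow> ('g \<times> 's \<Rightarrow>\<^sub>0 'k) set) \<Rightarrow> ('g \<Rightarrow> 's) \<Rightarrow> 'g \<Rightarrow> 's" where
  "in_coords \<theta> v = coords (\<theta> (point v))"

lemma in_coords:
  assumes "\<theta> \<in> carrier gS \<rightarrow> carrier gS" "v \<in> V"
  shows "in_coords \<theta> v \<in> V" "\<theta> (point v) = point (in_coords \<theta> v)"
proof -
  have "\<theta> (point v) \<in> carrier gS" using assms by auto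
  then show "in_coords \<theta> v \<in> V" "\<theta> (point v) = point (in_coords \<theta> v)"
    by (simp_all add: in_coords_def)
qed

lemma bij_in_coords:
  assumes A: "A \<subseteq> V" and bij: "bij_betw \<theta> (point ` A) (point ` A)"
  shows "bij_betw (in_coords \<theta>) A A" "v \<in> A \<Longrightarrow> in_coords \<theta> v \<in> A"
    "v \<in> A \<Longrightarrow> \<theta> (point v) = point (in_coords \<theta> v)"
proof -
  have "bij_betw point A (point ` A)"
    using A by (intro inj_on_imp_bij_betw inj_onI) (meson point_eq_iff subsetD)
  moreover have "bij_betw coords (point ` A) A"
    using A by (intro bij_betw_byWitness[of _ point]) (auto dest: subsetD)
  moreover have "in_coords \<theta> = coords \<circ> (\<theta> \<circ> point)" by (simp add: in_coords_def fun_eq_iff)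
  ultimately show *: "bij_betw (in_coords \<theta>) A A" using bij by (metis bij_betw_trans)
  assume v: "v \<in> A"
  then show "in_coords \<theta> v \<in> A" using * by (auto simp: bij_betw_def)
  have "\<theta> (point v) \<in> point ` A" using v bij by (auto simp: bij_betw_def)
  then show "\<theta> (point v) = point (in_coords \<theta> v)" using A by (auto simp: in_coords_def dest: subsetD)
qed

lemma S_aut_in_coords:
  assumes \<theta>: "\<theta> \<in> Aut gS"
  shows "S_aut (in_coords \<theta>)"
proof -
  have maps: "\<theta> \<in> carrier gS \<rightarrow> carrier gS" and bij: "bij_betw \<theta> (carrier gS) (carrier gS)"
    using \<theta> Bij_imp_funcset unfolding Aut_def Bij_def by auto
  note ic = in_coords[OF maps]
  have "in_coords \<theta> (v + w) = in_coords \<theta> v + in_coords \<theta> w" if "v \<in> V" "w \<in> V" for v w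
  proof -
    have "\<theta> (ladd gS (point v) (point w)) = ladd gS (\<theta> (point v)) (\<theta> (point w))"
      using \<theta> that unfolding Aut_def by simp
    then show ?thesis using that ic by (simp add: ladd_gS)
  qed
  moreover have "in_coords \<theta> (smul a v) = smul a (in_coords \<theta> v)" if "v \<in> V" for v a
  proof -
    have "\<theta> (lscale gS a (point v)) = lscale gS a (\<theta> (point v))"
      using \<theta> that unfolding Aut_def by simp
    then show ?thesis using that ic by (simp add: lscale_gS)
  qed
  moreover have "in_coords \<theta> (brV v w) = brV (in_coords \<theta> v) (in_coords \<theta> w)" if "v \<in> V" "w \<in> V" for v w
  proof -
    have "\<theta> (lbr gS (point v) (point w)) = lbr gS (\<theta> (point v)) (\<theta> (point w))"
      using \<theta> that unfolding Aut_def by simp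
    then show ?thesis using that ic by (simp add: lbr_gS)
  qed
  moreover have "bij_betw (in_coords \<theta>) V V"
    using bij by (intro bij_in_coords) (simp_all add: carrier_gS)
  ultimately show ?thesis unfolding S_aut_def S_linear_def using ic by blast
qed

definition lift :: "(('g \<Rightarrow> 's) \<Rightarrow> 'g \<Rightarrow> 's) \<Rightarrow>
    ('g \<times> 's \<Rightarrow>\<^sub>0 'k) set \<times> ('s \<Rightarrow>\<^sub>0 's) set \<Rightarrow> ('g \<times> 's \<Rightarrow>\<^sub>0 'k) set \<times> ('s \<Rightarrow>\<^sub>0 's) set" where
  "lift \<eta> = (\<lambda>x\<in>carrier U. el (\<eta> (coords (fst x))) (shift \<eta> (coords (fst x)) + value_on proj (snd x)))"

lemma lift_el: "v \<in> V \<Longrightarrow> \<eta> v \<in> V \<Longrightarrow> lift \<eta> (el v z) = el (\<eta> v) (shift \<eta> v + z)"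
  by (simp add: lift_def) (simp add: el_eq_iff, simp add: el_def value_on_coset[OF presents_proj] proj_add proj_proj)

lemma lift_Aut:
  assumes \<eta>: "S_aut \<eta>"
  shows "lift \<eta> \<in> Aut U"
proof -
  have S_linear: "S_linear \<eta>" and bij: "bij_betw \<eta> V V" and br: "\<And>v w. v \<in> V \<Longrightarrow> w \<in> V \<Longrightarrow> \<eta> (brV v w) = brV (\<eta> v) (\<eta> w)"
    using \<eta> unfolding S_aut_def by auto
  have \<eta>V [simp]: "\<eta> v \<in> V" if "v \<in> V" for v using S_linearD(1)[OF S_linear that] .
  have "inj_on (lift \<eta>) (carrier U)"
  proof (rule inj_onI)
    fix x y assume "x \<in> carrier U" "y \<in> carrier U" and eq: "lift \<eta> x = lift \<eta> y"
    then obtain v z w t where x: "x = el v z" "v \<in> V" and y: "y = el w t" "w \<in> V"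
      unfolding carrier_U_el by blast
    have "\<eta> v = \<eta> w" "proj (shift \<eta> v + z) = proj (shift \<eta> w + t)"
      using eq x y by (simp_all add: lift_el el_eq_iff)
    moreover have "v = w" using calculation(1) bij x y by (auto simp: bij_betw_def dest: inj_onD)
    ultimately show "x = y" by (simp add: x y el_eq_iff proj_add)
  qed
  moreover have "lift \<eta> ` carrier U = carrier U"
  proof
    show "lift \<eta> ` carrier U \<subseteq> carrier U"
    proof
      fix y assume "y \<in> lift \<eta> ` carrier U"
      then obtain x where x: "x \<in> carrier U" "y = lift \<eta> x" by blast
      then obtain v z where "v \<in> V" "y = lift \<eta> (el v z)" by (metis carrier_U_el)
      then show "y \<in> carrier U" by (simp add: lift_el)
    qed
    show "carrier U \<subseteq> lift \<eta> ` carrier U"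
    proof
      fix y assume "y \<in> carrier U"
      then obtain w t where y: "y = el w t" "w \<in> V" unfolding carrier_U_el by blast
      then have "w \<in> \<eta> ` V" using bij by (simp add: bij_betw_def)
      then obtain v where v: "v \<in> V" "\<eta> v = w" by auto
      then have "y = lift \<eta> (el v (t - shift \<eta> v))" by (simp add: y lift_el)
      then show "y \<in> lift \<eta> ` carrier U" using v by simp
    qed
  qed
  ultimately have "lift \<eta> \<in> Bij (carrier U)"
    unfolding Bij_def bij_betw_def lift_def by simp
  moreover have "uce_hom (lift \<eta>)"
    by (rule uce_homI)
      (simp_all add: lift_el U_el S_linearD[OF S_linear] br shift_add shift_scale shift_brV[OF \<eta>] algebra_simps)
  ultimately show ?thesis unfolding Aut_def uce_hom_def by simp
qed

lemma uce_lift_eq: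
  assumes \<theta>: "\<theta> \<in> Aut gS"
  shows "uce_lift sg br \<kappa> \<theta> = lift (in_coords \<theta>)"
  unfolding uce_lift_def
proof (rule the_equality)
  let ?l = "lift (in_coords \<theta>)"
  have maps: "\<theta> \<in> carrier gS \<rightarrow> carrier gS"
    using \<theta> Bij_imp_funcset unfolding Aut_def by auto
  have aut: "?l \<in> Aut U" using lift_Aut[OF S_aut_in_coords[OF \<theta>]] .
  have fst: "fst (?l x) = \<theta> (fst x)" if "x \<in> carrier U" for x
    using that by (auto simp: carrier_U_el lift_el in_coords[OF maps])
  show "?l \<in> Aut U \<and> (\<forall>x\<in>carrier U. fst (?l x) = \<theta> (fst x))" using aut fst by blast
  fix f assume f: "f \<in> Aut U \<and> (\<forall>x\<in>carrier U. fst (f x) = \<theta> (fst x))"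
  have "f \<in> extensional (carrier U)" "?l \<in> extensional (carrier U)"
    using f aut unfolding Aut_def by (auto dest: Bij_imp_extensional)
  moreover have "f x = ?l x" if "x \<in> carrier U" for x
    using uce_hom_unique[OF Aut_uce_hom Aut_uce_hom, of f ?l x] f aut fst that by simp
  ultimately show "f = ?l" by (rule extensionalityI)
qed

lemma uce_map_el:
  assumes f: "unital_ring_hom f" "f \<circ> \<kappa> = \<kappa>" and "v \<in> V"
  shows "uce_map sg \<kappa> f (el v z) = el (f \<circ> v) (push_form f z)"
proof -
  have "f (\<kappa> c) = \<kappa> c" for c using f(2) by (metis comp_apply)
  then show ?thesis
    using assms by (simp add: uce_map_def el_def kaehler_map_coset[OF hom f] current_map_point unital_ring_homD)
qed

lemma uce_hom_uce_map:
  assumes f: "unital_ring_hom f" "f \<circ> \<kappa> = \<kappa>"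
  shows "uce_hom (uce_map sg \<kappa> f)"
proof -
  have f\<kappa>: "f (\<kappa> c) = \<kappa> c" for c using f(2) by (metis comp_apply)
  note hf = unital_ring_homD[OF f(1)]
  have fV [simp]: "f \<circ> v \<in> V" if "v \<in> V" for v using that by (simp add: V_def hf)
  have br: "f \<circ> brV v w = brV (f \<circ> v) (f \<circ> w)" for v w
    by (simp add: brV_def fun_eq_iff hf f\<kappa>)
  have tau: "el v (push_form f (tau x y)) = el v (tau (f \<circ> x) (f \<circ> y))" for v x y
  proof -
    have "tau_form (f \<circ> x) (f \<circ> y) = push_form f (tau_form x y)"
      by (simp add: tau_form_def additive_sum[of "push_form f", OF push_form_add[OF f(1)]]
        push_form_single[OF f(1)] hf f\<kappa>)
    moreover have "tau_form x y - tau x y \<in> E"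
      by (simp add: proj_eq_0[symmetric] proj_diff) (simp add: tau_def)
    then have "push_form f (tau_form x y - tau x y) \<in> E"
      by (rule push_form_exact_null[OF f])
    then have "proj (push_form f (tau_form x y)) = proj (push_form f (tau x y))"
      using push_form_diff[OF f(1)]
      by (simp add: proj_eq_0[symmetric] proj_diff)
    ultimately show ?thesis by (metis el_proj proj_tau tau_def)
  qed
  have add: "f \<circ> (v + w) = (f \<circ> v) + (f \<circ> w)" "f \<circ> smul (\<kappa> c) v = smul (\<kappa> c) (f \<circ> v)" for v w c
    by (simp_all add: fun_simps hf f\<kappa>)
  show ?thesis
    by (rule uce_homI)
      (simp_all add: uce_map_el[OF f] U_el br tau add push_form_add[OF f(1)] push_form_fscale[OF f(1)] f\<kappa>)
qed

end

section \<open>Galois extensions\<close>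

locale galois =
  fixes \<iota> :: "'r::{comm_ring,comm_monoid_mult} \<Rightarrow> 's::{comm_ring,comm_monoid_mult}"
    and G :: "('c, 'm) monoid_scheme" (structure) and act :: "'c \<Rightarrow> 's \<Rightarrow> 's"
  assumes galois: "galois_extension \<iota> G act"
begin

lemma hom_\<iota>: "unital_ring_hom \<iota>"
  and finite_G [simp]: "finite (carrier G)"
  and hom_act: "g \<in> carrier G \<Longrightarrow> unital_ring_hom (act g)"
  and act_\<iota>: "g \<in> carrier G \<Longrightarrow> act g (\<iota> r) = \<iota> r"
  and invariant_in_range: "(\<And>g. g \<in> carrier G \<Longrightarrow> act g s = s) \<Longrightarrow> s \<in> range \<iota>"
  and action: "group_action G UNIV act"
  using galois unfolding galois_extension_def by auto

lemmas act_simps = unital_ring_homD[OF hom_act]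

sublocale group G
  using action unfolding group_action_def group_hom_def by simp

lemma act_mult: "g \<in> carrier G \<Longrightarrow> h \<in> carrier G \<Longrightarrow> act (g \<otimes> h) s = act g (act h s)"
  using group_action.composition_rule[OF action] by simp

lemma act_one: "act \<one> s = s"
  using group_action.id_eq_one[OF action] by (metis UNIV_I restrict_apply')

lemma act_inv: "g \<in> carrier G \<Longrightarrow> act g (act (inv g) s) = s"
  by (simp add: act_mult[symmetric] act_one)

definition tr :: "'s \<Rightarrow> 's" where
  "tr s = (\<Sum>g\<in>carrier G. act g s)"

lemma sum_translate:
  assumes "h \<in> carrier G"
  shows "(\<Sum>g\<in>carrier G. f (h \<otimes> g)) = (\<Sum>g\<in>carrier G. f g)"
proof (rule sum.reindex_bij_betw)
  show "bij_betw (\<lambda>g. h \<otimes> g) (carrier G) (carrier G)"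
    by (rule bij_betw_byWitness[of _ "\<lambda>g. inv h \<otimes> g"])
      (use assms in \<open>auto simp: m_assoc[symmetric]\<close>)
qed

lemma tr_in_range: "tr s \<in> range \<iota>"
proof (rule invariant_in_range)
  fix h assume h: "h \<in> carrier G"
  have "act h (tr s) = (\<Sum>g\<in>carrier G. act (h \<otimes> g) s)"
    unfolding tr_def using h by (simp add: unital_ring_homD(7)[OF hom_act] act_mult)
  then show "act h (tr s) = tr s" unfolding tr_def by (simp add: sum_translate[OF h, of "\<lambda>g. act g s"])
qed

text \<open>Such a system is a preimage of the idempotent \<open>(\<delta>\<^sub>g\<^sub>1)\<^sub>g\<close> under \<open>S \<otimes>\<^sub>R S \<rightarrow> \<Prod>\<^sub>g S\<close>.\<close>

lemma dual_system:
  obtains I :: "('s \<times> 's) set" and a b where "finite I"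
    "\<And>g. g \<in> carrier G \<Longrightarrow> (\<Sum>i\<in>I. a i * act g (b i)) = (if g = \<one> then 1 else 0)"
proof -
  let ?T = "tensor_null (alg_scale \<iota>) (alg_scale \<iota>)"
  let ?L = "\<lambda>g. lin_ext (alg_scale \<iota>) (\<lambda>(a, b). a * act g b)"
  let ?f = "\<lambda>g\<in>carrier G. if g = \<one> then 1 else (0::'s)"
  note \<iota> = unital_ring_homD[OF hom_\<iota>]
  have "?f \<in> galois_map \<iota> G act ` quot ?T"
    using galois unfolding galois_extension_def bij_betw_def by auto
  then obtain p where p: "galois_map \<iota> G act (coset ?T p) = ?f"
    by (auto simp: quot_eq)
  have val: "the_elem (?L g ` coset ?T p) = ?L g p" if g: "g \<in> carrier G" for g
  proof -
    note hg = unital_ring_homD[OF hom_act[OF g]]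
    have add: "?L g (q + r) = ?L g q + ?L g r" for q r
      by (rule lin_ext_add) (simp add: alg_scale_def \<iota> algebra_simps)
    have single: "?L g (single (x, y) c) = \<iota> c * (x * act g y)" for x y c
      by (subst lin_ext_single) (simp_all add: alg_scale_def \<iota>)
    have scale: "?L g (fscale c q) = \<iota> c * ?L g q" for c q
    proof (rule additive_eqI)
      fix d and e :: "'s \<times> 's"
      show "?L g (fscale c (single e d)) = \<iota> c * ?L g (single e d)"
        by (cases e) (simp add: single \<iota> mult.assoc)
    qed (simp_all add: add distrib_left)
    have null: "?L g q = 0" if q: "q \<in> ?T" for q
    proof -
      have "q \<in> {q. ?L g q = 0}"
        by (rule fspan_least[OF q[unfolded tensor_null_def]])
          (auto simp: additive_diff[of "?L g", OF add] additive_zero[of "?L g", OF add]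
            add single scale gen_def \<iota> hg alg_scale_def act_\<iota>[OF g] distrib_left distrib_right
            mult.assoc mult.left_commute)
      then show ?thesis by simp
    qed
    have const: "?L g q = ?L g p" if "q \<in> coset ?T p" for q
      using null[of "p - q"] that by (simp add: mem_coset_iff additive_diff[of "?L g", OF add])
    have "p \<in> coset ?T p" by (simp add: mem_coset_iff tensor_null_def fspan_zero)
    then have "coset ?T p \<noteq> {}" by blast
    then show ?thesis by (rule the_elem_image_unique) (rule const)
  qed
  show thesis
  proof (rule that)
    fix g assume g: "g \<in> carrier G"
    have "?L g p = (if g = \<one> then 1 else 0)"
      using fun_cong[OF p, of g] g by (simp add: galois_map_def val)
    then show "(\<Sum>i\<in>keys p. (\<iota> (lookup p i) * fst i) * act g (snd i)) =
        (if g = \<one> then 1 else 0)"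
      by (simp add: lin_ext_def alg_scale_def case_prod_unfold mult.assoc)
  qed simp
qed

lemma dual_system_expand:
  fixes a b :: "'i \<Rightarrow> 's"
  assumes ab: "\<And>g. g \<in> carrier G \<Longrightarrow> (\<Sum>i\<in>I. a i * act g (b i)) = (if g = \<one> then 1 else 0)"
  shows "(\<Sum>i\<in>I. a i * tr (b i * x)) = x"
proof -
  have "(\<Sum>i\<in>I. a i * tr (b i * x)) = (\<Sum>g\<in>carrier G. (\<Sum>i\<in>I. a i * act g (b i)) * act g x)"
    unfolding tr_def sum_distrib_left sum_distrib_right
    by (subst sum.swap) (simp add: act_simps mult.assoc)
  also have "\<dots> = (\<Sum>g\<in>carrier G. if g = \<one> then x else 0)"
    by (intro sum.cong refl) (auto simp: ab act_one)
  finally show ?thesis by simp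
qed

end

section \<open>Invariant differentials\<close>

locale galois_differentials = differentials \<kappa> + galois \<iota> G act
  for \<kappa> :: "'k::field_char_0 \<Rightarrow> 's::{comm_ring,comm_monoid_mult}"
    and \<iota> :: "'r::{comm_ring,comm_monoid_mult} \<Rightarrow> 's"
    and G :: "('c, 'm) monoid_scheme" (structure) and act +
  fixes \<iota>R :: "'k \<Rightarrow> 'r"
  assumes hom_\<iota>R: "unital_ring_hom \<iota>R" and \<kappa>_eq: "\<kappa> = \<iota> \<circ> \<iota>R"
begin

lemma act_\<kappa>: "g \<in> carrier G \<Longrightarrow> act g \<circ> \<kappa> = \<kappa>"
  by (simp add: \<kappa>_eq fun_eq_iff act_\<iota>)

text \<open>Unramifiedness: every derivation \<open>D\<close> of \<open>S\<close> that kills \<open>R\<close> is 0, here for \<open>D\<close> the universal derivation modulo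
  \<open>S dR\<close> and \<open>\<delta> a b = a D b\<close>. Expanding \<open>b\<^sub>i y\<close> by \<open>dual_system_expand\<close> and moving the traces,
  which lie in \<open>R\<close>, to the other side shows that \<open>\<Sum> x a\<^sub>i D (b\<^sub>i y)\<close> only depends on \<open>x y\<close>. Comparing
  \<open>(1, s)\<close> with \<open>(s, 1)\<close> gives \<open>\<Sum> a\<^sub>i b\<^sub>i D s = 0\<close>, and \<open>\<Sum> a\<^sub>i b\<^sub>i = 1\<close>.\<close>

lemma differentials_generated_by_base:
  fixes s :: 's
  defines "M \<equiv> fspan (Knull \<union> range (\<lambda>r. gen (\<iota> r)))"
  shows "gen s \<in> M"
proof -
  have K: "p \<in> M" if "p \<in> Knull" for p
    unfolding M_def using that by (intro fspan_base) simp
  have R: "single (\<iota> r) a \<in> M" for r a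
    using fspan_scale[OF fspan_base, of "gen (\<iota> r)" _ a] unfolding M_def by simp
  have sub: "F.subspace M"
    unfolding M_def by (rule F.subspaceI) (simp_all add: fspan_zero fspan_add fspan_scale)
  obtain P :: "('s \<Rightarrow>\<^sub>0 's) \<Rightarrow> ('s \<Rightarrow>\<^sub>0 's)" where
    lin: "Vector_Spaces.linear (\<lambda>c. fscale (\<kappa> c)) (\<lambda>c. fscale (\<kappa> c)) P" and ker: "\<And>p. P p = 0 \<longleftrightarrow> p \<in> M"
    by (rule subspace_projection[OF F.vector_space_axioms sub]) blast
  have P_add: "P (p + q) = P p + P q" for p q using lin by (simp add: Vector_Spaces.linear_iff)
  note P_diff = additive_diff[of P, OF P_add]
  define \<delta> where "\<delta> a b = P (single b a)" for a b
  have PK: "P p = 0" if "p \<in> Knull" for p using K[OF that] ker by blast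
  have add_left: "\<delta> (a + a') b = \<delta> a b + \<delta> a' b" for a a' b
    by (simp add: \<delta>_def single_add P_add)
  have add_right: "\<delta> a (b + b') = \<delta> a b + \<delta> a b'" for a b b'
    using PK[OF kaehler_null_fscale[OF kaehler_null_add], of a b b']
    by (simp add: \<delta>_def P_diff) (simp add: diff_eq_eq ac_simps)
  have leibniz: "\<delta> a (b * c) = \<delta> (a * b) c + \<delta> (a * c) b" for a b c
    using PK[OF kaehler_null_fscale[OF kaehler_null_mult], of a b c]
    by (simp add: \<delta>_def P_diff) (simp add: diff_eq_eq ac_simps)
  have \<delta>_base: "\<delta> a (\<iota> r) = 0" for a r using R ker by (simp add: \<delta>_def)
  have base_linear: "\<delta> a (b * tr x) = \<delta> (a * tr x) b" for a b x
  proof -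
    obtain r where "tr x = \<iota> r" using tr_in_range by blast
    then show ?thesis by (simp add: leibniz \<delta>_base)
  qed
  have sum_left: "\<delta> (\<Sum>i\<in>I. h i) b = (\<Sum>i\<in>I. \<delta> (h i) b)" for h and I :: "('s \<times> 's) set" and b
    by (rule additive_sum[of "\<lambda>a. \<delta> a b"]) (rule add_left)
  have sum_right: "\<delta> b (\<Sum>i\<in>I. h i) = (\<Sum>i\<in>I. \<delta> b (h i))" for h and I :: "('s \<times> 's) set" and b
    by (rule additive_sum[of "\<delta> b"]) (rule add_right)
  obtain I :: "('s \<times> 's) set" and a b where
    ab: "\<And>g. g \<in> carrier G \<Longrightarrow> (\<Sum>i\<in>I. a i * act g (b i)) = (if g = \<one> then 1 else 0)"
    using dual_system by metis
  note expand = dual_system_expand[OF ab]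
  have *: "(\<Sum>i\<in>I. \<delta> (x * a i) (b i * y)) = (\<Sum>j\<in>I. \<delta> (x * y * b j) (a j))" for x y
  proof -
    have "(\<Sum>i\<in>I. \<delta> (x * a i) (b i * y)) = (\<Sum>i\<in>I. \<Sum>j\<in>I. \<delta> (x * a i * tr (b j * (b i * y))) (a j))"
    proof (rule sum.cong[OF refl])
      fix i
      have "\<delta> (x * a i) (b i * y) = \<delta> (x * a i) (\<Sum>j\<in>I. a j * tr (b j * (b i * y)))"
        by (simp only: expand)
      then show "\<delta> (x * a i) (b i * y) = (\<Sum>j\<in>I. \<delta> (x * a i * tr (b j * (b i * y))) (a j))"
        by (simp only: sum_right base_linear)
    qed
    also have "\<dots> = (\<Sum>j\<in>I. \<delta> (\<Sum>i\<in>I. x * a i * tr (b i * (b j * y))) (a j))"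
      by (subst sum.swap) (simp add: sum_left ac_simps)
    also have "\<dots> = (\<Sum>j\<in>I. \<delta> (x * (b j * y)) (a j))"
      by (simp add: mult.assoc sum_distrib_left[symmetric] expand)
    finally show ?thesis by (simp add: ac_simps)
  qed
  have "(\<Sum>i\<in>I. \<delta> (a i) (b i * s)) = \<delta> (\<Sum>i\<in>I. a i * b i) s + (\<Sum>i\<in>I. \<delta> (s * a i) (b i))"
    by (simp add: leibniz sum.distrib sum_left mult.commute)
  then have "\<delta> 1 s = 0"
    using *[of 1 s] *[of s 1] ab[of "\<one>"] by (simp add: act_one)
  then show ?thesis using ker by (simp add: \<delta>_def gen_def)
qed

text \<open>A form \<open>\<Sum> s\<^sub>i dr\<^sub>i\<close> with \<open>r\<^sub>i \<in> R\<close> has trace \<open>\<Sum> tr s\<^sub>i dr\<^sub>i\<close>, and all forms are of this kind.\<close>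

lemma trace_form_descends:
  "\<exists>q. (\<Sum>g\<in>carrier G. push_form (act g) p) - push_form \<iota> q \<in> Knull"
proof -
  define Tr where "Tr p = (\<Sum>g\<in>carrier G. push_form (act g) p)" for p :: "'s \<Rightarrow>\<^sub>0 's"
  define T where "T = {p. \<exists>q. p - push_form \<iota> q \<in> Knull}"
  note push_\<iota> = push_form_add[OF hom_\<iota>] push_form_zero[OF hom_\<iota>]
  have Tr_add: "Tr (p + q) = Tr p + Tr q" for p q
    unfolding Tr_def by (simp add: push_form_add[OF hom_act] sum.distrib)
  have T_add: "p + q \<in> T" if p: "p \<in> T" and q: "q \<in> T" for p q
  proof -
    obtain p' q' where "p - push_form \<iota> p' \<in> Knull" "q - push_form \<iota> q' \<in> Knull"
      using p q unfolding T_def by auto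
    then have "p - push_form \<iota> p' + (q - push_form \<iota> q') \<in> Knull" by (rule kaehler_null_plus)
    then have "p + q - push_form \<iota> (p' + q') \<in> Knull" by (simp add: push_\<iota> algebra_simps)
    then show ?thesis unfolding T_def by blast
  qed
  have T_null: "p \<in> T" if "p \<in> Knull" for p
    unfolding T_def using that by (intro CollectI exI[of _ 0]) (simp add: push_\<iota>)
  have Tr_null: "Tr p \<in> Knull" if "p \<in> Knull" for p
  proof -
    have "(\<Sum>g\<in>A. push_form (act g) p) \<in> Knull" if "A \<subseteq> carrier G" for A
      using finite_subset[OF that finite_G] that
      by (induction A) (simp_all add: kaehler_null_0 kaehler_null_plus
        push_form_kaehler_null[OF hom_act act_\<kappa> \<open>p \<in> Knull\<close>])
    then show ?thesis unfolding Tr_def by simp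
  qed
  have Tr_base: "Tr (single (\<iota> r) c) \<in> T" for r c
  proof -
    obtain r' where r': "tr c = \<iota> r'" using tr_in_range by blast
    have "Tr (single (\<iota> r) c) = (\<Sum>g\<in>carrier G. single (\<iota> r) (act g c))"
      unfolding Tr_def by (simp add: push_form_single[OF hom_act] act_\<iota>)
    also have "\<dots> = single (\<iota> r) (tr c)"
      unfolding tr_def by (rule additive_sum[symmetric]) (rule single_add)
    also have "\<dots> = push_form \<iota> (single r r')"
      by (simp add: push_form_single[OF hom_\<iota>] r')
    finally show ?thesis unfolding T_def by (auto intro!: exI[of _ "single r r'"] kaehler_null_0)
  qed
  have "p \<in> {p. \<forall>c. Tr (fscale c p) \<in> T}" if p: "p \<in> fspan (Knull \<union> range (\<lambda>r. gen (\<iota> r)))" for p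
  proof (rule fspan_least[OF p])
    have "Tr 0 \<in> T" using T_null[OF Tr_null[OF kaehler_null_0]] .
    then show "0 \<in> {p. \<forall>c. Tr (fscale c p) \<in> T}" by simp
    show "Knull \<union> range (\<lambda>r. gen (\<iota> r)) \<subseteq> {p. \<forall>c. Tr (fscale c p) \<in> T}"
      using T_null[OF Tr_null[OF kaehler_null_fscale]] Tr_base by auto
  qed (simp_all add: Tr_add T_add)
  from this[OF fspan_scale[OF differentials_generated_by_base]]
  have gens: "Tr (single s c) \<in> T" for s c
    by (metis (no_types, lifting) fscale_simps(5) fscale_simps(9) mem_Collect_eq mult.left_neutral)
  have "Tr p \<in> T"
  proof (induction p rule: poly_mapping_single_induct)
    case zero
    show ?case using T_null[OF Tr_null[OF kaehler_null_0]] .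
  qed (simp add: Tr_add T_add gens)
  then show ?thesis unfolding T_def Tr_def by simp
qed

text \<open>An invariant class is the sum of its conjugates divided by the order of \<open>G\<close>, and this sum comes from \<open>R\<close>.\<close>

theorem invariant_forms:
  assumes Z: "Z \<in> kaehler_mod_exact \<kappa>"
  shows "(\<forall>g\<in>carrier G. kaehler_map \<kappa> (act g) Z = Z) \<longleftrightarrow> Z \<in> kaehler_map \<kappa> \<iota> ` kaehler_mod_exact \<iota>R"
proof -
  note km_act = kaehler_map_coset[OF hom hom_act act_\<kappa>]
  note km_\<iota> = kaehler_map_coset[OF hom_\<iota>R hom_\<iota> \<kappa>_eq[symmetric]]
  note coset_eq = coset_eq_iff[OF presents_proj]
  show ?thesis
  proof
    assume inv: "\<forall>g\<in>carrier G. kaehler_map \<kappa> (act g) Z = Z"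
    obtain p where p: "Z = coset E p" using Z by (auto simp: kaehler_mod_exact_def quot_eq)
    obtain q where q: "(\<Sum>g\<in>carrier G. push_form (act g) p) - push_form \<iota> q \<in> Knull"
      using trace_form_descends by blast
    define c :: 'k where "c = of_nat (card (carrier G))"
    have "c \<noteq> 0" using one_closed unfolding c_def by (auto simp: card_eq_0_iff)
    have "proj (push_form (act g) p) = proj p" if "g \<in> carrier G" for g
      using inv that unfolding p by (simp add: km_act coset_eq)
    then have "(\<Sum>g\<in>carrier G. proj p) = proj (\<Sum>g\<in>carrier G. push_form (act g) p)"
      by (simp add: proj_sum)
    also have "\<dots> = proj (push_form \<iota> q)"
      using proj_kaehler_null[OF q] by (simp add: proj_diff)
    finally have "fscale (\<kappa> c) (proj p) = proj (push_form \<iota> q)"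
      by (simp only: F.sum_constant_scale c_def)
    then have "fscale (\<kappa> (inverse c) * \<kappa> c) (proj p) = fscale (\<kappa> (inverse c)) (proj (push_form \<iota> q))"
      using fscale_simps(4) by metis
    moreover have "\<kappa> (inverse c) * \<kappa> c = 1"
      using \<open>c \<noteq> 0\<close> by (metis hom left_inverse unital_ring_homD(2,3))
    ultimately have "proj p = proj (fscale (\<kappa> (inverse c)) (push_form \<iota> q))" by (simp add: proj_scale)
    also have "\<dots> = proj (push_form \<iota> (fscale (\<iota>R (inverse c)) q))"
      by (simp add: push_form_fscale[OF hom_\<iota>] fun_cong[OF \<kappa>_eq])
    finally have "proj p = proj (push_form \<iota> (fscale (\<iota>R (inverse c)) q))" .
    then have "Z = kaehler_map \<kappa> \<iota> (coset (exact_null \<iota>R) (fscale (\<iota>R (inverse c)) q))"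
      by (simp add: p km_\<iota> coset_eq)
    then show "Z \<in> kaehler_map \<kappa> \<iota> ` kaehler_mod_exact \<iota>R"
      by (simp add: kaehler_mod_exact_def)
  next
    assume "Z \<in> kaehler_map \<kappa> \<iota> ` kaehler_mod_exact \<iota>R"
    then obtain q where q: "Z = coset E (push_form \<iota> q)"
      by (auto simp: kaehler_mod_exact_def quot_eq km_\<iota>)
    have "push_form (act g) (push_form \<iota> q) = push_form \<iota> q" if "g \<in> carrier G" for g
      by (rule additive_eqI[where p = q])
        (simp_all add: push_form_add[OF hom_act] push_form_add[OF hom_\<iota>] push_form_single[OF hom_act]
          push_form_single[OF hom_\<iota>] act_\<iota> that)
    then show "\<forall>g\<in>carrier G. kaehler_map \<kappa> (act g) Z = Z" by (simp add: q km_act)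
  qed
qed

end

section \<open>Twisted forms\<close>

locale galois_twist = current sg br \<kappa> + galois_differentials \<kappa> \<iota> G act \<iota>R
  for sg :: "'k::field_char_0 \<Rightarrow> 'g::ab_group_add \<Rightarrow> 'g" and br
    and \<kappa> :: "'k \<Rightarrow> 's::{comm_ring,comm_monoid_mult}"
    and \<iota> :: "'r::{comm_ring,comm_monoid_mult} \<Rightarrow> 's"
    and G :: "('c, 'm) monoid_scheme" (structure) and act \<iota>R +
  fixes u :: "'c \<Rightarrow> ('g \<times> 's \<Rightarrow>\<^sub>0 'k) set \<Rightarrow> ('g \<times> 's \<Rightarrow>\<^sub>0 'k) set"
  assumes cocycle: "cocycle sg br \<kappa> G act u"
begin

lemma u_Aut: "g \<in> carrier G \<Longrightarrow> u g \<in> Aut gS"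
  using cocycle unfolding cocycle_def by blast

lemma u_maps: "g \<in> carrier G \<Longrightarrow> u g \<in> carrier gS \<rightarrow> carrier gS"
  using u_Aut[of g] by (simp add: Aut_def Bij_imp_funcset)

definition uc :: "'c \<Rightarrow> ('g \<Rightarrow> 's) \<Rightarrow> 'g \<Rightarrow> 's" where
  "uc g = in_coords (u g)"

lemma S_aut_uc: "g \<in> carrier G \<Longrightarrow> S_aut (uc g)"
  unfolding uc_def by (rule S_aut_in_coords[OF u_Aut])

lemma S_linear_uc: "g \<in> carrier G \<Longrightarrow> S_linear (uc g)"
  using S_aut_uc unfolding S_aut_def by blast

lemma uc_V [simp]: "g \<in> carrier G \<Longrightarrow> v \<in> V \<Longrightarrow> uc g v \<in> V"
  by (rule S_linearD(1)[OF S_linear_uc])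

lemma u_point: "g \<in> carrier G \<Longrightarrow> v \<in> V \<Longrightarrow> u g (point v) = point (uc g v)"
  unfolding uc_def by (rule in_coords(2)[OF u_maps])

lemma act_V [simp]: "g \<in> carrier G \<Longrightarrow> v \<in> V \<Longrightarrow> act g \<circ> v \<in> V"
  by (simp add: V_def act_simps)

lemma act_\<kappa>_apply: "g \<in> carrier G \<Longrightarrow> act g (\<kappa> c) = \<kappa> c"
  by (simp add: \<kappa>_eq act_\<iota>)

lemma act_point: "g \<in> carrier G \<Longrightarrow> v \<in> V \<Longrightarrow> current_map sg \<kappa> (act g) (point v) = point (act g \<circ> v)"
  by (rule current_map_point) (simp_all add: act_simps act_\<kappa>_apply)

lemma act_comp:
  "g \<in> carrier G \<Longrightarrow> h \<in> carrier G \<Longrightarrow> act (g \<otimes> h) \<circ> v = act g \<circ> (act h \<circ> v)"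
  "act \<one> \<circ> v = v"
  "g \<in> carrier G \<Longrightarrow> act g \<circ> (act (inv g) \<circ> v) = v"
  by (simp_all add: fun_eq_iff act_mult act_one act_inv)

lemma uc_mult:
  assumes "g \<in> carrier G" "h \<in> carrier G" "v \<in> V"
  shows "uc (g \<otimes> h) v = uc g (act g \<circ> uc h (act (inv g) \<circ> v))"
proof -
  have "u (g \<otimes> h) (point v) =
      u g (current_map sg \<kappa> (act g) (u h (current_map sg \<kappa> (act (inv g)) (point v))))"
    using cocycle assms unfolding cocycle_def by simp
  then show ?thesis using assms by (simp add: u_point act_point)
qed

lemma uc_one: "v \<in> V \<Longrightarrow> uc \<one> v = v"
proof -
  assume v: "v \<in> V"
  have "uc \<one> v = uc \<one> (uc \<one> v)"
    using uc_mult[of "\<one>" "\<one>" v] v by (simp add: act_comp)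
  moreover have "inj_on (uc \<one>) V"
    using S_aut_uc[of "\<one>"] unfolding S_aut_def bij_betw_def by simp
  ultimately show ?thesis using v by (metis inj_onD one_closed uc_V)
qed

text \<open>The twisted action \<open>x \<mapsto> u\<^sub>g (\<^sup>gx)\<close> of \<open>G\<close>, whose invariants \<open>L\<close> are the coordinates of the twisted form. On the central
  extension the corresponding maps are called \<open>twist\<close> below.\<close>

definition star :: "'c \<Rightarrow> ('g \<Rightarrow> 's) \<Rightarrow> 'g \<Rightarrow> 's" where
  "star g v = uc g (act g \<circ> v)"

lemma star_V [simp]: "g \<in> carrier G \<Longrightarrow> v \<in> V \<Longrightarrow> star g v \<in> V"
  by (simp add: star_def)

lemma star_mult: "g \<in> carrier G \<Longrightarrow> h \<in> carrier G \<Longrightarrow> v \<in> V \<Longrightarrow> star (g \<otimes> h) v = star g (star h v)"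
proof -
  assume g: "g \<in> carrier G" and h: "h \<in> carrier G" and v: "v \<in> V"
  have "act (inv g) \<circ> (act (g \<otimes> h) \<circ> v) = act h \<circ> v"
    using g h by (simp add: act_comp(1)[symmetric] m_assoc[symmetric])
  then show ?thesis using g h v by (simp add: star_def uc_mult)
qed

lemma star_one: "v \<in> V \<Longrightarrow> star \<one> v = v"
  by (simp add: star_def act_comp uc_one)

lemma star_add: "g \<in> carrier G \<Longrightarrow> v \<in> V \<Longrightarrow> w \<in> V \<Longrightarrow> star g (v + w) = star g v + star g w"
proof -
  assume g: "g \<in> carrier G" and "v \<in> V" "w \<in> V"
  moreover have "act g \<circ> (v + w) = (act g \<circ> v) + (act g \<circ> w)"
    using g by (simp add: fun_simps act_simps)
  ultimately show ?thesis by (simp add: star_def S_linearD(2)[OF S_linear_uc])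
qed

lemma star_smul: "g \<in> carrier G \<Longrightarrow> v \<in> V \<Longrightarrow> star g (smul a v) = smul (act g a) (star g v)"
proof -
  assume g: "g \<in> carrier G" and "v \<in> V"
  moreover have "act g \<circ> smul a v = smul (act g a) (act g \<circ> v)"
    using g by (simp add: fun_simps act_simps)
  ultimately show ?thesis by (simp add: star_def S_linearD(3)[OF S_linear_uc])
qed

lemma star_brV: "g \<in> carrier G \<Longrightarrow> v \<in> V \<Longrightarrow> w \<in> V \<Longrightarrow> star g (brV v w) = brV (star g v) (star g w)"
proof -
  assume g: "g \<in> carrier G" and "v \<in> V" "w \<in> V"
  moreover have "act g \<circ> brV v w = brV (act g \<circ> v) (act g \<circ> w)"
    using g by (simp add: brV_def fun_eq_iff act_simps act_\<kappa>_apply)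
  ultimately show ?thesis using S_aut_uc[OF g] by (simp add: star_def S_aut_def)
qed

definition L :: "('g \<Rightarrow> 's) set" where
  "L = {v \<in> V. \<forall>g\<in>carrier G. star g v = v}"

lemma L_V [simp]: "v \<in> L \<Longrightarrow> v \<in> V"
  and star_L: "v \<in> L \<Longrightarrow> g \<in> carrier G \<Longrightarrow> star g v = v"
  by (simp_all add: L_def)

lemma L_closed: "v \<in> L \<Longrightarrow> w \<in> L \<Longrightarrow> v + w \<in> L" "v \<in> L \<Longrightarrow> smul (\<iota> r) v \<in> L"
  "v \<in> L \<Longrightarrow> w \<in> L \<Longrightarrow> brV v w \<in> L"
  by (simp_all add: L_def star_add star_smul star_brV act_\<iota> del: L_V)

abbreviation "Lu \<equiv> twisted_form sg br \<kappa> G act u"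

lemma twisted_form_eq: "Lu = point ` L"
proof -
  have "point v \<in> Lu \<longleftrightarrow> v \<in> L" if "v \<in> V" for v
    using that by (simp add: twisted_form_def L_def star_def act_point u_point del: L_V)
  moreover have "Lu \<subseteq> point ` V" by (auto simp: twisted_form_def carrier_gS)
  ultimately show ?thesis using L_V by blast
qed

lemma point_in_Lu: "v \<in> V \<Longrightarrow> point v \<in> Lu \<longleftrightarrow> v \<in> L"
  by (auto simp: twisted_form_eq)

definition twist where
  "twist g x = uce_lift sg br \<kappa> (u g) (uce_map sg \<kappa> (act g) x)"

lemma uce_lift_el:
  "g \<in> carrier G \<Longrightarrow> v \<in> V \<Longrightarrow> uce_lift sg br \<kappa> (u g) (el v z) = el (uc g v) (shift (uc g) v + z)"
  using uce_lift_eq[OF u_Aut] lift_el[of v "uc g"] by (simp add: uc_def[symmetric])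

lemma twist_el: "g \<in> carrier G \<Longrightarrow> v \<in> V \<Longrightarrow>
    twist g (el v z) = el (star g v) (shift (uc g) (act g \<circ> v) + push_form (act g) z)"
  by (simp add: twist_def uce_map_el[OF hom_act act_\<kappa>] uce_lift_el star_def)

lemma uce_hom_twist: "g \<in> carrier G \<Longrightarrow> uce_hom (twist g)"
proof -
  assume g: "g \<in> carrier G"
  have "uce_hom (uce_lift sg br \<kappa> (u g))"
    using uce_lift_eq[OF u_Aut[OF g]] lift_Aut[OF S_aut_uc[OF g]] Aut_uce_hom by (simp add: uc_def)
  then have "uce_hom (\<lambda>x. uce_lift sg br \<kappa> (u g) (uce_map sg \<kappa> (act g) x))"
    by (rule uce_hom_compose) (rule uce_hom_uce_map[OF hom_act[OF g] act_\<kappa>[OF g]])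
  then show ?thesis by (simp add: twist_def[abs_def])
qed

abbreviation "Lhat \<equiv> twisted_uce sg br \<kappa> G act u"

lemma Lhat_iff: "x \<in> Lhat \<longleftrightarrow> x \<in> carrier U \<and> (\<forall>g\<in>carrier G. twist g x = x)"
  by (simp add: twisted_uce_def twist_def)

lemma Lhat_closed:
  assumes "x \<in> Lhat" "y \<in> Lhat"
  shows "ladd U x y \<in> Lhat" "lscale U c x \<in> Lhat" "lbr U x y \<in> Lhat"
proof -
  have "x \<in> carrier U" "y \<in> carrier U" using assms by (simp_all add: Lhat_iff)
  then have "ladd U x y \<in> carrier U" "lscale U c x \<in> carrier U" "lbr U x y \<in> carrier U"
    by (auto simp: carrier_U_el U_el) (metis U_el V_closed brV_in_V)+
  then show "ladd U x y \<in> Lhat" "lscale U c x \<in> Lhat" "lbr U x y \<in> Lhat"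
    using assms uce_hom_twist unfolding Lhat_iff uce_hom_def by simp_all
qed

abbreviation "OmegaR \<equiv> kaehler_map \<kappa> \<iota> ` kaehler_mod_exact \<iota>R"

abbreviation "galois_stable \<equiv> (\<forall>g\<in>carrier G. current_map sg \<kappa> (act g) ` Lu \<subseteq> Lu)"

abbreviation "lifts_preserve \<equiv>
  (\<forall>g\<in>carrier G. uce_lift sg br \<kappa> (u g) ` (Lu \<times> {snd (lzero U)}) \<subseteq> Lu \<times> {snd (lzero U)})"

section \<open>Equivalence of the two conditions\<close>

lemma galois_stable_iff: "galois_stable \<longleftrightarrow> (\<forall>g\<in>carrier G. \<forall>v\<in>L. act g \<circ> v \<in> L)"
  by (simp add: twisted_form_eq image_subset_iff act_point) (simp add: twisted_form_eq[symmetric] point_in_Lu)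

lemma lifts_preserve_iff: "lifts_preserve \<longleftrightarrow> (\<forall>g\<in>carrier G. \<forall>v\<in>L. uc g v \<in> L \<and> shift (uc g) v = 0)"
proof -
  have zero: "snd (lzero U) = coset E 0" by (simp add: lzero_U el_def)
  have "uce_lift sg br \<kappa> (u g) (point v, coset E 0) \<in> Lu \<times> {coset E 0} \<longleftrightarrow> uc g v \<in> L \<and> shift (uc g) v = 0"
    if "g \<in> carrier G" "v \<in> L" for g v
    using that uce_lift_el[of g v 0]
    by (simp add: el_def point_in_Lu coset_eq_iff[OF presents_proj] proj_zero)
  moreover have "Lu \<times> {coset E 0} = (\<lambda>v. (point v, coset E 0)) ` L" by (auto simp: twisted_form_eq)
  ultimately show ?thesis unfolding zero by (simp add: image_subset_iff)
qed

text \<open>With \<open>h = g\<^sup>-\<^sup>1\<close>, the cocycle identity for \<open>1 = h g\<close> at \<open>\<^sup>hv\<close> reads \<open>\<^sup>hv = u\<^sub>h (\<^sup>h(u\<^sub>g v))\<close>, and the right-hand side is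
  \<open>u\<^sub>g v\<close> because \<open>u\<^sub>g v\<close> is invariant under the twisted action.\<close>

lemma act_inv_eq_uc:
  assumes pres: "\<And>g v. g \<in> carrier G \<Longrightarrow> v \<in> L \<Longrightarrow> uc g v \<in> L" and g: "g \<in> carrier G" and v: "v \<in> L"
  shows "act (inv g) \<circ> v = uc g v"
proof -
  let ?h = "inv g"
  have h: "?h \<in> carrier G" using g by simp
  have inv: "act g \<circ> (act ?h \<circ> v) = v" using g by (rule act_comp)
  have "act ?h \<circ> v = uc (?h \<otimes> g) (act ?h \<circ> v)"
    using g v h by (simp add: uc_one)
  also have "\<dots> = star ?h (uc g v)"
    using g v h inv by (subst uc_mult) (simp_all add: star_def)
  also have "\<dots> = uc g v" by (rule star_L[OF pres[OF g v] h])
  finally show ?thesis .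
qed

theorem conditions_equivalent: "(Lhat = Lu \<times> OmegaR \<and> galois_stable) \<longleftrightarrow> lifts_preserve"
proof
  assume L: "Lhat = Lu \<times> OmegaR \<and> galois_stable"
  then have stable: "act g \<circ> v \<in> L" if "g \<in> carrier G" "v \<in> L" for g v
    using that by (simp add: galois_stable_iff)
  have push0: "push_form (act g) 0 = 0" if "g \<in> carrier G" for g
    by (rule additive_zero) (rule push_form_add[OF hom_act[OF that]])
  have "coset E 0 \<in> OmegaR"
  proof -
    have "kaehler_map \<kappa> \<iota> (coset (exact_null \<iota>R) 0) = coset E 0"
      using kaehler_map_coset[OF hom_\<iota>R hom_\<iota> \<kappa>_eq[symmetric], of 0]
        push_form_zero[OF hom_\<iota>] by simp
    then show ?thesis by (metis coset_in_quot imageI kaehler_mod_exact_def)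
  qed
  then have el0: "el v 0 \<in> Lhat" if "v \<in> L" for v
    using L that by (simp add: el_def point_in_Lu)
  have "uc g v \<in> L \<and> shift (uc g) v = 0" if g: "g \<in> carrier G" and v: "v \<in> L" for g v
  proof -
    \<comment> \<open>\<open>twist g\<close> at \<open>g\<^sup>-\<^sup>1v\<close> has the components \<open>u\<^sub>g v\<close> and \<open>f\<^sub>g v\<close>\<close>
    let ?w = "act (inv g) \<circ> v"
    have w: "?w \<in> L" using g v stable by simp
    have "twist g (el ?w 0) = el ?w 0" using el0[OF w] g by (simp add: Lhat_iff)
    then have "star g ?w = ?w \<and> shift (uc g) v = 0"
      using g v w by (simp add: twist_el el_eq_iff act_comp push0 proj_zero)
    then show ?thesis using w g by (simp add: star_def act_comp)
  qed
  then show lifts_preserve by (simp add: lifts_preserve_iff)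
next
  assume lifts_preserve
  then have pres: "uc g v \<in> L" and shift0: "shift (uc g) v = 0" if "g \<in> carrier G" "v \<in> L" for g v
    using that by (auto simp: lifts_preserve_iff)
  have stable: "act g \<circ> v \<in> L" if "g \<in> carrier G" "v \<in> L" for g v
    using act_inv_eq_uc[OF pres, of "inv g" v] pres[of "inv g" v] that by simp
  have "el v z \<in> Lhat \<longleftrightarrow> v \<in> L \<and> coset E z \<in> OmegaR" if v: "v \<in> V" for v z
  proof -
    have "el v z \<in> Lhat \<longleftrightarrow> v \<in> L \<and> (\<forall>g\<in>carrier G. proj (push_form (act g) z) = proj z)"
    proof (cases "v \<in> L")
      case True
      then show ?thesis
        using v shift0[OF _ stable] by (simp add: Lhat_iff twist_el el_eq_iff star_L)
    next
      case False
      then obtain g where "g \<in> carrier G" "star g v \<noteq> v" using v by (auto simp: L_def simp del: L_V)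
      then show ?thesis using False v by (auto simp: Lhat_iff twist_el el_eq_iff)
    qed
    also have "\<dots> \<longleftrightarrow> v \<in> L \<and> (\<forall>g\<in>carrier G. kaehler_map \<kappa> (act g) (coset E z) = coset E z)"
      by (simp add: kaehler_map_coset[OF hom hom_act act_\<kappa>] coset_eq_iff[OF presents_proj])
    also have "\<dots> \<longleftrightarrow> v \<in> L \<and> coset E z \<in> OmegaR"
      by (subst invariant_forms) (simp_all add: kaehler_mod_exact_def)
    finally show ?thesis .
  qed
  then have iff: "el v z \<in> Lhat \<longleftrightarrow> el v z \<in> Lu \<times> OmegaR" if "v \<in> V" for v z
    using that by (simp add: el_def point_in_Lu)
  have "OmegaR \<subseteq> range (coset E)"
    using kaehler_map_coset[OF hom_\<iota>R hom_\<iota> \<kappa>_eq[symmetric]] by (auto simp: kaehler_mod_exact_def quot_eq)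
  then have sub: "Lu \<times> OmegaR \<subseteq> carrier U" by (auto simp: carrier_U twisted_form_def)
  have "Lhat = Lu \<times> OmegaR"
  proof (rule Set.set_eqI)
    fix x
    show "x \<in> Lhat \<longleftrightarrow> x \<in> Lu \<times> OmegaR"
    proof (cases "x \<in> carrier U")
      case True
      then show ?thesis using iff by (elim carrier_U_cases) simp
    next
      case False
      then show ?thesis using sub by (meson Lhat_iff subsetD)
    qed
  qed
  then show "Lhat = Lu \<times> OmegaR \<and> galois_stable" using stable by (simp add: galois_stable_iff)
qed

text \<open>If \<open>ad v = 0\<close> then \<open>v\<close> is orthogonal to everything under the Killing form.\<close>

lemma centerless:
  assumes "v \<in> V" "\<And>w. w \<in> V \<Longrightarrow> brV v w = 0"
  shows "v = 0"
proof
  fix b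
  show "v b = 0 b"
  proof (cases "b \<in> basis")
    case True
    have "killing_S v (ten (dual b) 1) = 0" using assms by (simp add: killing_S_eq_trace trace_S_zero)
    moreover have "killing_S v (ten (dual b) 1) = (\<Sum>i\<in>basis. killing_S (ten i (v i)) (ten (dual b) 1))"
      by (subst V_expand[OF assms(1)]) (rule additive_sum[of "\<lambda>v. killing_S v _"], rule killing_S_add)
    moreover have "\<dots> = (\<Sum>i\<in>basis. if i = b then v i else 0)"
      using True by (intro sum.cong refl) (auto simp: killing_S_ten killing_sym[of _ "dual b"] killing_dual \<kappa>)
    ultimately show ?thesis using True by (simp add: zero_fun_apply)
  next
    case False
    then show ?thesis using assms(1) by (simp add: V_def zero_fun_apply)
  qed
qed

section \<open>Descent\<close>

definition star_trace :: "('g \<Rightarrow> 's) \<Rightarrow> 'g \<Rightarrow> 's" where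
  "star_trace v = (\<Sum>g\<in>carrier G. star g v)"

lemma star_sum: "g \<in> carrier G \<Longrightarrow> (\<And>i. i \<in> I \<Longrightarrow> h i \<in> V) \<Longrightarrow> star g (\<Sum>i\<in>I. h i) = (\<Sum>i\<in>I. star g (h i))"
proof (induction I rule: infinite_finite_induct)
  case (insert i I)
  then show ?case by (simp add: star_add V_sum)
qed (use star_smul[of g 0 0] in \<open>simp_all add: act_simps\<close>)

lemma star_trace_in_L: "v \<in> V \<Longrightarrow> star_trace v \<in> L"
proof -
  assume v: "v \<in> V"
  have "star h (star_trace v) = star_trace v" if h: "h \<in> carrier G" for h
  proof -
    have "star h (star_trace v) = (\<Sum>g\<in>carrier G. star (h \<otimes> g) v)"
      unfolding star_trace_def using h v by (simp add: star_sum star_mult)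
    also have "\<dots> = star_trace v"
      unfolding star_trace_def by (rule sum_translate[OF h, of "\<lambda>g. star g v"])
    finally show ?thesis .
  qed
  then show ?thesis unfolding L_def using v by (simp add: star_trace_def V_sum)
qed

lemma star_trace_smul: "v \<in> L \<Longrightarrow> star_trace (smul a v) = smul (tr a) v"
  by (simp add: star_trace_def star_smul star_L tr_def smul_sum_left)

lemma star_trace_add: "v \<in> V \<Longrightarrow> w \<in> V \<Longrightarrow> star_trace (v + w) = star_trace v + star_trace w"
  by (simp add: star_trace_def star_add sum.distrib)

text \<open>The sum over \<open>i\<close> and \<open>g\<close> of \<open>a\<^sub>i star g (b\<^sub>i v)\<close> is, by semilinearity, the sum over \<open>g\<close> of
  \<open>(\<Sum> a\<^sub>i \<^sup>gb\<^sub>i) star g v\<close>, of which only the term \<open>v\<close> at \<open>g = 1\<close> remains.\<close>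

lemma dual_system_expand_V:
  obtains I :: "('s \<times> 's) set" and a b where "finite I"
    "\<And>x. (\<Sum>i\<in>I. a i * tr (b i * x)) = x"
    "\<And>v. v \<in> V \<Longrightarrow> (\<Sum>i\<in>I. smul (a i) (star_trace (smul (b i) v))) = v"
proof -
  obtain I :: "('s \<times> 's) set" and a b where fin: "finite I" and
    ab: "\<And>g. g \<in> carrier G \<Longrightarrow> (\<Sum>i\<in>I. a i * act g (b i)) = (if g = \<one> then 1 else 0)"
    using dual_system by metis
  show thesis
  proof (rule that[OF fin])
    show "(\<Sum>i\<in>I. a i * tr (b i * x)) = x" for x by (rule dual_system_expand[OF ab])
  next
    fix v assume v: "v \<in> V"
    have "(\<Sum>i\<in>I. smul (a i) (star_trace (smul (b i) v))) =
        (\<Sum>g\<in>carrier G. smul (\<Sum>i\<in>I. a i * act g (b i)) (star g v))"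
      unfolding star_trace_def smul_sum smul_sum_left using v
      by (subst sum.swap) (simp add: star_smul)
    also have "\<dots> = (\<Sum>g\<in>carrier G. if g = \<one> then v else 0)"
      using v by (intro sum.cong refl) (auto simp: ab star_one)
    finally show "(\<Sum>i\<in>I. smul (a i) (star_trace (smul (b i) v))) = v" by simp
  qed
qed

text \<open>Every \<open>v\<close> is an \<open>S\<close>-combination of the invariant vectors \<open>star_trace (smul (b i) v)\<close>.\<close>

lemma descent_induct [consumes 1, case_names zero add smul]:
  assumes "v \<in> V" "P 0" "\<And>v w. v \<in> V \<Longrightarrow> w \<in> V \<Longrightarrow> P v \<Longrightarrow> P w \<Longrightarrow> P (v + w)"
    "\<And>s w. w \<in> L \<Longrightarrow> P (smul s w)"
  shows "P v"
proof -
  obtain I :: "('s \<times> 's) set" and a b where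
    exp: "\<And>v. v \<in> V \<Longrightarrow> (\<Sum>i\<in>I. smul (a i) (star_trace (smul (b i) v))) = v"
    by (rule dual_system_expand_V) blast
  have "(\<Sum>i\<in>A. smul (a i) (star_trace (smul (b i) v))) \<in> V \<and> P (\<Sum>i\<in>A. smul (a i) (star_trace (smul (b i) v)))" for A
    by (induction A rule: infinite_finite_induct) (simp_all add: assms star_trace_in_L)
  then show ?thesis using exp[OF assms(1)] by metis
qed

definition L_linear :: "(('g \<Rightarrow> 's) \<Rightarrow> 'g \<Rightarrow> 's) \<Rightarrow> bool" where
  "L_linear f \<longleftrightarrow> (\<forall>v\<in>L. f v \<in> L) \<and> (\<forall>v\<in>L. \<forall>w\<in>L. f (v + w) = f v + f w) \<and>
     (\<forall>r. \<forall>v\<in>L. f (smul (\<iota> r) v) = smul (\<iota> r) (f v))"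

text \<open>The \<open>S\<close>-linear extension must be \<open>v \<mapsto> \<Sum> a\<^sub>i f (star_trace (b\<^sub>i v))\<close>. On \<open>s v\<close> with \<open>v\<close> invariant this is \<open>\<Sum> a\<^sub>i tr (b\<^sub>i s) f v = s f v\<close>.\<close>

lemma linear_extension:
  assumes f: "L_linear f"
  obtains \<eta> where "S_linear \<eta>" "\<And>s v. v \<in> L \<Longrightarrow> \<eta> (smul s v) = smul s (f v)"
proof -
  have fL: "\<And>v. v \<in> L \<Longrightarrow> f v \<in> L" and f_add: "\<And>v w. v \<in> L \<Longrightarrow> w \<in> L \<Longrightarrow> f (v + w) = f v + f w"
    and f_scale: "\<And>r v. v \<in> L \<Longrightarrow> f (smul (\<iota> r) v) = smul (\<iota> r) (f v)"
    using f unfolding L_linear_def by auto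
  obtain I :: "('s \<times> 's) set" and a b where exp: "\<And>x. (\<Sum>i\<in>I. a i * tr (b i * x)) = x"
    by (rule dual_system_expand_V) blast
  define \<eta> where "\<eta> v = (\<Sum>i\<in>I. smul (a i) (f (star_trace (smul (b i) v))))" for v
  have \<eta>: "\<eta> (smul s v) = smul s (f v)" if v: "v \<in> L" for s v
  proof -
    have tr: "f (smul (tr x) v) = smul (tr x) (f v)" for x
    proof -
      obtain r where "tr x = \<iota> r" using tr_in_range by blast
      then show ?thesis using f_scale[OF v] by simp
    qed
    have "\<eta> (smul s v) = smul (\<Sum>i\<in>I. a i * tr (b i * s)) (f v)"
      unfolding \<eta>_def smul_sum_left by (simp add: star_trace_smul[OF v] tr)
    then show ?thesis by (simp add: exp)
  qed
  have add: "\<eta> (v + w) = \<eta> v + \<eta> w" if "v \<in> V" "w \<in> V" for v w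
    using that by (simp add: \<eta>_def star_trace_add f_add star_trace_in_L sum.distrib)
  have \<eta>V: "\<eta> v \<in> V" if "v \<in> V" for v
    using that by (simp add: \<eta>_def V_sum fL star_trace_in_L)
  have \<eta>0: "\<eta> 0 = 0" using add[of 0 0] by simp
  have "\<eta> (smul t v) = smul t (\<eta> v)" if "v \<in> V" for t v
    using that by (induction rule: descent_induct) (simp_all add: \<eta>0 add \<eta>)
  then have "S_linear \<eta>" unfolding S_linear_def using add \<eta>V by blast
  then show thesis using \<eta> that by blast
qed

lemma automorphism_extension:
  assumes f: "L_linear f" and bij: "bij_betw f L L"
    and br: "\<And>v w. v \<in> L \<Longrightarrow> w \<in> L \<Longrightarrow> f (brV v w) = brV (f v) (f w)"
  obtains \<eta> where "S_aut \<eta>" "\<And>v. v \<in> L \<Longrightarrow> \<eta> v = f v"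
    "\<And>g v. g \<in> carrier G \<Longrightarrow> v \<in> V \<Longrightarrow> \<eta> (star g v) = star g (\<eta> v)"
proof -
  have fL: "\<And>v. v \<in> L \<Longrightarrow> f v \<in> L" and f_add: "\<And>v w. v \<in> L \<Longrightarrow> w \<in> L \<Longrightarrow> f (v + w) = f v + f w"
    and f_scale: "\<And>r v. v \<in> L \<Longrightarrow> f (smul (\<iota> r) v) = smul (\<iota> r) (f v)"
    using f unfolding L_linear_def by auto
  obtain \<eta> where S_linear: "S_linear \<eta>" and \<eta>: "\<And>s v. v \<in> L \<Longrightarrow> \<eta> (smul s v) = smul s (f v)"
    by (rule linear_extension[OF f]) blast
  note linD = S_linearD(1-3)[OF S_linear] S_linearD(4)[OF S_linear V_closed(1)]
  define f' where "f' = inv_into L f"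
  have f': "f' v \<in> L" "f (f' v) = v" "f' (f v) = v" if "v \<in> L" for v
    using that bij fL unfolding f'_def
    by (simp_all add: bij_betw_def inv_into_into f_inv_into_f bij_betw_inv_into_left)
  have "L_linear f'"
    unfolding L_linear_def
  proof (intro conjI ballI allI)
    fix v w r assume v: "v \<in> L"
    show "f' v \<in> L" using v by (rule f')
    have "f (smul (\<iota> r) (f' v)) = smul (\<iota> r) v" using v by (simp add: f_scale f')
    then show "f' (smul (\<iota> r) v) = smul (\<iota> r) (f' v)"
      using f'(3)[OF L_closed(2)[OF f'(1)[OF v]], of r] by simp
    assume w: "w \<in> L"
    have "f (f' v + f' w) = v + w" using v w by (simp add: f_add f')
    then show "f' (v + w) = f' v + f' w"
      using f'(3)[OF L_closed(1)[OF f'(1)[OF v] f'(1)[OF w]]] by simp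
  qed
  then obtain \<eta>' where SL': "S_linear \<eta>'" and \<eta>': "\<And>s v. v \<in> L \<Longrightarrow> \<eta>' (smul s v) = smul s (f' v)"
    by (rule linear_extension) blast
  note SLD' = S_linearD(1-3)[OF SL'] S_linearD(4)[OF SL' V_closed(1)]
  have \<eta>_L: "\<eta> v = f v" "\<eta>' v = f' v" if "v \<in> L" for v
    using \<eta>[OF that, of 1] \<eta>'[OF that, of 1] by simp_all
  have "\<eta>' (\<eta> v) = v" if "v \<in> V" for v
    using that by (induction rule: descent_induct) (simp_all add: linD SLD' \<eta>_L fL f')
  moreover have "\<eta> (\<eta>' v) = v" if "v \<in> V" for v
    using that by (induction rule: descent_induct) (simp_all add: linD SLD' \<eta>_L fL f')
  ultimately have bij\<eta>: "bij_betw \<eta> V V"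
    by (intro bij_betw_byWitness[of V \<eta>']) (auto simp: linD SLD')
  have "\<eta> (brV v w) = brV (\<eta> v) (\<eta> w)" if "v \<in> V" "w \<in> V" for v w
    using that(1)
  proof (induction rule: descent_induct)
    case (smul s v)
    show ?case using that(2)
    proof (induction rule: descent_induct)
      case (smul t w)
      then show ?case using \<open>v \<in> L\<close> by (simp add: brV_smul \<eta> L_closed br)
    qed (simp_all add: brV_add linD)
  qed (simp_all add: brV_add linD)
  then have VA: "S_aut \<eta>" using S_linear bij\<eta> unfolding S_aut_def by blast
  have "\<eta> (star g v) = star g (\<eta> v)" if g: "g \<in> carrier G" and v: "v \<in> V" for g v
    using v
  proof (induction rule: descent_induct)
    case zero
    have "star g 0 = 0" using star_smul[OF g, of 0 0] by (simp add: unital_ring_homD[OF hom_act[OF g]])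
    then show ?case by (simp add: linD)
  next
    case (smul s w)
    then show ?case using g by (simp add: star_smul \<eta> star_L fL)
  qed (simp add: linD star_add g)
  then show thesis using VA \<eta>_L(1) that by blast
qed

section \<open>Lifting automorphisms of the twisted form\<close>

text \<open>The lift of the \<open>S\<close>-linear extension \<open>\<eta>\<close> of \<open>\<theta>\<close> commutes with every \<open>twist g\<close>, as both composites are homomorphisms over
  the same map of \<open>g\<^sub>S\<close>. So it permutes the common fixed points of the twists.\<close>

theorem automorphism_lifts:
  assumes pres: lifts_preserve and \<theta>: "\<theta> \<in> Aut (restrict_scalars \<iota> gS\<lparr>carrier := Lu\<rparr>)"
  shows "\<exists>\<theta>'\<in>Aut (U\<lparr>carrier := Lhat\<rparr>). (\<forall>x\<in>Lhat. fst (\<theta>' x) = \<theta> (fst x)) \<and>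
    (\<forall>z\<in>center (U\<lparr>carrier := Lhat\<rparr>). \<theta>' z = z)"
proof -
  have Lhat_eq: "Lhat = Lu \<times> OmegaR" using pres conditions_equivalent by blast
  have bij: "bij_betw \<theta> Lu Lu"
    and \<theta>_add: "\<And>x y. x \<in> Lu \<Longrightarrow> y \<in> Lu \<Longrightarrow> \<theta> (ladd gS x y) = ladd gS (\<theta> x) (\<theta> y)"
    and \<theta>_scale: "\<And>r x. x \<in> Lu \<Longrightarrow> \<theta> (lscale gS (\<iota> r) x) = lscale gS (\<iota> r) (\<theta> x)"
    and \<theta>_br: "\<And>x y. x \<in> Lu \<Longrightarrow> y \<in> Lu \<Longrightarrow> \<theta> (lbr gS x y) = lbr gS (\<theta> x) (\<theta> y)"
    using \<theta> unfolding Aut_def Bij_def by (simp_all add: restrict_scalars_def)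
  define f where "f = in_coords \<theta>"
  have LV: "L \<subseteq> V" by auto
  note f_bij = bij_in_coords[OF LV, of \<theta>, folded twisted_form_eq f_def, OF bij]
  note f = f_bij(2,3)
  note Lu = point_in_Lu[THEN iffD2]
  have "L_linear f"
    unfolding L_linear_def
  proof (intro conjI ballI allI)
    fix v w r assume v: "v \<in> L"
    show "f v \<in> L" using v by (rule f)
    have "point (f (smul (\<iota> r) v)) = point (smul (\<iota> r) (f v))"
      using \<theta>_scale[of "point v" r] v f by (simp add: Lu lscale_gS L_closed)
    then show "f (smul (\<iota> r) v) = smul (\<iota> r) (f v)" using v f L_closed by simp
    assume w: "w \<in> L"
    have "point (f (v + w)) = point (f v + f w)"
      using \<theta>_add[of "point v" "point w"] v w f by (simp add: Lu ladd_gS L_closed)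
    then show "f (v + w) = f v + f w" using v w f L_closed by simp
  qed
  moreover note f_bij(1)
  moreover have "f (brV v w) = brV (f v) (f w)" if "v \<in> L" "w \<in> L" for v w
  proof -
    have "point (f (brV v w)) = point (brV (f v) (f w))"
      using \<theta>_br[of "point v" "point w"] that f by (simp add: Lu lbr_gS L_closed)
    then show ?thesis using that f L_closed by simp
  qed
  ultimately obtain \<eta> where \<eta>: "S_aut \<eta>" and \<eta>f: "\<And>v. v \<in> L \<Longrightarrow> \<eta> v = f v"
    and \<eta>_star: "\<And>g v. g \<in> carrier G \<Longrightarrow> v \<in> V \<Longrightarrow> \<eta> (star g v) = star g (\<eta> v)"
    by (rule automorphism_extension) blast+
  have \<eta>V: "\<eta> v \<in> V" if "v \<in> V" for v using \<eta> that unfolding S_aut_def by (auto dest: S_linearD)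
  have \<eta>0: "\<eta> 0 = 0" using \<eta> S_linearD(4)[OF _ V_closed(1)] unfolding S_aut_def by blast
  note lift = lift_Aut[OF \<eta>]
  have bijU: "bij_betw (lift \<eta>) (carrier U) (carrier U)" and homU: "uce_hom (lift \<eta>)"
    using lift Aut_uce_hom[OF lift] unfolding Aut_def Bij_def by auto
  have commute: "lift \<eta> (twist g x) = twist g (lift \<eta> x)" if g: "g \<in> carrier G" and x: "x \<in> carrier U" for g x
  proof (rule uce_hom_unique[OF uce_hom_compose[OF homU uce_hom_twist[OF g]] uce_hom_compose[OF uce_hom_twist[OF g] homU] _ x])
    fix y assume "y \<in> carrier U"
    then obtain v z where "y = el v z" "v \<in> V" by (elim carrier_U_cases)
    then show "fst (lift \<eta> (twist g y)) = fst (twist g (lift \<eta> y))"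
      using g by (simp add: twist_el lift_el \<eta>V \<eta>_star)
  qed
  have Lhat_lift: "lift \<eta> x \<in> Lhat \<longleftrightarrow> x \<in> Lhat" if x: "x \<in> carrier U" for x
  proof -
    have lx: "lift \<eta> x \<in> carrier U" using bijU x by (auto simp: bij_betw_def)
    have tx: "twist g x \<in> carrier U" if "g \<in> carrier G" for g
      using uce_hom_twist[OF that] x unfolding uce_hom_def by blast
    have "twist g (lift \<eta> x) = lift \<eta> x \<longleftrightarrow> twist g x = x" if "g \<in> carrier G" for g
      using bijU inj_on_eq_iff[of "lift \<eta>" "carrier U" "twist g x" x] x tx[OF that] that
      by (simp add: commute[symmetric] bij_betw_def)
    then show ?thesis using lx x by (simp add: Lhat_iff)
  qed
  have sub: "Lhat \<subseteq> carrier U" by (auto simp: Lhat_iff)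
  have "lift \<eta> ` Lhat = Lhat"
  proof
    show "lift \<eta> ` Lhat \<subseteq> Lhat" using sub Lhat_lift by auto
    show "Lhat \<subseteq> lift \<eta> ` Lhat"
    proof
      fix y assume y: "y \<in> Lhat"
      then have "y \<in> lift \<eta> ` carrier U" using sub bijU by (auto simp: bij_betw_def)
      then obtain x where "x \<in> carrier U" "y = lift \<eta> x" by auto
      then show "y \<in> lift \<eta> ` Lhat" using y Lhat_lift by blast
    qed
  qed
  moreover have "inj_on (lift \<eta>) Lhat"
    using bijU sub by (auto simp: bij_betw_def intro: inj_on_subset)
  ultimately have bijL: "bij_betw (lift \<eta>) Lhat Lhat" by (simp add: bij_betw_def)
  define \<theta>' where "\<theta>' = restrict (lift \<eta>) Lhat"
  have "\<theta>' \<in> Bij Lhat"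
    using bijL unfolding Bij_def \<theta>'_def by (simp add: bij_betw_restrict_eq)
  then have "\<theta>' \<in> Aut (U\<lparr>carrier := Lhat\<rparr>)"
    using homU subsetD[OF sub] unfolding Aut_def uce_hom_def
    by (simp add: \<theta>'_def Lhat_closed)
  moreover have "fst (\<theta>' x) = \<theta> (fst x)" if x: "x \<in> Lhat" for x
  proof -
    obtain v z where v: "x = el v z" "v \<in> V" using subsetD[OF sub x] by (elim carrier_U_cases)
    have "v \<in> L" using x unfolding Lhat_eq v by (simp add: el_def point_in_Lu[OF v(2)])
    then show ?thesis using x v by (simp add: \<theta>'_def lift_el \<eta>V \<eta>f f)
  qed
  moreover have "\<theta>' y = y" if y: "y \<in> center (U\<lparr>carrier := Lhat\<rparr>)" for y
  proof -
    have yL: "y \<in> Lhat" and cent: "\<And>x. x \<in> Lhat \<Longrightarrow> lbr U y x = lzero U"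
      using y by (auto simp: center_def)
    obtain v z where v: "y = el v z" "v \<in> V" using subsetD[OF sub yL] by (elim carrier_U_cases)
    obtain Z where Z: "Z \<in> OmegaR" using yL unfolding Lhat_eq by auto
    have brL: "brV v w = 0" if w: "w \<in> L" for w
    proof -
      have pL: "(point w, Z) \<in> Lhat" using w Z by (simp add: Lhat_eq Lu)
      then obtain t where "Z = coset E t" using sub by (auto simp: carrier_U)
      then have "(point w, Z) = el w t" by (simp add: el_def)
      then have "lbr U (el v z) (el w t) = lzero U"
        using cent[OF pL] v by simp
      then show ?thesis using v w by (simp add: lbr_U lzero_U el_eq_iff)
    qed
    have "brV v w = 0" if "w \<in> V" for w
      using that by (induction rule: descent_induct) (simp_all add: brV_add brV_smul brL)
    then have "v = 0" using centerless v(2) by blast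
    then show ?thesis using yL v by (simp add: \<theta>'_def lift_el \<eta>0)
  qed
  ultimately show ?thesis by blast
qed

end

theorem proposition23:
  fixes sg :: "'k::field_char_0 \<Rightarrow> 'g::ab_group_add \<Rightarrow> 'g"
    and br :: "'g \<Rightarrow> 'g \<Rightarrow> 'g"
    and \<iota>\<^sub>R :: "'k \<Rightarrow> 'r::{comm_ring,comm_monoid_mult}"
    and \<iota>\<^sub>S :: "'r \<Rightarrow> 's::{comm_ring,comm_monoid_mult}"
    and G :: "('c, 'm) monoid_scheme"
    and act :: "'c \<Rightarrow> 's \<Rightarrow> 's"
    and u :: "'c \<Rightarrow> ('g \<times> 's \<Rightarrow>\<^sub>0 'k) set \<Rightarrow> ('g \<times> 's \<Rightarrow>\<^sub>0 'k) set"
  assumes "lie_algebra sg br"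
    and "lie_algebra.finite_dim sg"
    and "lie_algebra.simple sg br"
    and "lie_algebra.split sg br"
    and "unital_ring_hom \<iota>\<^sub>R"
    and "galois_extension \<iota>\<^sub>S G act"
    and "cocycle sg br (\<iota>\<^sub>S \<circ> \<iota>\<^sub>R) G act u"
  shows "let \<kappa> = \<iota>\<^sub>S \<circ> \<iota>\<^sub>R;
             gS = current_algebra sg br \<kappa>;
             gS_hat = uce sg br \<kappa>;
             L\<^sub>u = twisted_form sg br \<kappa> G act u;
             L\<^sub>u_hat = twisted_uce sg br \<kappa> G act u;
             \<Omega>\<^sub>R = kaehler_map \<kappa> \<iota>\<^sub>S ` kaehler_mod_exact \<iota>\<^sub>R;
             zero\<^sub>\<Omega> = snd (lzero gS_hat);
             cond1 = (L\<^sub>u_hat = L\<^sub>u \<times> \<Omega>\<^sub>R \<and> (\<forall>g\<in>carrier G. current_map sg \<kappa> (act g) ` L\<^sub>u \<subseteq> L\<^sub>u));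
             cond2 = (\<forall>g\<in>carrier G. uce_lift sg br \<kappa> (u g) ` (L\<^sub>u \<times> {zero\<^sub>\<Omega>}) \<subseteq> L\<^sub>u \<times> {zero\<^sub>\<Omega>});
             LR = restrict_scalars \<iota>\<^sub>S gS\<lparr>carrier := L\<^sub>u\<rparr>;
             LK_hat = gS_hat\<lparr>carrier := L\<^sub>u_hat\<rparr>
         in (cond1 \<longleftrightarrow> cond2) \<and>
            (cond1 \<and> cond2 \<longrightarrow>
               (\<forall>\<theta>\<in>Aut LR. \<exists>\<theta>_hat\<in>Aut LK_hat.
                  (\<forall>x\<in>L\<^sub>u_hat. fst (\<theta>_hat x) = \<theta> (fst x)) \<and>
                  (\<forall>z\<in>center LK_hat. \<theta>_hat z = z)))"
proof -
  interpret lie_algebra sg br by fact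
  have hom: "unital_ring_hom (\<iota>\<^sub>S \<circ> \<iota>\<^sub>R)"
    using assms(5,6) by (intro unital_ring_hom_comp) (auto simp: galois_extension_def)
  interpret galois_twist sg br "\<iota>\<^sub>S \<circ> \<iota>\<^sub>R" \<iota>\<^sub>S G act \<iota>\<^sub>R u
    by unfold_locales (use assms hom in auto)
  show ?thesis
    unfolding Let_def
  proof (rule conjI, rule conditions_equivalent, intro impI ballI, elim conjE)
  qed (rule automorphism_lifts)
qed

end
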